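(* Let $(\mathcal{C},\iota,\lambda)$ be a category with conjugation, $(\mathcal{C}',\iota',\lambda')$ its double and $(\mathcal{C}'',\iota'',\lambda'')$ the double of its double. The morphisms of categories with conjugation $(\Theta,\theta)\colon(\mathcal{C}'',\iota'',\lambda'')\to(\mathcal{C},\iota,\lambda)$ and $(\Psi,\psi)\colon(\mathcal{C},\iota,\lambda)\to(\mathcal{C}'',\iota'',\lambda'')$ define an equivalence of categories with conjugation $(\mathcal{C},\iota,\lambda)\equiv(\mathcal{C}'',\iota'',\lambda'')$. Moreover, up to natural isomorphisms, $G'\Psi\cong F$ as functors $\mathcal{C}\to\mathcal{C}'$, and $\Theta F'\cong G$ as functors $\mathcal{C}'\to\mathcal{C}$.
   Context: Throughout, $k$ is a commutative ring in which $2$ is invertible, $\mathcal{C}$ is an additive $k$-linear category that is pseudo-abelian (every idempotent endomorphism splits), and all functors are $k$-linear. Composition is written by juxtaposition; $1_C$ is the identity of $C$. A conjugation on $\mathcal{C}$ is a pair $(\iota,\lambda)$ where $\iota\colon\mathcal{C}\to\mathcal{C}$ is a covariant functor and $\lambda\colon\iota\iota\Rightarrow\mathrm{Id}_{\mathcal{C}}$ is a natural isomorphism with $\lambda_{\iota(C)}=\iota(\lambda_C)$ for all objects $C$. A morphism of categories with conjugation $(\mathcal{C}_1,\iota_1,\lambda_1)\to(\mathcal{C}_2,\iota_2,\lambda_2)$ is a pair $(R,\tau)$ of a covariant functor $R\colon\mathcal{C}_1\to\mathcal{C}_2$ and a natural isomorphism $\tau\colon R\iota_1\Rightarrow\iota_2R$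 such that $(\lambda_2)_{R(C)}\,\iota_2(\tau_C)=R((\lambda_1)_C)\,\tau^{-1}_{\iota_1(C)}$ for all $C$. The composite of $(R_1,\tau_1)$ followed by $(R_2,\tau_2)$ is $R_2R_1$ with the natural isomorphism $C\mapsto(\tau_2)_{R_1(C)}\,R_2((\tau_1)_C)$; the identity morphism is the identity functor with the identity natural isomorphism. A natural isomorphism of morphisms of categories with conjugation $(R,\tau)\Rightarrow(S,\sigma)$ is a natural isomorphism $\rho\colon R\Rightarrow S$ with $\sigma_C\,\rho_{\iota_1(C)}=\iota_2(\rho_C)\,\tau_C$ for all $C$. Two morphisms of categories with conjugation in opposite directions define an equivalence of categories with conjugation if both of their composites are naturally isomorphic, as morphisms of categories with conjugation, to the identity morphisms. The double category $\mathcal{C}'$ has as objects the pairs $(C,f)$ with $C\in\mathcal{C}$ and $f\colon\iota(C)\to C$ an isomorphism with $f\,\iota(f)=\lambda_C$; morphisms $(C,f)\to(D,g)$ are the morphisms $\varphi\colon C\to D$ in $\mathcal{C}$ with $\varphi f=g\,\iota(\varphi)$. It carries the conjugation $\iota'(C,f)=(\iota(C),-\iota(f))$, $\iota'(\varphi)=\iota(\varphi)$, $\lambda'_{(C,f)}=-\lambda_C$. Functors: $F\colon\mathcal{C}\to\mathcal{C}'$, $F(C)=(C\oplus\iota(C),\Lambda_C)$ with $\Lambda_C=\begin{pmatrix}0&\lambda_C\\1_{\iota(C)}&0\end{pmatrix}$, $F(\varphi)=\begin{pmatrix}\varphi&0\\0&\iota(\varphi)\end{pmatrix}$; and $G\colon\mathcal{C}'\to\mathcal{C}$,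 $G(C,f)=C$, $G(\varphi)=\varphi$. The double of $(\mathcal{C}',\iota',\lambda')$ is $(\mathcal{C}'',\iota'',\lambda'')$, with functors $F'\colon\mathcal{C}'\to\mathcal{C}''$ and $G'\colon\mathcal{C}''\to\mathcal{C}'$ defined in the same way from $(\mathcal{C}',\iota',\lambda')$. Objects $((C,f),g)$ of $\mathcal{C}''$ are written $(C,f,g)$. Functor $\Theta\colon\mathcal{C}''\to\mathcal{C}$: for $C''=(C,f,g)\in\mathcal{C}''$ the endomorphism $\frac12(1_C-gf^{-1})$ of $C$ in $\mathcal{C}$ is idempotent; choose an object $\Theta(C'')$ and morphisms $t_{C''}\colon\Theta(C'')\to C$, $s_{C''}\colon C\to\Theta(C'')$ with $s_{C''}t_{C''}=1$ and $t_{C''}s_{C''}=\frac12(1_C-gf^{-1})$; for $\varphi\colon C_1''\to C_2''$ put $\Theta(\varphi)=s_{C_2''}\,\varphi\,t_{C_1''}$. Natural isomorphism $\theta\colon\Theta\iota''\Rightarrow\iota\Theta$: $\theta_{C''}=\iota(s_{C''})\,t_{\iota''(C'')}$ (the canonical identification of two splittings of the same idempotent). Functor $\Psi\colon\mathcal{C}\to\mathcal{C}''$: $\Psi(C)=(C\oplus\iota(C),\Lambda_C,\Delta_C)$ with $\Delta_C=\begin{pmatrix}0&-\lambda_C\\1_{\iota(C)}&0\end{pmatrix}$, and $\Psi(\varphi)=\begin{pmatrix}\varphi&0\\0&\iota(\varphi)\end{pmatrix}$. Natural isomorphism $\psi\colon\Psi\iota\Rightarrow\iota''\Psi$: $\p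si_C=\begin{pmatrix}-1_{\iota(C)}&0\\0&1_{\iota\iota(C)}\end{pmatrix}$.
   Formalization: The natural isomorphism ψ_C is taken to be diag(1, −1) instead of the printed diag(−1, 1); with the printed sign ΘΨ carries −1 instead of 1, and the claim fails e.g. for finite-dimensional Q-vector spaces with ι = Id, λ = 1. *)

theory Defs
  imports "HOL-Algebra.Module"
begin

section \<open>Linear categories\<close>

text \<open>
  Morphisms are indexed by their end points: the hom-sets \<open>Hom C X Y\<close> are modules over \<open>k\<close>
  that need not be disjoint for different pairs \<open>(X, Y)\<close>, so composition and the action of
  functors on morphisms take the objects involved as arguments.  This way a morphism of the double
  category is literally a morphism of the original category.  Only the additive structure of
  \<open>Hom C X Y\<close> is used; the fields \<open>mult\<close> and \<open>one\<close> of its record type carry no information.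

  \<open>comp C X Y Z g f\<close> is the composite \<open>gf\<close> of \<open>f : X \<rightarrow> Y\<close> and \<open>g : Y \<rightarrow> Z\<close>.
\<close>

record ('o, 'm, 'k) lincat =
  Obj :: "'o set"
  Hom :: "'o \<Rightarrow> 'o \<Rightarrow> ('k, 'm) module"
  comp :: "'o \<Rightarrow> 'o \<Rightarrow> 'o \<Rightarrow> 'm \<Rightarrow> 'm \<Rightarrow> 'm"
  Id :: "'o \<Rightarrow> 'm"

abbreviation arr :: "('o, 'm, 'k, 'z) lincat_scheme \<Rightarrow> 'o \<Rightarrow> 'o \<Rightarrow> 'm set" where
  "arr C X Y \<equiv> carrier (Hom C X Y)"

locale linear_category = cring k
  for k :: "'k ring" (structure) +
  fixes C :: "('o, 'm, 'k, 'z) lincat_scheme"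
  assumes hom_module: "\<lbrakk>X \<in> Obj C; Y \<in> Obj C\<rbrakk> \<Longrightarrow> module k (Hom C X Y)"
    and Id_arr: "X \<in> Obj C \<Longrightarrow> Id C X \<in> arr C X X"
    and comp_arr: "\<lbrakk>X \<in> Obj C; Y \<in> Obj C; Z \<in> Obj C; f \<in> arr C X Y; g \<in> arr C Y Z\<rbrakk>
      \<Longrightarrow> comp C X Y Z g f \<in> arr C X Z"
    and comp_assoc: "\<lbrakk>W \<in> Obj C; X \<in> Obj C; Y \<in> Obj C; Z \<in> Obj C;
        f \<in> arr C W X; g \<in> arr C X Y; h \<in> arr C Y Z\<rbrakk>
      \<Longrightarrow> comp C W X Z (comp C X Y Z h g) f = comp C W Y Z h (comp C W X Y g f)"
    and comp_Id_left: "\<lbrakk>X \<in> Obj C; Y \<in> Obj C; f \<in> arr C X Y\<rbrakk> \<Longrightarrow> comp C X Y Y (Id C Y) f = f"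
    and comp_Id_right: "\<lbrakk>X \<in> Obj C; Y \<in> Obj C; f \<in> arr C X Y\<rbrakk> \<Longrightarrow> comp C X X Y f (Id C X) = f"
    and comp_add_left: "\<lbrakk>X \<in> Obj C; Y \<in> Obj C; Z \<in> Obj C;
        f \<in> arr C X Y; g \<in> arr C Y Z; h \<in> arr C Y Z\<rbrakk>
      \<Longrightarrow> comp C X Y Z (g \<oplus>\<^bsub>Hom C Y Z\<^esub> h) f
          = comp C X Y Z g f \<oplus>\<^bsub>Hom C X Z\<^esub> comp C X Y Z h f"
    and comp_add_right: "\<lbrakk>X \<in> Obj C; Y \<in> Obj C; Z \<in> Obj C;
        f \<in> arr C X Y; g \<in> arr C X Y; h \<in> arr C Y Z\<rbrakk>
      \<Longrightarrow> comp C X Y Z h (f \<oplus>\<^bsub>Hom C X Y\<^esub> g)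
          = comp C X Y Z h f \<oplus>\<^bsub>Hom C X Z\<^esub> comp C X Y Z h g"
    and comp_smult_left: "\<lbrakk>X \<in> Obj C; Y \<in> Obj C; Z \<in> Obj C; a \<in> carrier k;
        f \<in> arr C X Y; g \<in> arr C Y Z\<rbrakk>
      \<Longrightarrow> comp C X Y Z (a \<odot>\<^bsub>Hom C Y Z\<^esub> g) f = a \<odot>\<^bsub>Hom C X Z\<^esub> comp C X Y Z g f"
    and comp_smult_right: "\<lbrakk>X \<in> Obj C; Y \<in> Obj C; Z \<in> Obj C; a \<in> carrier k;
        f \<in> arr C X Y; g \<in> arr C Y Z\<rbrakk>
      \<Longrightarrow> comp C X Y Z g (a \<odot>\<^bsub>Hom C X Y\<^esub> f) = a \<odot>\<^bsub>Hom C X Z\<^esub> comp C X Y Z g f"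

definition inverse_arrs :: "('o, 'm, 'k, 'z) lincat_scheme \<Rightarrow> 'o \<Rightarrow> 'o \<Rightarrow> 'm \<Rightarrow> 'm \<Rightarrow> bool" where
  "inverse_arrs C X Y f g \<longleftrightarrow> f \<in> arr C X Y \<and> g \<in> arr C Y X \<and>
     comp C X Y X g f = Id C X \<and> comp C Y X Y f g = Id C Y"

definition iso_arr :: "('o, 'm, 'k, 'z) lincat_scheme \<Rightarrow> 'o \<Rightarrow> 'o \<Rightarrow> 'm \<Rightarrow> bool" where
  "iso_arr C X Y f \<longleftrightarrow> (\<exists>g. inverse_arrs C X Y f g)"

definition inv_arr :: "('o, 'm, 'k, 'z) lincat_scheme \<Rightarrow> 'o \<Rightarrow> 'o \<Rightarrow> 'm \<Rightarrow> 'm" where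
  "inv_arr C X Y f = (THE g. inverse_arrs C X Y f g)"

definition zero_object :: "('o, 'm, 'k, 'z) lincat_scheme \<Rightarrow> 'o \<Rightarrow> bool" where
  "zero_object C Z \<longleftrightarrow> Z \<in> Obj C \<and>
     (\<forall>X \<in> Obj C. (\<exists>!f. f \<in> arr C X Z) \<and> (\<exists>!f. f \<in> arr C Z X))"

record ('o, 'm) biprod =
  sum_obj :: 'o
  in1 :: 'm
  in2 :: 'm
  pr1 :: 'm
  pr2 :: 'm

definition is_biproduct ::
    "('o, 'm, 'k, 'z) lincat_scheme \<Rightarrow> 'o \<Rightarrow> 'o \<Rightarrow> ('o, 'm) biprod \<Rightarrow> bool" where
  "is_biproduct C X Y b \<longleftrightarrow> (let S = sum_obj b in
     S \<in> Obj C \<and> in1 b \<in> arr C X S \<and> in2 b \<in> arr C Y S \<and> pr1 b \<in> arr C S X \<and> pr2 b \<in> arr C S Y \<and>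
     comp C X S X (pr1 b) (in1 b) = Id C X \<and>
     comp C Y S Y (pr2 b) (in2 b) = Id C Y \<and>
     comp C Y S X (pr1 b) (in2 b) = \<zero>\<^bsub>Hom C Y X\<^esub> \<and>
     comp C X S Y (pr2 b) (in1 b) = \<zero>\<^bsub>Hom C X Y\<^esub> \<and>
     comp C S X S (in1 b) (pr1 b) \<oplus>\<^bsub>Hom C S S\<^esub> comp C S Y S (in2 b) (pr2 b) = Id C S)"

definition additive_category :: "'k ring \<Rightarrow> ('o, 'm, 'k, 'z) lincat_scheme \<Rightarrow> bool" where
  "additive_category k C \<longleftrightarrow> linear_category k C \<and> (\<exists>Z. zero_object C Z) \<and>
     (\<forall>X \<in> Obj C. \<forall>Y \<in> Obj C. \<exists>b. is_biproduct C X Y b)"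

definition splits ::
    "('o, 'm, 'k, 'z) lincat_scheme \<Rightarrow> 'o \<Rightarrow> 'm \<Rightarrow> 'o \<Rightarrow> 'm \<Rightarrow> 'm \<Rightarrow> bool" where
  "splits C X e Y t s \<longleftrightarrow> Y \<in> Obj C \<and> t \<in> arr C Y X \<and> s \<in> arr C X Y \<and>
     comp C Y X Y s t = Id C Y \<and> comp C X Y X t s = e"

definition pseudo_abelian :: "('o, 'm, 'k, 'z) lincat_scheme \<Rightarrow> bool" where
  "pseudo_abelian C \<longleftrightarrow> (\<forall>X \<in> Obj C. \<forall>e \<in> arr C X X.
     comp C X X X e e = e \<longrightarrow> (\<exists>Y t s. splits C X e Y t s))"


section \<open>Functors and natural isomorphisms\<close>

record ('o1, 'm1, 'o2, 'm2) funct =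
  ob :: "'o1 \<Rightarrow> 'o2"
  mor :: "'o1 \<Rightarrow> 'o1 \<Rightarrow> 'm1 \<Rightarrow> 'm2"

definition linear_functor :: "'k ring \<Rightarrow> ('o1, 'm1, 'k, 'y) lincat_scheme
    \<Rightarrow> ('o2, 'm2, 'k, 'z) lincat_scheme \<Rightarrow> ('o1, 'm1, 'o2, 'm2) funct \<Rightarrow> bool" where
  "linear_functor k C D F \<longleftrightarrow>
     (\<forall>X \<in> Obj C. ob F X \<in> Obj D) \<and>
     (\<forall>X \<in> Obj C. \<forall>Y \<in> Obj C. \<forall>f \<in> arr C X Y. mor F X Y f \<in> arr D (ob F X) (ob F Y)) \<and>
     (\<forall>X \<in> Obj C. mor F X X (Id C X) = Id D (ob F X)) \<and>
     (\<forall>X \<in> Obj C. \<forall>Y \<in> Obj C. \<forall>Z \<in> Obj C. \<forall>f \<in> arr C X Y. \<forall>g \<in> arr C Y Z.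
        mor F X Z (comp C X Y Z g f)
        = comp D (ob F X) (ob F Y) (ob F Z) (mor F Y Z g) (mor F X Y f)) \<and>
     (\<forall>X \<in> Obj C. \<forall>Y \<in> Obj C. \<forall>f \<in> arr C X Y. \<forall>g \<in> arr C X Y.
        mor F X Y (f \<oplus>\<^bsub>Hom C X Y\<^esub> g)
        = mor F X Y f \<oplus>\<^bsub>Hom D (ob F X) (ob F Y)\<^esub> mor F X Y g) \<and>
     (\<forall>X \<in> Obj C. \<forall>Y \<in> Obj C. \<forall>a \<in> carrier k. \<forall>f \<in> arr C X Y.
        mor F X Y (a \<odot>\<^bsub>Hom C X Y\<^esub> f) = a \<odot>\<^bsub>Hom D (ob F X) (ob F Y)\<^esub> mor F X Y f)"

definition id_functor :: "('o, 'm, 'o, 'm) funct" where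
  "id_functor = \<lparr>ob = \<lambda>X. X, mor = \<lambda>X Y f. f\<rparr>"

definition comp_functor :: "('o2, 'm2, 'o3, 'm3) funct \<Rightarrow> ('o1, 'm1, 'o2, 'm2) funct
    \<Rightarrow> ('o1, 'm1, 'o3, 'm3) funct" (infixr \<open>\<circ>\<^sub>F\<close> 55) where
  "G \<circ>\<^sub>F F = \<lparr>ob = \<lambda>X. ob G (ob F X),
             mor = \<lambda>X Y f. mor G (ob F X) (ob F Y) (mor F X Y f)\<rparr>"

definition natural_iso :: "('o1, 'm1, 'k, 'y) lincat_scheme \<Rightarrow> ('o2, 'm2, 'k, 'z) lincat_scheme
    \<Rightarrow> ('o1, 'm1, 'o2, 'm2) funct \<Rightarrow> ('o1, 'm1, 'o2, 'm2) funct \<Rightarrow> ('o1 \<Rightarrow> 'm2) \<Rightarrow> bool" where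
  "natural_iso C D F G \<rho> \<longleftrightarrow>
     (\<forall>X \<in> Obj C. iso_arr D (ob F X) (ob G X) (\<rho> X)) \<and>
     (\<forall>X \<in> Obj C. \<forall>Y \<in> Obj C. \<forall>f \<in> arr C X Y.
        comp D (ob F X) (ob F Y) (ob G Y) (\<rho> Y) (mor F X Y f)
        = comp D (ob F X) (ob G X) (ob G Y) (mor G X Y f) (\<rho> X))"

definition isomorphic_functors :: "'k ring \<Rightarrow> ('o1, 'm1, 'k, 'y) lincat_scheme
    \<Rightarrow> ('o2, 'm2, 'k, 'z) lincat_scheme
    \<Rightarrow> ('o1, 'm1, 'o2, 'm2) funct \<Rightarrow> ('o1, 'm1, 'o2, 'm2) funct \<Rightarrow> bool" where
  "isomorphic_functors k C D F G \<longleftrightarrow> linear_functor k C D F \<and> linear_functor k C D G \<and>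
     (\<exists>\<rho>. natural_iso C D F G \<rho>)"


section \<open>Categories with conjugation\<close>

record ('o, 'm, 'k) conjcat = "('o, 'm, 'k) lincat" +
  conj_functor :: "('o, 'm, 'o, 'm) funct"
  conj_nat :: "'o \<Rightarrow> 'm"

abbreviation cob :: "('o, 'm, 'k) conjcat \<Rightarrow> 'o \<Rightarrow> 'o" where
  "cob A X \<equiv> ob (conj_functor A) X"

abbreviation cmor :: "('o, 'm, 'k) conjcat \<Rightarrow> 'o \<Rightarrow> 'o \<Rightarrow> 'm \<Rightarrow> 'm" where
  "cmor A X Y f \<equiv> mor (conj_functor A) X Y f"

definition category_with_conjugation :: "'k ring \<Rightarrow> ('o, 'm, 'k) conjcat \<Rightarrow> bool" where
  "category_with_conjugation k A \<longleftrightarrow>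
     additive_category k A \<and> pseudo_abelian A \<and>
     linear_functor k A A (conj_functor A) \<and>
     natural_iso A A (conj_functor A \<circ>\<^sub>F conj_functor A) id_functor (conj_nat A) \<and>
     (\<forall>X \<in> Obj A. conj_nat A (cob A X) = cmor A (cob A (cob A X)) X (conj_nat A X))"

text \<open>A morphism of categories with conjugation is a pair \<open>(R, \<tau>)\<close>.\<close>

type_synonym ('o1, 'm1, 'o2, 'm2) conj_pair = "('o1, 'm1, 'o2, 'm2) funct \<times> ('o1 \<Rightarrow> 'm2)"

definition conj_morphism :: "'k ring \<Rightarrow> ('o1, 'm1, 'k) conjcat \<Rightarrow> ('o2, 'm2, 'k) conjcat
    \<Rightarrow> ('o1, 'm1, 'o2, 'm2) conj_pair \<Rightarrow> bool" where
  "conj_morphism k A B P \<longleftrightarrow> (case P of (R, \<tau>) \<Rightarrow>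
     category_with_conjugation k A \<and> category_with_conjugation k B \<and>
     linear_functor k A B R \<and>
     natural_iso A B (R \<circ>\<^sub>F conj_functor A) (conj_functor B \<circ>\<^sub>F R) \<tau> \<and>
     (\<forall>X \<in> Obj A.
        comp B (cob B (ob R (cob A X))) (cob B (cob B (ob R X))) (ob R X)
          (conj_nat B (ob R X))
          (cmor B (ob R (cob A X)) (cob B (ob R X)) (\<tau> X))
        = comp B (cob B (ob R (cob A X))) (ob R (cob A (cob A X))) (ob R X)
          (mor R (cob A (cob A X)) X (conj_nat A X))
          (inv_arr B (ob R (cob A (cob A X))) (cob B (ob R (cob A X))) (\<tau> (cob A X)))))"

definition conj_comp :: "('o1, 'm1, 'k) conjcat \<Rightarrow> ('o2, 'm2, 'k) conjcat
    \<Rightarrow> ('o3, 'm3, 'k) conjcat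
    \<Rightarrow> ('o2, 'm2, 'o3, 'm3) conj_pair \<Rightarrow> ('o1, 'm1, 'o2, 'm2) conj_pair
    \<Rightarrow> ('o1, 'm1, 'o3, 'm3) conj_pair" where
  "conj_comp A1 A2 A3 P2 P1 = (case P1 of (R1, \<tau>1) \<Rightarrow> case P2 of (R2, \<tau>2) \<Rightarrow>
     (R2 \<circ>\<^sub>F R1,
      \<lambda>X. comp A3 (ob R2 (ob R1 (cob A1 X))) (ob R2 (cob A2 (ob R1 X))) (cob A3 (ob R2 (ob R1 X)))
            (\<tau>2 (ob R1 X))
            (mor R2 (ob R1 (cob A1 X)) (cob A2 (ob R1 X)) (\<tau>1 X))))"

definition conj_id :: "('o, 'm, 'k) conjcat \<Rightarrow> ('o, 'm, 'o, 'm) conj_pair" where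
  "conj_id A = (id_functor, \<lambda>X. Id A (cob A X))"

definition conj_natural_iso :: "('o1, 'm1, 'k) conjcat \<Rightarrow> ('o2, 'm2, 'k) conjcat
    \<Rightarrow> ('o1, 'm1, 'o2, 'm2) conj_pair \<Rightarrow> ('o1, 'm1, 'o2, 'm2) conj_pair
    \<Rightarrow> ('o1 \<Rightarrow> 'm2) \<Rightarrow> bool" where
  "conj_natural_iso A B P Q \<rho> \<longleftrightarrow> (case P of (R, \<tau>) \<Rightarrow> case Q of (S, \<sigma>) \<Rightarrow>
     natural_iso A B R S \<rho> \<and>
     (\<forall>X \<in> Obj A.
        comp B (ob R (cob A X)) (ob S (cob A X)) (cob B (ob S X)) (\<sigma> X) (\<rho> (cob A X))
        = comp B (ob R (cob A X)) (cob B (ob R X)) (cob B (ob S X))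
            (cmor B (ob R X) (ob S X) (\<rho> X)) (\<tau> X)))"

definition conj_equivalence :: "'k ring \<Rightarrow> ('o1, 'm1, 'k) conjcat \<Rightarrow> ('o2, 'm2, 'k) conjcat
    \<Rightarrow> ('o1, 'm1, 'o2, 'm2) conj_pair \<Rightarrow> ('o2, 'm2, 'o1, 'm1) conj_pair \<Rightarrow> bool" where
  "conj_equivalence k A B P Q \<longleftrightarrow>
     conj_morphism k A B P \<and> conj_morphism k B A Q \<and>
     (\<exists>\<rho>. conj_natural_iso A A (conj_comp A B A Q P) (conj_id A) \<rho>) \<and>
     (\<exists>\<rho>. conj_natural_iso B B (conj_comp B A B P Q) (conj_id B) \<rho>)"


section \<open>The double category\<close>

text \<open>
  The second component \<open>f : \<iota>(C) \<rightarrow> C\<close> of an object \<open>(C, f)\<close> is a morphism, so the type of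
  objects becomes \<open>'o \<times> 'm\<close> while the type of morphisms does not change.
\<close>

definition double :: "('o, 'm, 'k) conjcat \<Rightarrow> ('o \<times> 'm, 'm, 'k) conjcat" where
  "double A =
     \<lparr>Obj = {(X, f). X \<in> Obj A \<and> iso_arr A (cob A X) X f \<and>
               comp A (cob A (cob A X)) (cob A X) X f (cmor A (cob A X) X f) = conj_nat A X},
      Hom = (\<lambda>(X, f) (Y, g). (Hom A X Y)
               \<lparr>carrier := {\<phi> \<in> arr A X Y.
                  comp A (cob A X) X Y \<phi> f = comp A (cob A X) (cob A Y) Y g (cmor A X Y \<phi>)}\<rparr>),
      comp = (\<lambda>(X, f) (Y, g) (Z, h). comp A X Y Z),
      Id = (\<lambda>(X, f). Id A X),
      conj_functor =
        \<lparr>ob = (\<lambda>(X, f). (cob A X, \<ominus>\<^bsub>Hom A (cob A (cob A X)) (cob A X)\<^esub> cmor A (cob A X) X f)),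
         mor = (\<lambda>(X, f) (Y, g). cmor A X Y)\<rparr>,
      conj_nat = (\<lambda>(X, f). \<ominus>\<^bsub>Hom A (cob A (cob A X)) X\<^esub> conj_nat A X)\<rparr>"

text \<open>
  \<open>matrix C X1 X2 b Y1 Y2 c a11 a12 a21 a22\<close> is the morphism with matrix \<open>(a11 a12; a21 a22)\<close>
  from the biproduct \<open>b\<close> of \<open>X1, X2\<close> to the biproduct \<open>c\<close> of \<open>Y1, Y2\<close>; columns belong to
  the source, thus \<open>aij : Xj \<rightarrow> Yi\<close>.
\<close>

definition matrix :: "('o, 'm, 'k, 'z) lincat_scheme
    \<Rightarrow> 'o \<Rightarrow> 'o \<Rightarrow> ('o, 'm) biprod \<Rightarrow> 'o \<Rightarrow> 'o \<Rightarrow> ('o, 'm) biprod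
    \<Rightarrow> 'm \<Rightarrow> 'm \<Rightarrow> 'm \<Rightarrow> 'm \<Rightarrow> 'm" where
  "matrix C X1 X2 b Y1 Y2 c a11 a12 a21 a22 =
     (let S = sum_obj b; T = sum_obj c;
          entry = (\<lambda>X Y i a p. comp C S Y T i (comp C S X Y a p))
      in (entry X1 Y1 (in1 c) a11 (pr1 b) \<oplus>\<^bsub>Hom C S T\<^esub> entry X2 Y1 (in1 c) a12 (pr2 b))
         \<oplus>\<^bsub>Hom C S T\<^esub>
         (entry X1 Y2 (in2 c) a21 (pr1 b) \<oplus>\<^bsub>Hom C S T\<^esub> entry X2 Y2 (in2 c) a22 (pr2 b)))"

text \<open>The image under \<open>\<iota>\<close> of a biproduct of \<open>X, Y\<close>, used to identify
  \<open>\<iota>(X \<oplus> Y)\<close> with \<open>\<iota>(X) \<oplus> \<iota>(Y)\<close>.\<close>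

definition conj_biprod ::
    "('o, 'm, 'k) conjcat \<Rightarrow> 'o \<Rightarrow> 'o \<Rightarrow> ('o, 'm) biprod \<Rightarrow> ('o, 'm) biprod" where
  "conj_biprod A X Y b =
     \<lparr>sum_obj = cob A (sum_obj b),
      in1 = cmor A X (sum_obj b) (in1 b), in2 = cmor A Y (sum_obj b) (in2 b),
      pr1 = cmor A (sum_obj b) X (pr1 b), pr2 = cmor A (sum_obj b) Y (pr2 b)\<rparr>"

text \<open>A choice \<open>S\<close> of the biproducts \<open>X \<oplus> \<iota>(X)\<close>.\<close>

definition sum_choice :: "('o, 'm, 'k) conjcat \<Rightarrow> ('o \<Rightarrow> ('o, 'm) biprod) \<Rightarrow> bool" where
  "sum_choice A S \<longleftrightarrow> (\<forall>X \<in> Obj A. is_biproduct A X (cob A X) (S X))"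

text \<open>\<open>conj_matrix A S X a b c d : \<iota>(X \<oplus> \<iota>(X)) \<rightarrow> X \<oplus> \<iota>(X)\<close>,
  and \<open>diag A S X Y a d : X \<oplus> \<iota>(X) \<rightarrow> Y \<oplus> \<iota>(Y)\<close>.\<close>

definition conj_matrix ::
    "('o, 'm, 'k) conjcat \<Rightarrow> ('o \<Rightarrow> ('o, 'm) biprod) \<Rightarrow> 'o \<Rightarrow> 'm \<Rightarrow> 'm \<Rightarrow> 'm \<Rightarrow> 'm \<Rightarrow> 'm" where
  "conj_matrix A S X = matrix A (cob A X) (cob A (cob A X)) (conj_biprod A X (cob A X) (S X))
                                X (cob A X) (S X)"

definition diag ::
    "('o, 'm, 'k) conjcat \<Rightarrow> ('o \<Rightarrow> ('o, 'm) biprod) \<Rightarrow> 'o \<Rightarrow> 'o \<Rightarrow> 'm \<Rightarrow> 'm \<Rightarrow> 'm" where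
  "diag A S X Y a d = matrix A X (cob A X) (S X) Y (cob A Y) (S Y)
     a \<zero>\<^bsub>Hom A (cob A X) Y\<^esub> \<zero>\<^bsub>Hom A X (cob A Y)\<^esub> d"

definition Lambda :: "('o, 'm, 'k) conjcat \<Rightarrow> ('o \<Rightarrow> ('o, 'm) biprod) \<Rightarrow> 'o \<Rightarrow> 'm" where
  "Lambda A S X = conj_matrix A S X
     \<zero>\<^bsub>Hom A (cob A X) X\<^esub>   (conj_nat A X)
     (Id A (cob A X))      \<zero>\<^bsub>Hom A (cob A (cob A X)) (cob A X)\<^esub>"

definition Delta :: "('o, 'm, 'k) conjcat \<Rightarrow> ('o \<Rightarrow> ('o, 'm) biprod) \<Rightarrow> 'o \<Rightarrow> 'm" where
  "Delta A S X = conj_matrix A S X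
     \<zero>\<^bsub>Hom A (cob A X) X\<^esub>   (\<ominus>\<^bsub>Hom A (cob A (cob A X)) X\<^esub> conj_nat A X)
     (Id A (cob A X))      \<zero>\<^bsub>Hom A (cob A (cob A X)) (cob A X)\<^esub>"

text \<open>The functors \<open>F : C \<rightarrow> C'\<close> and \<open>G : C' \<rightarrow> C\<close>.\<close>

definition F_functor ::
    "('o, 'm, 'k) conjcat \<Rightarrow> ('o \<Rightarrow> ('o, 'm) biprod) \<Rightarrow> ('o, 'm, 'o \<times> 'm, 'm) funct" where
  "F_functor A S = \<lparr>ob = \<lambda>X. (sum_obj (S X), Lambda A S X),
                    mor = \<lambda>X Y \<phi>. diag A S X Y \<phi> (cmor A X Y \<phi>)\<rparr>"

definition G_functor :: "('o \<times> 'm, 'm, 'o, 'm) funct" where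
  "G_functor = \<lparr>ob = fst, mor = \<lambda>X Y \<phi>. \<phi>\<rparr>"


section \<open>The functors between a category and the double of its double\<close>

text \<open>The idempotent \<open>1/2 (1 - g f\<inverse>)\<close> of \<open>C\<close> attached to \<open>(C, f, g)\<close>.\<close>

definition half_idem :: "'k ring \<Rightarrow> ('o, 'm, 'k) conjcat \<Rightarrow> ('o \<times> 'm) \<times> 'm \<Rightarrow> 'm" where
  "half_idem k A = (\<lambda>((X, f), g).
     (inv\<^bsub>k\<^esub> (\<one>\<^bsub>k\<^esub> \<oplus>\<^bsub>k\<^esub> \<one>\<^bsub>k\<^esub>)) \<odot>\<^bsub>Hom A X X\<^esub>
       (Id A X \<ominus>\<^bsub>Hom A X X\<^esub> comp A X (cob A X) X g (inv_arr A (cob A X) X f)))"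

text \<open>\<open>\<Theta>\<close> depends on a choice, for every object of the double of the double, of a splitting
  \<open>(T, t, s)\<close> of that idempotent.\<close>

definition splitting_choice :: "'k ring \<Rightarrow> ('o, 'm, 'k) conjcat
    \<Rightarrow> (('o \<times> 'm) \<times> 'm \<Rightarrow> 'o) \<Rightarrow> (('o \<times> 'm) \<times> 'm \<Rightarrow> 'm) \<Rightarrow> (('o \<times> 'm) \<times> 'm \<Rightarrow> 'm) \<Rightarrow> bool" where
  "splitting_choice k A T t s \<longleftrightarrow> (\<forall>X \<in> Obj (double (double A)).
     splits A (fst (fst X)) (half_idem k A X) (T X) (t X) (s X))"

definition Theta :: "('o, 'm, 'k) conjcat
    \<Rightarrow> (('o \<times> 'm) \<times> 'm \<Rightarrow> 'o) \<Rightarrow> (('o \<times> 'm) \<times> 'm \<Rightarrow> 'm) \<Rightarrow> (('o \<times> 'm) \<times> 'm \<Rightarrow> 'm)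
    \<Rightarrow> (('o \<times> 'm) \<times> 'm, 'm, 'o, 'm) funct" where
  "Theta A T t s =
     \<lparr>ob = T,
      mor = \<lambda>X Y \<phi>. comp A (T X) (fst (fst Y)) (T Y) (s Y)
                      (comp A (T X) (fst (fst X)) (fst (fst Y)) \<phi> (t X))\<rparr>"

definition theta :: "('o, 'm, 'k) conjcat
    \<Rightarrow> (('o \<times> 'm) \<times> 'm \<Rightarrow> 'o) \<Rightarrow> (('o \<times> 'm) \<times> 'm \<Rightarrow> 'm) \<Rightarrow> (('o \<times> 'm) \<times> 'm \<Rightarrow> 'm)
    \<Rightarrow> ('o \<times> 'm) \<times> 'm \<Rightarrow> 'm" where
  "theta A T t s X =
     (let C = fst (fst X); iX = cob (double (double A)) X
      in comp A (T iX) (cob A C) (cob A (T X)) (cmor A C (T X) (s X)) (t iX))"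

definition Psi ::
    "('o, 'm, 'k) conjcat \<Rightarrow> ('o \<Rightarrow> ('o, 'm) biprod) \<Rightarrow> ('o, 'm, ('o \<times> 'm) \<times> 'm, 'm) funct" where
  "Psi A S = \<lparr>ob = \<lambda>X. ((sum_obj (S X), Lambda A S X), Delta A S X),
              mor = \<lambda>X Y \<phi>. diag A S X Y \<phi> (cmor A X Y \<phi>)\<rparr>"

text \<open>
  \<open>\<psi> X : \<iota>(X) \<oplus> \<iota>(\<iota>(X)) \<rightarrow> \<iota>(X \<oplus> \<iota>(X))\<close> is the diagonal matrix \<open>(1, -1)\<close>.
  This is the opposite of the sign convention \<open>(-1, 1)\<close> of the source.  Both signs make \<open>\<Psi>\<close> a
  morphism of categories with conjugation, but the idempotent of \<open>\<Psi>(X)\<close> is the projection onto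
  the first summand \<open>X\<close>, and \<open>\<theta>\<close> is the canonical identification; hence with \<open>(-1, 1)\<close> the
  composite of \<open>\<Psi>\<close> with \<open>\<Theta>\<close> is isomorphic to the identity functor equipped with \<open>-1\<close> instead
  of \<open>1\<close> on \<open>\<iota>(X)\<close>.  For \<open>\<iota> = Id\<close>, \<open>\<lambda> = 1\<close> these are isomorphic only if all objects are zero.
\<close>

definition psi :: "('o, 'm, 'k) conjcat \<Rightarrow> ('o \<Rightarrow> ('o, 'm) biprod) \<Rightarrow> 'o \<Rightarrow> 'm" where
  "psi A S X = (let Y = cob A X; Z = cob A (cob A X) in
     matrix A Y Z (S Y) Y Z (conj_biprod A X Y (S X))
       (Id A Y)   \<zero>\<^bsub>Hom A Z Y\<^esub>
       \<zero>\<^bsub>Hom A Y Z\<^esub>   (\<ominus>\<^bsub>Hom A Z Z\<^esub> Id A Z))"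

end

theory Submission
  imports Defs
begin

text \<open>
  An object \<open>(X, f, g)\<close> of the double of the double carries the endomorphism \<open>h = g f\<inverse>\<close> of \<open>X\<close>.
  The defining conditions are \<open>f \<iota>(f) = \<lambda>\<close>, \<open>g \<iota>(g) = -\<lambda>\<close> and, from \<open>g\<close> being a morphism of
  the double, \<open>g \<iota>(f) = -f \<iota>(g)\<close>.  They give \<open>h\<^sup>2 = 1\<close> (\<open>involution_involution\<close>) and
  \<open>f \<iota>(h) = -h f\<close> (\<open>f_cmor_involution\<close>).  As \<open>2\<close> is invertible, \<open>X\<close> is the sum of the eigenspaces
  of \<open>h\<close>; \<open>\<Theta>(X, f, g)\<close> is the one for \<open>-1\<close>, and \<open>f\<close> identifies \<open>\<iota>(\<Theta>(X, f, g))\<close> with the one for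
  \<open>1\<close>.  Thus, with the inclusion \<open>t : \<Theta>(X, f, g) \<rightarrow> X\<close>, the morphism \<open>(t, f \<iota>(t))\<close> from
  \<open>\<Theta>(X, f, g) \<oplus> \<iota>(\<Theta>(X, f, g))\<close> to \<open>X\<close> is an isomorphism, and it takes the structure
  \<open>(\<Lambda>, \<Delta>)\<close> to \<open>(f, g)\<close>: this is \<open>\<Psi>\<Theta> \<cong> Id\<close> (\<open>conj_natural_iso_Psi_Theta\<close>).  Conversely, the
  involution of \<open>\<Psi>(X)\<close> is \<open>-1\<close> on \<open>X\<close> and \<open>1\<close> on \<open>\<iota>(X)\<close>, so the idempotent of \<open>\<Psi>(X)\<close> is the
  projection onto \<open>X\<close> and \<open>\<Theta>\<Psi> \<cong> Id\<close> (\<open>conj_natural_iso_Theta_Psi\<close>).  Both isomorphisms respect the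
  conjugations because \<open>\<theta>\<close> is the canonical identification of two splittings, i.e.
  \<open>\<iota>(t) \<theta> = t'\<close> for the inclusion \<open>t'\<close> of the conjugate object (\<open>t_theta\<close>), and \<open>\<psi>\<close> is \<open>1\<close> on the first summand.

  The composite \<open>G'\<Psi>\<close> is equal to \<open>F\<close>.  For \<open>F'(X, f)\<close> the involution exchanges, up to \<open>f\<close>, the two
  summands \<open>X\<close> and \<open>\<iota>(X)\<close>; its eigenspace is an antidiagonal, which the first projection maps
  isomorphically onto \<open>X\<close>, so \<open>\<Theta>F' \<cong> G\<close> (\<open>isomorphic_functors_Theta_F\<close>).

  All of this presupposes that the double is again a category with conjugation
  (\<open>category_with_conjugation_double\<close>); applied twice, it makes the double of the double available.

  Two devices keep the calculations short.  Morphisms out of a biproduct are compared on its two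
  inclusions (\<open>biproduct_ext\<close>), so of a matrix only the columns are needed.  And since the double
  inherits composition and addition, every equation in it, or in its double, is an equation
  in the category one starts with.
\<close>

section \<open>Calculus in a linear category\<close>

definition copair ::
    "('o, 'm, 'k, 'z) lincat_scheme \<Rightarrow> 'o \<Rightarrow> 'o \<Rightarrow> ('o, 'm) biprod \<Rightarrow> 'o \<Rightarrow> 'm \<Rightarrow> 'm \<Rightarrow> 'm" where
  "copair C X Y b Z f g = comp C (sum_obj b) X Z f (pr1 b) \<oplus>\<^bsub>Hom C (sum_obj b) Z\<^esub>
     comp C (sum_obj b) Y Z g (pr2 b)"

context linear_category
begin

lemma hom_abelian_group:
  "\<lbrakk>X \<in> Obj C; Y \<in> Obj C\<rbrakk> \<Longrightarrow> abelian_group (Hom C X Y)"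
  using hom_module by (simp add: module_def)

lemma zero_arr: "\<lbrakk>X \<in> Obj C; Y \<in> Obj C\<rbrakk> \<Longrightarrow> \<zero>\<^bsub>Hom C X Y\<^esub> \<in> arr C X Y"
  by (rule abelian_monoid.zero_closed[OF abelian_group.axioms(1)[OF hom_abelian_group]])

lemma add_arr:
  "\<lbrakk>X \<in> Obj C; Y \<in> Obj C; f \<in> arr C X Y; g \<in> arr C X Y\<rbrakk> \<Longrightarrow> f \<oplus>\<^bsub>Hom C X Y\<^esub> g \<in> arr C X Y"
  by (rule abelian_monoid.a_closed[OF abelian_group.axioms(1)[OF hom_abelian_group]])

lemma minus_arr:
  "\<lbrakk>X \<in> Obj C; Y \<in> Obj C; f \<in> arr C X Y\<rbrakk> \<Longrightarrow> \<ominus>\<^bsub>Hom C X Y\<^esub> f \<in> arr C X Y"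
  by (rule abelian_group.a_inv_closed[OF hom_abelian_group])

lemma smult_arr:
  "\<lbrakk>X \<in> Obj C; Y \<in> Obj C; a \<in> carrier k; f \<in> arr C X Y\<rbrakk> \<Longrightarrow> a \<odot>\<^bsub>Hom C X Y\<^esub> f \<in> arr C X Y"
  by (rule module.smult_closed[OF hom_module])

lemmas typing = Id_arr comp_arr zero_arr add_arr minus_arr smult_arr

lemma add_zero:
  assumes "X \<in> Obj C" "Y \<in> Obj C" "f \<in> arr C X Y"
  shows "\<zero>\<^bsub>Hom C X Y\<^esub> \<oplus>\<^bsub>Hom C X Y\<^esub> f = f" "f \<oplus>\<^bsub>Hom C X Y\<^esub> \<zero>\<^bsub>Hom C X Y\<^esub> = f"
proof -
  interpret abelian_group "Hom C X Y" by (rule hom_abelian_group) fact+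
  show "\<zero>\<^bsub>Hom C X Y\<^esub> \<oplus>\<^bsub>Hom C X Y\<^esub> f = f" "f \<oplus>\<^bsub>Hom C X Y\<^esub> \<zero>\<^bsub>Hom C X Y\<^esub> = f"
    using assms by simp_all
qed

lemma minus_minus:
  "\<lbrakk>X \<in> Obj C; Y \<in> Obj C; f \<in> arr C X Y\<rbrakk> \<Longrightarrow> \<ominus>\<^bsub>Hom C X Y\<^esub> (\<ominus>\<^bsub>Hom C X Y\<^esub> f) = f"
  by (rule abelian_group.minus_minus[OF hom_abelian_group])

lemma minus_eq_iff:
  "\<lbrakk>X \<in> Obj C; Y \<in> Obj C; f \<in> arr C X Y; g \<in> arr C X Y\<rbrakk> \<Longrightarrow>
    \<ominus>\<^bsub>Hom C X Y\<^esub> f = \<ominus>\<^bsub>Hom C X Y\<^esub> g \<longleftrightarrow> f = g"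
  by (metis minus_minus)

lemma minus_zero:
  assumes "X \<in> Obj C" "Y \<in> Obj C"
  shows "\<ominus>\<^bsub>Hom C X Y\<^esub> \<zero>\<^bsub>Hom C X Y\<^esub> = \<zero>\<^bsub>Hom C X Y\<^esub>"
proof -
  interpret abelian_group "Hom C X Y" by (rule hom_abelian_group) fact+
  show ?thesis by simp
qed

lemma add_minus:
  assumes "X \<in> Obj C" "Y \<in> Obj C" "f \<in> arr C X Y"
  shows "f \<oplus>\<^bsub>Hom C X Y\<^esub> \<ominus>\<^bsub>Hom C X Y\<^esub> f = \<zero>\<^bsub>Hom C X Y\<^esub>"
proof -
  interpret abelian_group "Hom C X Y" by (rule hom_abelian_group) fact+
  show ?thesis using assms by (simp add: r_neg)
qed

lemma minus_add:
  assumes "X \<in> Obj C" "Y \<in> Obj C" "f \<in> arr C X Y" "g \<in> arr C X Y"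
  shows "\<ominus>\<^bsub>Hom C X Y\<^esub> (f \<oplus>\<^bsub>Hom C X Y\<^esub> g) = \<ominus>\<^bsub>Hom C X Y\<^esub> f \<oplus>\<^bsub>Hom C X Y\<^esub> \<ominus>\<^bsub>Hom C X Y\<^esub> g"
proof -
  interpret abelian_group "Hom C X Y" by (rule hom_abelian_group) fact+
  show ?thesis using assms by (simp add: minus_add)
qed

lemma minus_unique:
  assumes "X \<in> Obj C" "Y \<in> Obj C" "f \<in> arr C X Y" "g \<in> arr C X Y"
    and "f \<oplus>\<^bsub>Hom C X Y\<^esub> g = \<zero>\<^bsub>Hom C X Y\<^esub>"
  shows "f = \<ominus>\<^bsub>Hom C X Y\<^esub> g"
proof -
  interpret abelian_group "Hom C X Y" by (rule hom_abelian_group) fact+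
  show ?thesis using assms by (simp add: minus_equality)
qed

lemma add_idem_zero:
  assumes "X \<in> Obj C" "Y \<in> Obj C" "f \<in> arr C X Y" "f \<oplus>\<^bsub>Hom C X Y\<^esub> f = f"
  shows "f = \<zero>\<^bsub>Hom C X Y\<^esub>"
proof -
  interpret abelian_group "Hom C X Y" by (rule hom_abelian_group) fact+
  show ?thesis using assms by simp
qed

lemma comp_zero_left:
  assumes "X \<in> Obj C" "Y \<in> Obj C" "Z \<in> Obj C" "f \<in> arr C X Y"
  shows "comp C X Y Z \<zero>\<^bsub>Hom C Y Z\<^esub> f = \<zero>\<^bsub>Hom C X Z\<^esub>"
  using assms comp_add_left[of X Y Z f "\<zero>\<^bsub>Hom C Y Z\<^esub>" "\<zero>\<^bsub>Hom C Y Z\<^esub>"]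
  by (auto intro!: add_idem_zero typing simp: add_zero typing)

lemma comp_zero_right:
  assumes "X \<in> Obj C" "Y \<in> Obj C" "Z \<in> Obj C" "g \<in> arr C Y Z"
  shows "comp C X Y Z g \<zero>\<^bsub>Hom C X Y\<^esub> = \<zero>\<^bsub>Hom C X Z\<^esub>"
  using assms comp_add_right[of X Y Z "\<zero>\<^bsub>Hom C X Y\<^esub>" "\<zero>\<^bsub>Hom C X Y\<^esub>" g]
  by (auto intro!: add_idem_zero typing simp: add_zero typing)

lemma comp_minus_left:
  assumes "X \<in> Obj C" "Y \<in> Obj C" "Z \<in> Obj C" "f \<in> arr C X Y" "g \<in> arr C Y Z"
  shows "comp C X Y Z (\<ominus>\<^bsub>Hom C Y Z\<^esub> g) f = \<ominus>\<^bsub>Hom C X Z\<^esub> comp C X Y Z g f"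
proof (rule minus_unique)
  interpret abelian_group "Hom C Y Z" by (rule hom_abelian_group) fact+
  show "comp C X Y Z (\<ominus>\<^bsub>Hom C Y Z\<^esub> g) f \<oplus>\<^bsub>Hom C X Z\<^esub> comp C X Y Z g f = \<zero>\<^bsub>Hom C X Z\<^esub>"
    using assms by (simp add: typing l_neg comp_zero_left flip: comp_add_left)
qed (use assms in \<open>simp_all add: typing\<close>)

lemma comp_minus_right:
  assumes "X \<in> Obj C" "Y \<in> Obj C" "Z \<in> Obj C" "f \<in> arr C X Y" "g \<in> arr C Y Z"
  shows "comp C X Y Z g (\<ominus>\<^bsub>Hom C X Y\<^esub> f) = \<ominus>\<^bsub>Hom C X Z\<^esub> comp C X Y Z g f"
proof (rule minus_unique)
  interpret abelian_group "Hom C X Y" by (rule hom_abelian_group) fact+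
  show "comp C X Y Z g (\<ominus>\<^bsub>Hom C X Y\<^esub> f) \<oplus>\<^bsub>Hom C X Z\<^esub> comp C X Y Z g f = \<zero>\<^bsub>Hom C X Z\<^esub>"
    using assms by (simp add: typing l_neg comp_zero_right flip: comp_add_right)
qed (use assms in \<open>simp_all add: typing\<close>)

lemmas linear = comp_add_left comp_add_right comp_smult_left comp_smult_right
  comp_zero_left comp_zero_right comp_minus_left comp_minus_right
  add_zero minus_minus minus_zero minus_add

text \<open>
  Simplification brings composites into right-nested form, where an equation \<open>g f = h\<close> no longer
  matches if something follows on the right; this turns the equation into the rule for that case.
\<close>

lemma comp_reduce:
  assumes "comp C X Y Z g f = h" "W \<in> Obj C" "X \<in> Obj C" "Y \<in> Obj C" "Z \<in> Obj C"
    "f \<in> arr C X Y" "g \<in> arr C Y Z" "u \<in> arr C W X"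
  shows "comp C W Y Z g (comp C W X Y f u) = comp C W X Z h u"
  using assms comp_assoc[of W X Y Z u f g] by simp

lemmas calc = typing linear comp_assoc comp_Id_left comp_Id_right

lemma inverse_arrs_unique:
  assumes "X \<in> Obj C" "Y \<in> Obj C" "inverse_arrs C X Y f g" "inverse_arrs C X Y f g'"
  shows "g = g'"
proof -
  have "comp C Y X X (comp C X Y X g f) g' = comp C Y Y X g (comp C Y X Y f g')"
    using assms unfolding inverse_arrs_def by (intro comp_assoc) auto
  then show ?thesis
    using assms unfolding inverse_arrs_def by (simp add: comp_Id_left comp_Id_right)
qed

lemma inv_arr_eq:
  assumes "X \<in> Obj C" "Y \<in> Obj C" "inverse_arrs C X Y f g"
  shows "inv_arr C X Y f = g"
  unfolding inv_arr_def using assms inverse_arrs_unique by blast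

lemma inverse_arrs_inv_arr:
  assumes "X \<in> Obj C" "Y \<in> Obj C" "iso_arr C X Y f"
  shows "inverse_arrs C X Y f (inv_arr C X Y f)"
  using assms inv_arr_eq[OF assms(1,2)] unfolding iso_arr_def by auto

lemma iso_arr_Id: "X \<in> Obj C \<Longrightarrow> iso_arr C X X (Id C X)"
  unfolding iso_arr_def inverse_arrs_def by (rule exI[of _ "Id C X"]) (simp add: calc)

text \<open>
  Inverses chosen by \<open>inv_arr\<close> are removed by composing with the isomorphism; so the compatibility
  condition on \<open>\<psi>\<close> becomes an equation without \<open>\<psi>\<inverse>\<close>.
\<close>

lemma comp_inv_arrI:
  assumes "X \<in> Obj C" "Y \<in> Obj C" "Z \<in> Obj C" "iso_arr C X Y f" "a \<in> arr C Y Z" "b \<in> arr C X Z"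
    and "comp C X Y Z a f = b"
  shows "a = comp C Y X Z b (inv_arr C X Y f)"
proof -
  have "inverse_arrs C X Y f (inv_arr C X Y f)"
    using assms by (intro inverse_arrs_inv_arr)
  then show ?thesis
    using assms(1-6) unfolding inverse_arrs_def by (simp add: calc flip: assms(7))
qed

lemma iso_cancel_right:
  assumes "X \<in> Obj C" "Y \<in> Obj C" "Z \<in> Obj C" "iso_arr C X Y f" "a \<in> arr C Y Z" "b \<in> arr C Y Z"
    and eq: "comp C X Y Z a f = comp C X Y Z b f"
  shows "a = b"
proof -
  obtain g where g: "g \<in> arr C Y X" "comp C Y X Y f g = Id C Y" and f: "f \<in> arr C X Y"
    using assms unfolding iso_arr_def inverse_arrs_def by blast
  have "comp C Y X Z (comp C X Y Z a f) g = comp C Y X Z (comp C X Y Z b f) g"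
    by (simp only: eq)
  then show ?thesis using assms(1-6) f g by (simp add: calc)
qed

text \<open>
  In this form being a zero object passes from a category to its double, where the identities and
  the zero morphisms are the same.
\<close>

lemma zero_object_iff:
  assumes "Z \<in> Obj C"
  shows "zero_object C Z \<longleftrightarrow> Id C Z = \<zero>\<^bsub>Hom C Z Z\<^esub>"
proof
  assume "zero_object C Z"
  then show "Id C Z = \<zero>\<^bsub>Hom C Z Z\<^esub>"
    using assms Id_arr[OF assms] zero_arr[OF assms assms] unfolding zero_object_def by blast
next
  assume Z: "Id C Z = \<zero>\<^bsub>Hom C Z Z\<^esub>"
  have "f = \<zero>\<^bsub>Hom C X Z\<^esub>" if "X \<in> Obj C" "f \<in> arr C X Z" for X f
    using comp_Id_left[of X Z f] that assms by (simp add: Z calc)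
  moreover have "f = \<zero>\<^bsub>Hom C Z X\<^esub>" if "X \<in> Obj C" "f \<in> arr C Z X" for X f
    using comp_Id_right[of Z X f] that assms by (simp add: Z calc)
  ultimately show "zero_object C Z"
    unfolding zero_object_def using assms by (auto intro!: ex1I zero_arr)
qed

lemma biproductD:
  assumes "is_biproduct C X Y b"
  shows "sum_obj b \<in> Obj C" "in1 b \<in> arr C X (sum_obj b)" "in2 b \<in> arr C Y (sum_obj b)"
    "pr1 b \<in> arr C (sum_obj b) X" "pr2 b \<in> arr C (sum_obj b) Y"
    "comp C X (sum_obj b) X (pr1 b) (in1 b) = Id C X"
    "comp C Y (sum_obj b) Y (pr2 b) (in2 b) = Id C Y"
    "comp C Y (sum_obj b) X (pr1 b) (in2 b) = \<zero>\<^bsub>Hom C Y X\<^esub>"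
    "comp C X (sum_obj b) Y (pr2 b) (in1 b) = \<zero>\<^bsub>Hom C X Y\<^esub>"
    "comp C (sum_obj b) X (sum_obj b) (in1 b) (pr1 b) \<oplus>\<^bsub>Hom C (sum_obj b) (sum_obj b)\<^esub>
       comp C (sum_obj b) Y (sum_obj b) (in2 b) (pr2 b) = Id C (sum_obj b)"
  using assms by (simp_all add: is_biproduct_def Let_def)

lemma biproduct_ext:
  assumes "X \<in> Obj C" "Y \<in> Obj C" "Z \<in> Obj C" and b: "is_biproduct C X Y b"
    and f: "f \<in> arr C (sum_obj b) Z" and g: "g \<in> arr C (sum_obj b) Z"
    and 1: "comp C X (sum_obj b) Z f (in1 b) = comp C X (sum_obj b) Z g (in1 b)"
    and 2: "comp C Y (sum_obj b) Z f (in2 b) = comp C Y (sum_obj b) Z g (in2 b)"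
  shows "f = g"
proof -
  note b [simp] = biproductD[OF b] and [simp] = typing assms(1-3)
  have *: "comp C (sum_obj b) X Z (comp C X (sum_obj b) Z u (in1 b)) (pr1 b)
      \<oplus>\<^bsub>Hom C (sum_obj b) Z\<^esub> comp C (sum_obj b) Y Z (comp C Y (sum_obj b) Z u (in2 b)) (pr2 b) = u"
    if [simp]: "u \<in> arr C (sum_obj b) Z" for u
  proof -
    have "comp C (sum_obj b) (sum_obj b) Z u
        (comp C (sum_obj b) X (sum_obj b) (in1 b) (pr1 b) \<oplus>\<^bsub>Hom C (sum_obj b) (sum_obj b)\<^esub>
         comp C (sum_obj b) Y (sum_obj b) (in2 b) (pr2 b)) = u"
      by (simp add: comp_Id_right)
    then show ?thesis by (simp add: comp_assoc comp_add_right del: b(10))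
  qed
  show ?thesis by (rule trans[OF *[OF f, unfolded 1 2, symmetric] *[OF g]])
qed

lemma copair:
  assumes "X \<in> Obj C" "Y \<in> Obj C" "Z \<in> Obj C" "is_biproduct C X Y b"
    and "f \<in> arr C X Z" "g \<in> arr C Y Z"
  shows "copair C X Y b Z f g \<in> arr C (sum_obj b) Z"
    and "comp C X (sum_obj b) Z (copair C X Y b Z f g) (in1 b) = f"
    and "comp C Y (sum_obj b) Z (copair C X Y b Z f g) (in2 b) = g"
  using assms biproductD[OF assms(4)] by (simp_all add: copair_def calc)

lemma matrix:
  assumes "X1 \<in> Obj C" "X2 \<in> Obj C" "Y1 \<in> Obj C" "Y2 \<in> Obj C"
    and "is_biproduct C X1 X2 b" "is_biproduct C Y1 Y2 c"
    and "a11 \<in> arr C X1 Y1" "a12 \<in> arr C X2 Y1" "a21 \<in> arr C X1 Y2" "a22 \<in> arr C X2 Y2"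
  shows "matrix C X1 X2 b Y1 Y2 c a11 a12 a21 a22 \<in> arr C (sum_obj b) (sum_obj c)"
    and "comp C X1 (sum_obj b) (sum_obj c) (matrix C X1 X2 b Y1 Y2 c a11 a12 a21 a22) (in1 b) =
      comp C X1 Y1 (sum_obj c) (in1 c) a11 \<oplus>\<^bsub>Hom C X1 (sum_obj c)\<^esub>
      comp C X1 Y2 (sum_obj c) (in2 c) a21"
    and "comp C X2 (sum_obj b) (sum_obj c) (matrix C X1 X2 b Y1 Y2 c a11 a12 a21 a22) (in2 b) =
      comp C X2 Y1 (sum_obj c) (in1 c) a12 \<oplus>\<^bsub>Hom C X2 (sum_obj c)\<^esub>
      comp C X2 Y2 (sum_obj c) (in2 c) a22"
  using assms biproductD[OF assms(5)] biproductD[OF assms(6)]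
  by (simp_all add: matrix_def Let_def calc)

end

section \<open>Linear functors and conjugations\<close>

lemma linear_functorD:
  assumes "linear_functor k C D F"
  shows "X \<in> Obj C \<Longrightarrow> ob F X \<in> Obj D"
    and "\<lbrakk>X \<in> Obj C; Y \<in> Obj C; f \<in> arr C X Y\<rbrakk> \<Longrightarrow> mor F X Y f \<in> arr D (ob F X) (ob F Y)"
    and "X \<in> Obj C \<Longrightarrow> mor F X X (Id C X) = Id D (ob F X)"
    and "\<lbrakk>X \<in> Obj C; Y \<in> Obj C; Z \<in> Obj C; f \<in> arr C X Y; g \<in> arr C Y Z\<rbrakk> \<Longrightarrow>
      mor F X Z (comp C X Y Z g f)
        = comp D (ob F X) (ob F Y) (ob F Z) (mor F Y Z g) (mor F X Y f)"
    and "\<lbrakk>X \<in> Obj C; Y \<in> Obj C; f \<in> arr C X Y; g \<in> arr C X Y\<rbrakk> \<Longrightarrow>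
      mor F X Y (f \<oplus>\<^bsub>Hom C X Y\<^esub> g) = mor F X Y f \<oplus>\<^bsub>Hom D (ob F X) (ob F Y)\<^esub> mor F X Y g"
    and "\<lbrakk>X \<in> Obj C; Y \<in> Obj C; a \<in> carrier k; f \<in> arr C X Y\<rbrakk> \<Longrightarrow>
      mor F X Y (a \<odot>\<^bsub>Hom C X Y\<^esub> f) = a \<odot>\<^bsub>Hom D (ob F X) (ob F Y)\<^esub> mor F X Y f"
  using assms by (simp_all add: linear_functor_def)

lemma linear_functor_comp:
  assumes "linear_functor k B C F" "linear_functor k C D G"
  shows "linear_functor k B D (G \<circ>\<^sub>F F)"
  using linear_functorD[OF assms(1)] linear_functorD[OF assms(2)]
  by (simp add: linear_functor_def comp_functor_def)

context linear_category
begin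

lemma isomorphic_functors_refl:
  assumes "linear_functor k B C F"
  shows "isomorphic_functors k B C F F"
proof -
  have "natural_iso B C F F (\<lambda>X. Id C (ob F X))"
    using linear_functorD[OF assms] by (simp add: natural_iso_def iso_arr_Id calc)
  then show ?thesis using assms by (auto simp: isomorphic_functors_def)
qed

end

locale conj_category =
  fixes k :: "'k ring" and A :: "('o, 'm, 'k) conjcat"
  assumes category_with_conjugation: "category_with_conjugation k A"

sublocale conj_category \<subseteq> linear_category k A
  using category_with_conjugation
  by (simp add: category_with_conjugation_def additive_category_def)

context conj_category
begin

lemma linear_functor_conj: "linear_functor k A A (conj_functor A)"
  using category_with_conjugation by (simp add: category_with_conjugation_def)

lemmas cob_Obj = linear_functorD(1)[OF linear_functor_conj]
lemmas cmor_arr = linear_functorD(2)[OF linear_functor_conj]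
lemmas cmor_Id = linear_functorD(3)[OF linear_functor_conj]
lemmas cmor_comp = linear_functorD(4)[OF linear_functor_conj]
lemmas cmor_add = linear_functorD(5)[OF linear_functor_conj]
lemmas cmor_smult = linear_functorD(6)[OF linear_functor_conj]

lemma cmor_zero:
  assumes "X \<in> Obj A" "Y \<in> Obj A"
  shows "cmor A X Y \<zero>\<^bsub>Hom A X Y\<^esub> = \<zero>\<^bsub>Hom A (cob A X) (cob A Y)\<^esub>"
  using assms cmor_add[of X Y "\<zero>\<^bsub>Hom A X Y\<^esub>" "\<zero>\<^bsub>Hom A X Y\<^esub>"]
  by (auto intro!: add_idem_zero cob_Obj cmor_arr typing simp: add_zero typing)

lemma cmor_minus:
  assumes "X \<in> Obj A" "Y \<in> Obj A" "f \<in> arr A X Y"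
  shows "cmor A X Y (\<ominus>\<^bsub>Hom A X Y\<^esub> f) = \<ominus>\<^bsub>Hom A (cob A X) (cob A Y)\<^esub> cmor A X Y f"
proof (rule minus_unique)
  interpret abelian_group "Hom A X Y" by (rule hom_abelian_group) fact+
  show "cmor A X Y (\<ominus>\<^bsub>Hom A X Y\<^esub> f) \<oplus>\<^bsub>Hom A (cob A X) (cob A Y)\<^esub> cmor A X Y f
      = \<zero>\<^bsub>Hom A (cob A X) (cob A Y)\<^esub>"
    using assms by (simp add: typing l_neg cmor_zero flip: cmor_add)
qed (use assms in \<open>simp_all add: typing cob_Obj cmor_arr\<close>)

lemma conj_nat_iso: "X \<in> Obj A \<Longrightarrow> iso_arr A (cob A (cob A X)) X (conj_nat A X)"
  using category_with_conjugation
  by (simp add: category_with_conjugation_def natural_iso_def comp_functor_def id_functor_def)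

lemma conj_nat_arr: "X \<in> Obj A \<Longrightarrow> conj_nat A X \<in> arr A (cob A (cob A X)) X"
  using conj_nat_iso unfolding iso_arr_def inverse_arrs_def by blast

lemma conj_nat_natural:
  "\<lbrakk>X \<in> Obj A; Y \<in> Obj A; f \<in> arr A X Y\<rbrakk> \<Longrightarrow>
    comp A (cob A (cob A X)) (cob A (cob A Y)) Y (conj_nat A Y)
      (cmor A (cob A X) (cob A Y) (cmor A X Y f))
    = comp A (cob A (cob A X)) X Y f (conj_nat A X)"
  using category_with_conjugation
  by (simp add: category_with_conjugation_def natural_iso_def comp_functor_def id_functor_def)

text \<open>
  The rules for \<open>\<lambda>\<close> are oriented so that \<open>\<lambda>\<close> moves to the right past every \<open>\<iota>\<iota>(f)\<close> and
  \<open>\<iota>(\<lambda>\<^sub>X)\<close> becomes \<open>\<lambda>\<close> at \<open>\<iota>(X)\<close>; then naturality applies to every occurrence of \<open>\<lambda>\<close>.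
\<close>

lemma conj_nat_natural_comp:
  assumes "X \<in> Obj A" "Y \<in> Obj A" "f \<in> arr A X Y" "W \<in> Obj A" "u \<in> arr A W (cob A (cob A X))"
  shows "comp A W (cob A (cob A Y)) Y (conj_nat A Y)
      (comp A W (cob A (cob A X)) (cob A (cob A Y)) (cmor A (cob A X) (cob A Y) (cmor A X Y f)) u)
    = comp A W X Y f (comp A W (cob A (cob A X)) X (conj_nat A X) u)"
  using assms
  by (simp add: comp_reduce[OF conj_nat_natural] comp_assoc cob_Obj cmor_arr conj_nat_arr)

lemma cmor_conj_nat:
  "X \<in> Obj A \<Longrightarrow> cmor A (cob A (cob A X)) X (conj_nat A X) = conj_nat A (cob A X)"
  using category_with_conjugation by (simp add: category_with_conjugation_def)

lemmas conj_calc = calc cob_Obj cmor_arr cmor_Id cmor_comp cmor_add cmor_smult cmor_zero cmor_minus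
  conj_nat_arr conj_nat_natural conj_nat_natural_comp cmor_conj_nat

lemma inverse_arrs_cmor:
  assumes "X \<in> Obj A" "Y \<in> Obj A" "inverse_arrs A X Y f g"
  shows "inverse_arrs A (cob A X) (cob A Y) (cmor A X Y f) (cmor A Y X g)"
  using assms by (simp add: inverse_arrs_def conj_calc flip: cmor_comp)

lemma conj_biprod:
  assumes "X \<in> Obj A" "Y \<in> Obj A" "is_biproduct A X Y b"
  shows "is_biproduct A (cob A X) (cob A Y) (conj_biprod A X Y b)"
  using assms(1,2) biproductD[OF assms(3)]
  by (simp add: is_biproduct_def conj_biprod_def Let_def cob_Obj cmor_arr cmor_Id cmor_zero typing
      flip: cmor_comp cmor_add)

end

section \<open>The double category\<close>

lemma double_simps:
  "comp (double A) (X, f) (Y, g) (Z, h) = comp A X Y Z"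
  "Id (double A) (X, f) = Id A X"
  "\<zero>\<^bsub>Hom (double A) (X, f) (Y, g)\<^esub> = \<zero>\<^bsub>Hom A X Y\<^esub>"
  "\<phi> \<oplus>\<^bsub>Hom (double A) (X, f) (Y, g)\<^esub> \<chi> = \<phi> \<oplus>\<^bsub>Hom A X Y\<^esub> \<chi>"
  "a \<odot>\<^bsub>Hom (double A) (X, f) (Y, g)\<^esub> \<phi> = a \<odot>\<^bsub>Hom A X Y\<^esub> \<phi>"
  "cob (double A) (X, f) = (cob A X, \<ominus>\<^bsub>Hom A (cob A (cob A X)) (cob A X)\<^esub> cmor A (cob A X) X f)"
  "cmor (double A) (X, f) (Y, g) = cmor A X Y"
  "conj_nat (double A) (X, f) = \<ominus>\<^bsub>Hom A (cob A (cob A X)) X\<^esub> conj_nat A X"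
  by (simp_all add: double_def)

lemma double_simps_fst:
  "comp (double A) P Q R = comp A (fst P) (fst Q) (fst R)"
  "Id (double A) P = Id A (fst P)"
  "\<phi> \<oplus>\<^bsub>Hom (double A) P Q\<^esub> \<chi> = \<phi> \<oplus>\<^bsub>Hom A (fst P) (fst Q)\<^esub> \<chi>"
  "a \<odot>\<^bsub>Hom (double A) P Q\<^esub> \<phi> = a \<odot>\<^bsub>Hom A (fst P) (fst Q)\<^esub> \<phi>"
  by (simp_all add: double_def split_beta)

lemma double_arr:
  "\<phi> \<in> arr (double A) (X, f) (Y, g) \<longleftrightarrow> \<phi> \<in> arr A X Y \<and>
    comp A (cob A X) X Y \<phi> f = comp A (cob A X) (cob A Y) Y g (cmor A X Y \<phi>)"
  by (simp add: double_def)

lemma double_Obj: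
  "(X, f) \<in> Obj (double A) \<longleftrightarrow> X \<in> Obj A \<and> f \<in> arr A (cob A X) X \<and> iso_arr A (cob A X) X f \<and>
    comp A (cob A (cob A X)) (cob A X) X f (cmor A (cob A X) X f) = conj_nat A X"
  by (auto simp: double_def iso_arr_def inverse_arrs_def)

lemma double_ObjD:
  assumes "(X, f) \<in> Obj (double A)"
  shows "X \<in> Obj A" "f \<in> arr A (cob A X) X" "iso_arr A (cob A X) X f"
    and "comp A (cob A (cob A X)) (cob A X) X f (cmor A (cob A X) X f) = conj_nat A X"
  using assms by (simp_all add: double_Obj)

lemma fst_Obj: "P \<in> Obj (double A) \<Longrightarrow> fst P \<in> Obj A"
  by (cases P) (simp add: double_Obj)

lemma fst_arr: "\<phi> \<in> arr (double A) P Q \<Longrightarrow> \<phi> \<in> arr A (fst P) (fst Q)"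
  by (cases P; cases Q) (simp add: double_arr)

lemma linear_functor_G: "linear_functor k (double A) A G_functor"
  by (simp add: linear_functor_def G_functor_def double_simps_fst fst_Obj fst_arr)

text \<open>
  A functor into the double is a functor into the underlying category whose values carry the extra
  structure, since the double has the same operations on morphisms.
\<close>

lemma linear_functor_doubleI:
  assumes "linear_functor k B A (G_functor \<circ>\<^sub>F F)"
    and "\<And>X. X \<in> Obj B \<Longrightarrow> ob F X \<in> Obj (double A)"
    and "\<And>X Y f. \<lbrakk>X \<in> Obj B; Y \<in> Obj B; f \<in> arr B X Y\<rbrakk> \<Longrightarrow>
      mor F X Y f \<in> arr (double A) (ob F X) (ob F Y)"
  shows "linear_functor k B (double A) F"
  using linear_functorD[OF assms(1)] assms(2,3)
  by (simp add: linear_functor_def comp_functor_def G_functor_def double_simps_fst)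

context conj_category
begin

text \<open>
  The equation \<open>f \<iota>(f) = \<lambda>\<close> makes \<open>f\<close> invertible: it provides the right inverse
  \<open>\<iota>(f) \<lambda>\<inverse>\<close>, and its image under \<open>\<iota>\<close>, with naturality of \<open>\<lambda>\<close>, shows that this is a left
  inverse too.  Hence objects of the double are obtained from the equation alone.
\<close>

lemma double_inverse:
  assumes X: "X \<in> Obj A" and f: "f \<in> arr A (cob A X) X"
    and ff: "comp A (cob A (cob A X)) (cob A X) X f (cmor A (cob A X) X f) = conj_nat A X"
    and l: "inverse_arrs A (cob A (cob A X)) X (conj_nat A X) l"
  shows "inverse_arrs A (cob A X) X f (comp A X (cob A (cob A X)) (cob A X) (cmor A (cob A X) X f) l)"
proof -
  have [simp]: "l \<in> arr A X (cob A (cob A X))"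
    "comp A (cob A (cob A X)) X (cob A (cob A X)) l (conj_nat A X) = Id A (cob A (cob A X))"
    "comp A X (cob A (cob A X)) X (conj_nat A X) l = Id A X"
    using l by (simp_all add: inverse_arrs_def)
  note [simp] = X f conj_calc
  have cl: "comp A (cob A X) (cob A (cob A (cob A X))) (cob A X) (conj_nat A (cob A X))
      (cmor A X (cob A (cob A X)) l) = Id A (cob A X)"
    by (simp flip: cmor_comp cmor_conj_nat)
  \<comment> \<open>naturality of \<open>\<lambda>\<close> at \<open>f\<close> turns \<open>\<lambda>\<inverse> f\<close> into \<open>\<iota>\<iota>(f) \<iota>(\<lambda>\<inverse>)\<close>\<close>
  have lf: "comp A (cob A X) X (cob A (cob A X)) l f =
      comp A (cob A X) (cob A (cob A (cob A X))) (cob A (cob A X))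
        (cmor A (cob A (cob A X)) (cob A X) (cmor A (cob A X) X f)) (cmor A X (cob A (cob A X)) l)"
      (is "_ = ?r")
  proof -
    have "f = comp A (cob A X) (cob A (cob A X)) X (conj_nat A X) ?r"
      using comp_Id_right[of "cob A X" X f] by (simp del: comp_Id_right add: cl)
    then have "comp A (cob A X) X (cob A (cob A X)) l f =
      comp A (cob A X) X (cob A (cob A X)) l
        (comp A (cob A X) (cob A (cob A X)) X (conj_nat A X) ?r)"
      by (rule arg_cong)
    also have "\<dots> = ?r"
      by (subst comp_reduce[where h = "Id A (cob A (cob A X))"]) simp_all
    finally show ?thesis .
  qed
  have cff: "comp A (cob A (cob A (cob A X))) (cob A (cob A X)) (cob A X) (cmor A (cob A X) X f)
      (cmor A (cob A (cob A X)) (cob A X) (cmor A (cob A X) X f)) = conj_nat A (cob A X)"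
    by (simp add: ff flip: cmor_comp)
  show ?thesis
    unfolding inverse_arrs_def
    by (simp add: lf comp_reduce[OF ff] comp_reduce[OF cff] cl)
qed

lemma double_ObjI:
  assumes "X \<in> Obj A" "f \<in> arr A (cob A X) X"
    and "comp A (cob A (cob A X)) (cob A X) X f (cmor A (cob A X) X f) = conj_nat A X"
  shows "(X, f) \<in> Obj (double A)"
  using assms double_inverse[OF assms(1-3)] conj_nat_iso[OF assms(1)]
  unfolding double_Obj iso_arr_def by blast

lemma submodule_double:
  assumes "(X, f) \<in> Obj (double A)" "(Y, g) \<in> Obj (double A)"
  shows "submodule (arr (double A) (X, f) (Y, g)) k (Hom A X Y)"
proof -
  note [simp] = double_ObjD[OF assms(1)] double_ObjD[OF assms(2)]
  interpret module k "Hom A X Y" by (rule hom_module) simp_all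
  show ?thesis by (rule submoduleI) (auto simp: double_arr conj_calc)
qed

text \<open>
  Additive inverses are chosen within the carrier, and the hom-sets of the double have smaller
  carriers; that the choices agree rests on these being submodules.
\<close>

lemma double_minus:
  assumes "(X, f) \<in> Obj (double A)" "(Y, g) \<in> Obj (double A)" "\<phi> \<in> arr (double A) (X, f) (Y, g)"
  shows "\<ominus>\<^bsub>Hom (double A) (X, f) (Y, g)\<^esub> \<phi> = \<ominus>\<^bsub>Hom A X Y\<^esub> \<phi>"
proof -
  interpret abelian_group "Hom A X Y"
    by (rule hom_abelian_group[OF double_ObjD(1)[OF assms(1)] double_ObjD(1)[OF assms(2)]])
  let ?H = "arr (double A) (X, f) (Y, g)"
  have "\<ominus>\<^bsub>(Hom A X Y)\<lparr>carrier := ?H\<rparr>\<^esub> \<phi> = \<ominus>\<^bsub>Hom A X Y\<^esub> \<phi>"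
    using group.m_inv_consistent[OF a_group submodule.axioms(1)[OF submodule_double[OF assms(1,2)]]]
      assms(3) by (simp add: a_inv_def)
  moreover have "Hom (double A) (X, f) (Y, g) = (Hom A X Y)\<lparr>carrier := ?H\<rparr>"
    by (simp add: double_def)
  ultimately show ?thesis by metis
qed

lemma linear_category_double: "linear_category k (double A)"
proof (intro linear_category.intro linear_category_axioms.intro)
  show "cring k" by unfold_locales
  fix P Q :: "'o \<times> 'm"
  assume PQ: "P \<in> Obj (double A)" "Q \<in> Obj (double A)"
  obtain X f where P: "P = (X, f)" by fastforce
  obtain Y g where Q: "Q = (Y, g)" by fastforce
  have "Hom (double A) P Q = (Hom A X Y)\<lparr>carrier := arr (double A) P Q\<rparr>"
    by (simp add: P Q double_def)
  then show "module k (Hom (double A) P Q)"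
    using submodule.submodule_is_module[OF submodule_double hom_module] PQ
    by (metis P Q double_ObjD(1))
next
  fix P Q R :: "'o \<times> 'm" and \<phi> \<chi>
  assume PQR: "P \<in> Obj (double A)" "Q \<in> Obj (double A)" "R \<in> Obj (double A)"
    and arr: "\<phi> \<in> arr (double A) P Q" "\<chi> \<in> arr (double A) Q R"
  obtain X f where P: "P = (X, f)" by fastforce
  obtain Y g where Q: "Q = (Y, g)" by fastforce
  obtain Z h where R: "R = (Z, h)" by fastforce
  note [simp] = PQR[unfolded P Q R double_Obj] arr[unfolded P Q R double_arr]
  show "comp (double A) P Q R \<chi> \<phi> \<in> arr (double A) P R"
    by (simp add: P Q R double_arr double_simps conj_calc comp_reduce[of _ _ _ \<chi> g])
qed (auto simp: double_Obj double_arr double_simps conj_calc)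

section \<open>The double as a category with conjugation\<close>

text \<open>
  The forgetful functor from the double reflects isomorphisms: if \<open>\<phi> f = g \<iota>(\<phi>)\<close>, then
  multiplying by \<open>\<phi>\<inverse>\<close> and \<open>\<iota>(\<phi>\<inverse>)\<close> gives the same condition for \<open>\<phi>\<inverse>\<close>.
\<close>

lemma inverse_arrs_double:
  assumes P: "(X, f) \<in> Obj (double A)" and Q: "(Y, g) \<in> Obj (double A)"
    and \<phi>: "\<phi> \<in> arr (double A) (X, f) (Y, g)" and inv: "inverse_arrs A X Y \<phi> \<chi>"
  shows "inverse_arrs (double A) (X, f) (Y, g) \<phi> \<chi>"
proof -
  note [simp] = P[unfolded double_Obj] Q[unfolded double_Obj] conj_calc
  have i: "\<phi> \<in> arr A X Y" "\<chi> \<in> arr A Y X" "comp A X Y X \<chi> \<phi> = Id A X" "comp A Y X Y \<phi> \<chi> = Id A Y"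
    using inv by (simp_all add: inverse_arrs_def)
  note [simp] = i comp_reduce[OF i(3)]
  have \<phi>f: "comp A (cob A X) X Y \<phi> f = comp A (cob A X) (cob A Y) Y g (cmor A X Y \<phi>)"
    using \<phi> by (simp add: double_arr)
  have "comp A (cob A Y) Y X \<chi> g = comp A (cob A Y) Y X \<chi>
      (comp A (cob A Y) (cob A Y) Y g (cmor A Y Y (comp A Y X Y \<phi> \<chi>)))"
    by simp
  also have "\<dots> = comp A (cob A Y) Y X \<chi>
      (comp A (cob A Y) (cob A X) Y (comp A (cob A X) (cob A Y) Y g (cmor A X Y \<phi>)) (cmor A Y X \<chi>))"
    by (simp del: i(4))
  also have "\<dots> = comp A (cob A Y) (cob A X) X f (cmor A Y X \<chi>)"
    by (simp flip: \<phi>f)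
  finally show ?thesis
    using \<phi> unfolding inverse_arrs_def by (simp add: double_arr double_simps)
qed

lemma iso_arr_double:
  assumes "(X, f) \<in> Obj (double A)" "(Y, g) \<in> Obj (double A)"
    and "\<phi> \<in> arr (double A) (X, f) (Y, g)" "iso_arr A X Y \<phi>"
  shows "iso_arr (double A) (X, f) (Y, g) \<phi>"
  using inverse_arrs_double[OF assms(1-3)] assms(4) unfolding iso_arr_def by blast

lemma iso_arr_minus:
  assumes "X \<in> Obj A" "Y \<in> Obj A" "iso_arr A X Y f"
  shows "iso_arr A X Y (\<ominus>\<^bsub>Hom A X Y\<^esub> f)"
proof -
  obtain g where "inverse_arrs A X Y f g" using assms by (auto simp: iso_arr_def)
  then have "inverse_arrs A X Y (\<ominus>\<^bsub>Hom A X Y\<^esub> f) (\<ominus>\<^bsub>Hom A Y X\<^esub> g)"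
    using assms(1,2) by (simp add: inverse_arrs_def calc)
  then show ?thesis by (auto simp: iso_arr_def)
qed

lemma double_cob_Obj:
  assumes "P \<in> Obj (double A)"
  shows "cob (double A) P \<in> Obj (double A)"
proof -
  obtain X f where P: "P = (X, f)" by fastforce
  note f [simp] = assms[unfolded P double_Obj] and [simp] = conj_calc
  have "comp A (cob A (cob A (cob A X))) (cob A (cob A X)) (cob A X) (cmor A (cob A X) X f)
      (cmor A (cob A (cob A X)) (cob A X) (cmor A (cob A X) X f)) = conj_nat A (cob A X)"
    by (simp flip: cmor_comp)
  then show ?thesis
    by (simp add: P double_simps double_ObjI)
qed

text \<open>
  A zero object \<open>Z\<close> becomes a zero object of the double with \<open>f = 0\<close>; this is allowed because
  \<open>\<lambda>\<close> at \<open>Z\<close> is \<open>0\<close>.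
\<close>

lemma zero_object_double: "\<exists>Z. zero_object (double A) Z"
proof -
  interpret D: linear_category k "double A" by (rule linear_category_double)
  obtain Z where Z: "Z \<in> Obj A" "Id A Z = \<zero>\<^bsub>Hom A Z Z\<^esub>"
    using category_with_conjugation zero_object_iff
    unfolding category_with_conjugation_def additive_category_def by (auto simp: zero_object_def)
  have "conj_nat A Z = comp A (cob A (cob A Z)) Z Z (Id A Z) (conj_nat A Z)"
    using Z(1) by (simp add: conj_calc)
  then have "conj_nat A Z = \<zero>\<^bsub>Hom A (cob A (cob A Z)) Z\<^esub>"
    using Z by (simp add: conj_calc)
  then have "(Z, \<zero>\<^bsub>Hom A (cob A Z) Z\<^esub>) \<in> Obj (double A)"
    using Z by (intro double_ObjI) (simp_all add: conj_calc)
  then show ?thesis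
    using Z by (intro exI[of _ "(Z, \<zero>\<^bsub>Hom A (cob A Z) Z\<^esub>)"]) (simp add: D.zero_object_iff double_simps)
qed

text \<open>
  The biproduct of \<open>(X, f)\<close> and \<open>(Y, g)\<close> is \<open>X \<oplus> Y\<close> with the diagonal morphism \<open>d = f \<oplus> g\<close>, which
  is characterised by its values on the images of the inclusions under \<open>\<iota>\<close>.
\<close>

lemma biproduct_double:
  assumes P: "(X, f) \<in> Obj (double A)" and Q: "(Y, g) \<in> Obj (double A)"
  shows "\<exists>b. is_biproduct (double A) (X, f) (Y, g) b"
proof -
  note [simp] = P[unfolded double_Obj] Q[unfolded double_Obj] conj_calc
  obtain b where b: "is_biproduct A X Y b"
    using category_with_conjugation double_ObjD(1)[OF P] double_ObjD(1)[OF Q]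
    unfolding category_with_conjugation_def additive_category_def by meson
  let ?S = "sum_obj b"
  note [simp] = biproductD[OF b]
  have cb: "is_biproduct A (cob A X) (cob A Y) (conj_biprod A X Y b)"
    by (intro conj_biprod b) simp_all
  have ccb: "is_biproduct A (cob A (cob A X)) (cob A (cob A Y))
      (conj_biprod A (cob A X) (cob A Y) (conj_biprod A X Y b))"
    by (intro conj_biprod b) simp_all
  have [simp]: "comp A (cob A X) (cob A ?S) (cob A X) (cmor A ?S X (pr1 b)) (cmor A X ?S (in1 b)) = Id A (cob A X)"
    "comp A (cob A Y) (cob A ?S) (cob A X) (cmor A ?S X (pr1 b)) (cmor A Y ?S (in2 b)) = \<zero>\<^bsub>Hom A (cob A Y) (cob A X)\<^esub>"
    "comp A (cob A Y) (cob A ?S) (cob A Y) (cmor A ?S Y (pr2 b)) (cmor A Y ?S (in2 b)) = Id A (cob A Y)"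
    "comp A (cob A X) (cob A ?S) (cob A Y) (cmor A ?S Y (pr2 b)) (cmor A X ?S (in1 b)) = \<zero>\<^bsub>Hom A (cob A X) (cob A Y)\<^esub>"
    by (simp_all flip: cmor_comp)
  define d where "d = copair A (cob A X) (cob A Y) (conj_biprod A X Y b) ?S
      (comp A (cob A X) X ?S (in1 b) f) (comp A (cob A Y) Y ?S (in2 b) g)"
  have d: "d \<in> arr A (cob A ?S) ?S"
    "comp A (cob A X) (cob A ?S) ?S d (cmor A X ?S (in1 b)) = comp A (cob A X) X ?S (in1 b) f"
    "comp A (cob A Y) (cob A ?S) ?S d (cmor A Y ?S (in2 b)) = comp A (cob A Y) Y ?S (in2 b) g"
    using copair[OF _ _ _ cb, of ?S "comp A (cob A X) X ?S (in1 b) f" "comp A (cob A Y) Y ?S (in2 b) g"]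
    by (simp_all add: d_def conj_biprod_def)
  note [simp] = d comp_reduce[OF d(2)] comp_reduce[OF d(3)]
    comp_reduce[OF biproductD(6)[OF b]] comp_reduce[OF biproductD(7)[OF b]]
    comp_reduce[OF biproductD(8)[OF b]] comp_reduce[OF biproductD(9)[OF b]]
  have [simp]: "comp A (cob A (cob A X)) (cob A (cob A ?S)) (cob A ?S) (cmor A (cob A ?S) ?S d)
        (cmor A (cob A X) (cob A ?S) (cmor A X ?S (in1 b)))
      = comp A (cob A (cob A X)) (cob A X) (cob A ?S) (cmor A X ?S (in1 b)) (cmor A (cob A X) X f)"
    "comp A (cob A (cob A Y)) (cob A (cob A ?S)) (cob A ?S) (cmor A (cob A ?S) ?S d)
        (cmor A (cob A Y) (cob A ?S) (cmor A Y ?S (in2 b)))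
      = comp A (cob A (cob A Y)) (cob A Y) (cob A ?S) (cmor A Y ?S (in2 b)) (cmor A (cob A Y) Y g)"
    by (simp_all flip: cmor_comp)
  have dd: "comp A (cob A (cob A ?S)) (cob A ?S) ?S d (cmor A (cob A ?S) ?S d) = conj_nat A ?S"
    by (rule biproduct_ext[where Z = ?S, OF _ _ _ ccb]) (simp_all add: conj_biprod_def)
  have pr: "comp A (cob A ?S) ?S X (pr1 b) d = comp A (cob A ?S) (cob A X) X f (cmor A ?S X (pr1 b))"
    "comp A (cob A ?S) ?S Y (pr2 b) d = comp A (cob A ?S) (cob A Y) Y g (cmor A ?S Y (pr2 b))"
    by (rule biproduct_ext[where Z = X, OF _ _ _ cb]; simp add: conj_biprod_def)
      (rule biproduct_ext[where Z = Y, OF _ _ _ cb]; simp add: conj_biprod_def)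
  have "is_biproduct (double A) (X, f) (Y, g)
      \<lparr>sum_obj = (?S, d), in1 = in1 b, in2 = in2 b, pr1 = pr1 b, pr2 = pr2 b\<rparr>"
    by (simp add: is_biproduct_def double_arr double_simps double_ObjI dd pr)
  then show ?thesis by blast
qed

lemma biproduct_of_double:
  assumes "is_biproduct (double A) (X, f) (Y, g) b"
  shows "is_biproduct A X Y
    \<lparr>sum_obj = fst (sum_obj b), in1 = in1 b, in2 = in2 b, pr1 = pr1 b, pr2 = pr2 b\<rparr>"
proof -
  obtain D d where "sum_obj b = (D, d)" by fastforce
  then show ?thesis
    using assms by (simp add: is_biproduct_def double_simps double_arr double_Obj)
qed

text \<open>
  An idempotent \<open>e\<close> of \<open>(X, f)\<close> is split by a splitting \<open>e = t s\<close> of the underlying idempotent, with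
  \<open>f' = s f \<iota>(t)\<close> on the splitting object.  It satisfies \<open>t f' = f \<iota>(t)\<close> and \<open>f' \<iota>(s) = s f\<close>,
  because \<open>e f = f \<iota>(e)\<close>; so \<open>f' \<iota>(f') = s f \<iota>(f) \<iota>\<iota>(t) = s \<lambda> \<iota>\<iota>(t) = s t \<lambda> = \<lambda>\<close>.
\<close>

lemma pseudo_abelian_double: "pseudo_abelian (double A)"
  unfolding pseudo_abelian_def
proof (intro ballI impI)
  fix P e
  assume P': "P \<in> Obj (double A)" and e': "e \<in> arr (double A) P P"
    and ee: "comp (double A) P P P e e = e"
  obtain X f where P: "P = (X, f)" by fastforce
  note [simp] = P'[unfolded P double_Obj] e'[unfolded P double_arr] conj_calc
  obtain Y t s where st: "splits A X e Y t s"
    using category_with_conjugation ee[unfolded P double_simps] P'[unfolded P double_Obj]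
      e'[unfolded P double_arr]
    unfolding category_with_conjugation_def pseudo_abelian_def by meson
  note st' = st[unfolded splits_def]
  have ts: "comp A X Y X t s = e" using st' by blast
  note [simp] = st'
  have st [simp]: "comp A Y X Y s t = Id A Y" by simp
  have te [simp]: "comp A Y X X e t = t" "comp A X X Y s e = s"
    by (simp_all flip: ts add: comp_reduce[OF st])
  have ef: "comp A (cob A X) X X e f = comp A (cob A X) (cob A X) X f (cmor A X X e)" by simp
  have cst [simp]: "comp A (cob A Y) (cob A X) (cob A Y) (cmor A X Y s) (cmor A Y X t) = Id A (cob A Y)"
    by (simp flip: cmor_comp)
  have cts: "comp A (cob A X) (cob A Y) (cob A X) (cmor A Y X t) (cmor A X Y s) = cmor A X X e"
    by (simp flip: cmor_comp)
  have cet: "comp A (cob A Y) (cob A X) (cob A X) (cmor A X X e) (cmor A Y X t) = cmor A Y X t"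
    by (simp flip: cmor_comp)
  define f' where "f' = comp A (cob A Y) X Y s (comp A (cob A Y) (cob A X) X f (cmor A Y X t))"
  have tf: "comp A (cob A Y) Y X t f' = comp A (cob A Y) (cob A X) X f (cmor A Y X t)"
    by (simp add: f'_def comp_reduce[OF ts] comp_reduce[OF ef] cet)
  have sf: "comp A (cob A X) X Y s f = comp A (cob A X) (cob A Y) Y f' (cmor A X Y s)"
    by (simp add: f'_def cts) (subst ef[symmetric], subst comp_reduce[OF te(2)], simp_all)
  have [simp]: "f' \<in> arr A (cob A Y) Y" by (simp add: f'_def)
  have "comp A (cob A (cob A Y)) (cob A Y) Y f' (cmor A (cob A Y) Y f') =
      comp A (cob A (cob A Y)) (cob A X) Y (comp A (cob A X) (cob A Y) Y f' (cmor A X Y s))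
        (comp A (cob A (cob A Y)) (cob A (cob A X)) (cob A X) (cmor A (cob A X) X f)
          (cmor A (cob A Y) (cob A X) (cmor A Y X t)))"
    by (simp add: f'_def)
  also have "\<dots> = conj_nat A Y"
    by (simp flip: sf)
      (simp add: comp_reduce[of "cob A (cob A X)" "cob A X" X f] comp_reduce[OF st])
  finally have "(Y, f') \<in> Obj (double A)" by (simp add: double_ObjI)
  then have "splits (double A) P e (Y, f') t s"
    by (simp add: splits_def P double_arr double_simps tf sf)
  then show "\<exists>Q t s. splits (double A) P e Q t s" by blast
qed

theorem category_with_conjugation_double: "category_with_conjugation k (double A)"
  unfolding category_with_conjugation_def
proof (intro conjI ballI)
  show "additive_category k (double A)"
    unfolding additive_category_def
    using linear_category_double zero_object_double biproduct_double by fast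
  show "pseudo_abelian (double A)" by (rule pseudo_abelian_double)
  have cmor_double: "cmor (double A) P Q \<phi> \<in> arr (double A) (cob (double A) P) (cob (double A) Q)"
    if PQ: "P \<in> Obj (double A)" "Q \<in> Obj (double A)" and \<phi>': "\<phi> \<in> arr (double A) P Q" for P Q \<phi>
  proof -
    obtain X f where P: "P = (X, f)" by fastforce
    obtain Y g where Q: "Q = (Y, g)" by fastforce
    note [simp] = PQ[unfolded P Q double_Obj] \<phi>'[unfolded P Q double_arr] conj_calc
    have "comp A (cob A (cob A X)) (cob A X) (cob A Y) (cmor A X Y \<phi>) (cmor A (cob A X) X f) =
        comp A (cob A (cob A X)) (cob A (cob A Y)) (cob A Y) (cmor A (cob A Y) Y g)
          (cmor A (cob A X) (cob A Y) (cmor A X Y \<phi>))"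
      by (simp flip: cmor_comp)
    then show ?thesis by (simp add: P Q double_simps double_arr)
  qed
  show lin: "linear_functor k (double A) (double A) (conj_functor (double A))"
    unfolding linear_functor_def
    by (intro conjI ballI; (fact double_cob_Obj cmor_double)?)
      (auto simp: double_simps conj_calc double_Obj double_arr)
  have nat_double: "conj_nat (double A) P \<in> arr (double A) (cob (double A) (cob (double A) P)) P"
    if P': "P \<in> Obj (double A)" for P
  proof -
    obtain X f where P: "P = (X, f)" by fastforce
    note [simp] = P'[unfolded P double_Obj]
    show ?thesis by (simp add: P double_simps double_arr conj_calc)
  qed
  show "natural_iso (double A) (double A) (conj_functor (double A) \<circ>\<^sub>F conj_functor (double A))
      id_functor (conj_nat (double A))"
    unfolding natural_iso_def comp_functor_def id_functor_def funct.simps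
  proof (intro conjI ballI)
    fix P assume P': "P \<in> Obj (double A)"
    obtain X f where P: "P = (X, f)" by fastforce
    show "iso_arr (double A) (cob (double A) (cob (double A) P)) P (conj_nat (double A) P)"
      using double_cob_Obj[OF double_cob_Obj[OF P']] nat_double[OF P'] P'
      by (auto simp: P double_simps conj_calc double_Obj intro!: iso_arr_double iso_arr_minus conj_nat_iso)
  qed (auto simp: double_simps conj_calc double_Obj double_arr)
  fix P assume P': "P \<in> Obj (double A)"
  obtain X f where P: "P = (X, f)" by fastforce
  have "conj_nat (double A) (cob (double A) P)
      = \<ominus>\<^bsub>Hom A (cob A (cob A (cob A X))) (cob A X)\<^esub> conj_nat A (cob A X)"
    by (simp add: P double_simps)
  then show "conj_nat (double A) (cob (double A) P)
      = cmor (double A) (cob (double A) (cob (double A) P)) P (conj_nat (double A) P)"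
    using P' by (simp add: P double_simps double_Obj conj_calc)
qed

section \<open>The double of the double\<close>

interpretation dbl: conj_category k "double A"
  by unfold_locales (rule category_with_conjugation_double)

lemma conj_category_double_double: "conj_category k (double (double A))"
  by unfold_locales (rule dbl.category_with_conjugation_double)

lemma comp_cmor:
  assumes "comp A X Y Z g f = h" "X \<in> Obj A" "Y \<in> Obj A" "Z \<in> Obj A" "f \<in> arr A X Y" "g \<in> arr A Y Z"
  shows "comp A (cob A X) (cob A Y) (cob A Z) (cmor A Y Z g) (cmor A X Y f) = cmor A X Z h"
  using assms by (simp add: cmor_comp flip: assms(1))

lemma double_double_arr:
  "\<phi> \<in> arr (double (double A)) ((X, f), g) ((X', f'), g') \<longleftrightarrow> \<phi> \<in> arr A X X' \<and>
    comp A (cob A X) X X' \<phi> f = comp A (cob A X) (cob A X') X' f' (cmor A X X' \<phi>) \<and>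
    comp A (cob A X) X X' \<phi> g = comp A (cob A X) (cob A X') X' g' (cmor A X X' \<phi>)"
  by (simp add: double_arr double_simps)

lemma double_double_ObjI:
  assumes "X \<in> Obj A" "f \<in> arr A (cob A X) X" "g \<in> arr A (cob A X) X"
    and "comp A (cob A (cob A X)) (cob A X) X f (cmor A (cob A X) X f) = conj_nat A X"
    and "comp A (cob A (cob A X)) (cob A X) X g (cmor A (cob A X) X g)
      = \<ominus>\<^bsub>Hom A (cob A (cob A X)) X\<^esub> conj_nat A X"
    and "comp A (cob A (cob A X)) (cob A X) X g (cmor A (cob A X) X f)
      = \<ominus>\<^bsub>Hom A (cob A (cob A X)) X\<^esub> comp A (cob A (cob A X)) (cob A X) X f (cmor A (cob A X) X g)"
  shows "((X, f), g) \<in> Obj (double (double A))"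
proof (rule dbl.double_ObjI)
  show "(X, f) \<in> Obj (double A)" using assms by (intro double_ObjI)
  show "g \<in> arr (double A) (cob (double A) (X, f)) (X, f)"
    using assms by (simp add: double_simps double_arr conj_calc)
qed (use assms in \<open>simp add: double_simps\<close>)

lemma double_double_ObjD:
  assumes "((X, f), g) \<in> Obj (double (double A))"
  shows "(X, f) \<in> Obj (double A)" "X \<in> Obj A" "f \<in> arr A (cob A X) X" "g \<in> arr A (cob A X) X"
    and "iso_arr A (cob A X) X f"
    and "comp A (cob A (cob A X)) (cob A X) X f (cmor A (cob A X) X f) = conj_nat A X"
    and "comp A (cob A (cob A X)) (cob A X) X g (cmor A (cob A X) X g)
      = \<ominus>\<^bsub>Hom A (cob A (cob A X)) X\<^esub> conj_nat A X"
    and "comp A (cob A (cob A X)) (cob A X) X g (cmor A (cob A X) X f)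
      = \<ominus>\<^bsub>Hom A (cob A (cob A X)) X\<^esub> comp A (cob A (cob A X)) (cob A X) X f (cmor A (cob A X) X g)"
proof -
  note D = double_ObjD[OF assms]
  show P: "(X, f) \<in> Obj (double A)" by (rule D)
  note [simp] = double_ObjD[OF P] conj_calc
  show "X \<in> Obj A" "f \<in> arr A (cob A X) X" "iso_arr A (cob A X) X f"
    "comp A (cob A (cob A X)) (cob A X) X f (cmor A (cob A X) X f) = conj_nat A X"
    by simp_all
  show g [simp]: "g \<in> arr A (cob A X) X"
    using D(2) by (simp add: double_simps double_arr)
  show "comp A (cob A (cob A X)) (cob A X) X g (cmor A (cob A X) X g)
      = \<ominus>\<^bsub>Hom A (cob A (cob A X)) X\<^esub> conj_nat A X"
    using D(4) by (simp add: double_simps)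
  have "\<ominus>\<^bsub>Hom A (cob A (cob A X)) X\<^esub> comp A (cob A (cob A X)) (cob A X) X g (cmor A (cob A X) X f)
      = comp A (cob A (cob A X)) (cob A X) X f (cmor A (cob A X) X g)"
    using D(2) by (simp add: double_simps double_arr)
  from arg_cong[OF this, of "\<lambda>x. \<ominus>\<^bsub>Hom A (cob A (cob A X)) X\<^esub> x"]
  show "comp A (cob A (cob A X)) (cob A X) X g (cmor A (cob A X) X f)
      = \<ominus>\<^bsub>Hom A (cob A (cob A X)) X\<^esub> comp A (cob A (cob A X)) (cob A X) X f (cmor A (cob A X) X g)"
    by simp
qed

text \<open>
  The sign in front of \<open>\<iota>(g)\<close> is formed in the hom-module of the double; by \<open>double_minus\<close> it is
  the sign of the original category.
\<close>

lemma double_double_cob: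
  assumes "((X, f), g) \<in> Obj (double (double A))"
  shows "cob (double (double A)) ((X, f), g)
    = ((cob A X, \<ominus>\<^bsub>Hom A (cob A (cob A X)) (cob A X)\<^esub> cmor A (cob A X) X f),
        \<ominus>\<^bsub>Hom A (cob A (cob A X)) (cob A X)\<^esub> cmor A (cob A X) X g)"
proof -
  note D = double_ObjD[OF assms]
  have "cmor (double A) (cob (double A) (X, f)) (X, f) g
      \<in> arr (double A) (cob (double A) (cob (double A) (X, f))) (cob (double A) (X, f))"
    by (intro dbl.cmor_arr dbl.cob_Obj D)
  moreover have "cob (double A) (X, f) \<in> Obj (double A)"
    "cob (double A) (cob (double A) (X, f)) \<in> Obj (double A)"
    by (intro dbl.cob_Obj D)+
  ultimately show ?thesis
    by (simp add: double_simps double_minus)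
qed

text \<open>
  The signs introduced by the two doublings cancel.
\<close>

lemma double_double_conj_nat:
  assumes "((X, f), g) \<in> Obj (double (double A))"
  shows "conj_nat (double (double A)) ((X, f), g) = conj_nat A X"
proof -
  note D = double_ObjD[OF assms]
  have "conj_nat (double A) (X, f) \<in> arr (double A) (cob (double A) (cob (double A) (X, f))) (X, f)"
    "cob (double A) (cob (double A) (X, f)) \<in> Obj (double A)"
    by (intro dbl.conj_nat_arr dbl.cob_Obj D)+
  then show ?thesis
    using D(1) double_ObjD[OF D(1)] by (simp add: double_simps double_minus conj_calc)
qed

lemma iso_arr_double_double:
  assumes P: "((X, f), g) \<in> Obj (double (double A))" and Q: "((X', f'), g') \<in> Obj (double (double A))"
    and \<phi>: "\<phi> \<in> arr (double (double A)) ((X, f), g) ((X', f'), g')" and iso: "iso_arr A X X' \<phi>"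
  shows "iso_arr (double (double A)) ((X, f), g) ((X', f'), g') \<phi>"
proof (rule dbl.iso_arr_double[OF P Q \<phi>])
  have "\<phi> \<in> arr (double A) (X, f) (X', f')"
    using \<phi> unfolding double_double_arr double_arr by blast
  then show "iso_arr (double A) (X, f) (X', f') \<phi>"
    by (rule iso_arr_double[OF double_double_ObjD(1)[OF P] double_double_ObjD(1)[OF Q] _ iso])
qed

abbreviation base :: "('o \<times> 'm) \<times> 'm \<Rightarrow> 'o" where "base P \<equiv> fst (fst P)"

lemma dd_cases:
  assumes "P \<in> Obj (double (double A))"
  obtains X f g where "P = ((X, f), g)" "((X, f), g) \<in> Obj (double (double A))"
  using that[of "fst (fst P)" "snd (fst P)" "snd P"] assms by simp

lemma base_Obj: "P \<in> Obj (double (double A)) \<Longrightarrow> base P \<in> Obj A"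
  by (erule dd_cases) (simp add: double_double_ObjD)

lemma base_arr: "\<phi> \<in> arr (double (double A)) P Q \<Longrightarrow> \<phi> \<in> arr A (base P) (base Q)"
  by (cases P; cases Q) (auto simp: double_double_arr)

lemma base_cob: "P \<in> Obj (double (double A)) \<Longrightarrow> base (cob (double (double A)) P) = cob A (base P)"
  by (erule dd_cases) (simp add: double_double_cob)

lemma cmor_double_double: "cmor (double (double A)) P Q = cmor A (base P) (base Q)"
  by (cases P; cases Q) (auto simp: double_simps)

lemma conj_nat_double_double:
  "P \<in> Obj (double (double A)) \<Longrightarrow> conj_nat (double (double A)) P = conj_nat A (base P)"
  by (erule dd_cases) (simp add: double_double_conj_nat)

end

section \<open>The functors on sums \<open>X \<oplus> \<iota>(X)\<close>\<close>

locale conj_category_sums = conj_category k A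
  for k :: "'k ring" and A :: "('o, 'm, 'k) conjcat" +
  fixes S :: "'o \<Rightarrow> ('o, 'm) biprod"
  assumes sum_choice: "sum_choice A S"
begin

lemma biproduct_S: "X \<in> Obj A \<Longrightarrow> is_biproduct A X (cob A X) (S X)"
  using sum_choice by (simp add: sum_choice_def)

lemma conj_biproduct_S:
  "X \<in> Obj A \<Longrightarrow> is_biproduct A (cob A X) (cob A (cob A X)) (conj_biprod A X (cob A X) (S X))"
  by (intro conj_biprod biproduct_S cob_Obj)

lemma conj_conj_biproduct_S:
  "X \<in> Obj A \<Longrightarrow> is_biproduct A (cob A (cob A X)) (cob A (cob A (cob A X)))
     (conj_biprod A (cob A X) (cob A (cob A X)) (conj_biprod A X (cob A X) (S X)))"
  by (intro conj_biprod biproduct_S cob_Obj)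

lemmas S_typing = biproductD(1-5)[OF biproduct_S]
lemmas S_eqs = biproductD(6-9)[OF biproduct_S]

lemma sum_ext:
  assumes "X \<in> Obj A" "Z \<in> Obj A" "f \<in> arr A (sum_obj (S X)) Z" "g \<in> arr A (sum_obj (S X)) Z"
    and "comp A X (sum_obj (S X)) Z f (in1 (S X)) = comp A X (sum_obj (S X)) Z g (in1 (S X))"
    and "comp A (cob A X) (sum_obj (S X)) Z f (in2 (S X)) = comp A (cob A X) (sum_obj (S X)) Z g (in2 (S X))"
  shows "f = g"
  by (rule biproduct_ext[OF _ _ _ biproduct_S]) (use assms in \<open>simp_all add: cob_Obj\<close>)

lemma conj_sum_ext:
  assumes "X \<in> Obj A" "Z \<in> Obj A" "f \<in> arr A (cob A (sum_obj (S X))) Z" "g \<in> arr A (cob A (sum_obj (S X))) Z"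
    and "comp A (cob A X) (cob A (sum_obj (S X))) Z f (cmor A X (sum_obj (S X)) (in1 (S X)))
      = comp A (cob A X) (cob A (sum_obj (S X))) Z g (cmor A X (sum_obj (S X)) (in1 (S X)))"
    and "comp A (cob A (cob A X)) (cob A (sum_obj (S X))) Z f (cmor A (cob A X) (sum_obj (S X)) (in2 (S X)))
      = comp A (cob A (cob A X)) (cob A (sum_obj (S X))) Z g (cmor A (cob A X) (sum_obj (S X)) (in2 (S X)))"
  shows "f = g"
  by (rule biproduct_ext[OF _ _ _ conj_biproduct_S]) (use assms in \<open>simp_all add: cob_Obj conj_biprod_def\<close>)

lemma conj_conj_sum_ext:
  assumes "X \<in> Obj A" "Z \<in> Obj A"
    "f \<in> arr A (cob A (cob A (sum_obj (S X)))) Z" "g \<in> arr A (cob A (cob A (sum_obj (S X)))) Z"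
    and "comp A (cob A (cob A X)) (cob A (cob A (sum_obj (S X)))) Z f
        (cmor A (cob A X) (cob A (sum_obj (S X))) (cmor A X (sum_obj (S X)) (in1 (S X))))
      = comp A (cob A (cob A X)) (cob A (cob A (sum_obj (S X)))) Z g
        (cmor A (cob A X) (cob A (sum_obj (S X))) (cmor A X (sum_obj (S X)) (in1 (S X))))"
    and "comp A (cob A (cob A (cob A X))) (cob A (cob A (sum_obj (S X)))) Z f
        (cmor A (cob A (cob A X)) (cob A (sum_obj (S X))) (cmor A (cob A X) (sum_obj (S X)) (in2 (S X))))
      = comp A (cob A (cob A (cob A X))) (cob A (cob A (sum_obj (S X)))) Z g
        (cmor A (cob A (cob A X)) (cob A (sum_obj (S X))) (cmor A (cob A X) (sum_obj (S X)) (in2 (S X))))"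
  shows "f = g"
  by (rule biproduct_ext[OF _ _ _ conj_conj_biproduct_S]) (use assms in \<open>simp_all add: cob_Obj conj_biprod_def\<close>)

lemma Lambda_arr: "X \<in> Obj A \<Longrightarrow> Lambda A S X \<in> arr A (cob A (sum_obj (S X))) (sum_obj (S X))"
  and Lambda_in1: "X \<in> Obj A \<Longrightarrow> comp A (cob A X) (cob A (sum_obj (S X))) (sum_obj (S X))
      (Lambda A S X) (cmor A X (sum_obj (S X)) (in1 (S X))) = in2 (S X)"
  and Lambda_in2: "X \<in> Obj A \<Longrightarrow> comp A (cob A (cob A X)) (cob A (sum_obj (S X))) (sum_obj (S X))
      (Lambda A S X) (cmor A (cob A X) (sum_obj (S X)) (in2 (S X)))
      = comp A (cob A (cob A X)) X (sum_obj (S X)) (in1 (S X)) (conj_nat A X)"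
  using matrix[OF _ _ _ _ conj_biproduct_S biproduct_S]
  by (simp_all add: Lambda_def conj_matrix_def conj_biprod_def conj_calc S_typing)

lemma Delta_arr: "X \<in> Obj A \<Longrightarrow> Delta A S X \<in> arr A (cob A (sum_obj (S X))) (sum_obj (S X))"
  and Delta_in1: "X \<in> Obj A \<Longrightarrow> comp A (cob A X) (cob A (sum_obj (S X))) (sum_obj (S X))
      (Delta A S X) (cmor A X (sum_obj (S X)) (in1 (S X))) = in2 (S X)"
  and Delta_in2: "X \<in> Obj A \<Longrightarrow> comp A (cob A (cob A X)) (cob A (sum_obj (S X))) (sum_obj (S X))
      (Delta A S X) (cmor A (cob A X) (sum_obj (S X)) (in2 (S X)))
      = \<ominus>\<^bsub>Hom A (cob A (cob A X)) (sum_obj (S X))\<^esub>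
        comp A (cob A (cob A X)) X (sum_obj (S X)) (in1 (S X)) (conj_nat A X)"
  using matrix[OF _ _ _ _ conj_biproduct_S biproduct_S]
  by (simp_all add: Delta_def conj_matrix_def conj_biprod_def conj_calc S_typing)

lemma diag:
  assumes "X \<in> Obj A" "Y \<in> Obj A" "a \<in> arr A X Y" "d \<in> arr A (cob A X) (cob A Y)"
  shows diag_arr: "diag A S X Y a d \<in> arr A (sum_obj (S X)) (sum_obj (S Y))"
    and diag_in1: "comp A X (sum_obj (S X)) (sum_obj (S Y)) (diag A S X Y a d) (in1 (S X))
      = comp A X Y (sum_obj (S Y)) (in1 (S Y)) a"
    and diag_in2: "comp A (cob A X) (sum_obj (S X)) (sum_obj (S Y)) (diag A S X Y a d) (in2 (S X))
      = comp A (cob A X) (cob A Y) (sum_obj (S Y)) (in2 (S Y)) d"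
  using assms matrix[OF _ _ _ _ biproduct_S biproduct_S, of X Y]
  by (simp_all add: diag_def conj_calc S_typing)

lemma psi_arr: "X \<in> Obj A \<Longrightarrow> psi A S X \<in> arr A (sum_obj (S (cob A X))) (cob A (sum_obj (S X)))"
  and psi_in1: "X \<in> Obj A \<Longrightarrow> comp A (cob A X) (sum_obj (S (cob A X))) (cob A (sum_obj (S X)))
      (psi A S X) (in1 (S (cob A X))) = cmor A X (sum_obj (S X)) (in1 (S X))"
  and psi_in2: "X \<in> Obj A \<Longrightarrow>
      comp A (cob A (cob A X)) (sum_obj (S (cob A X))) (cob A (sum_obj (S X))) (psi A S X) (in2 (S (cob A X)))
      = \<ominus>\<^bsub>Hom A (cob A (cob A X)) (cob A (sum_obj (S X)))\<^esub>
        cmor A (cob A X) (sum_obj (S X)) (in2 (S X))"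
  using matrix[OF _ _ _ _ biproduct_S conj_biproduct_S, of "cob A X" X]
  by (simp_all add: psi_def Let_def conj_biprod_def conj_calc S_typing)

lemmas sum_arrs = S_typing Lambda_arr Delta_arr diag_arr psi_arr
lemmas sum_eqs = S_eqs Lambda_in1 Lambda_in2 Delta_in1 Delta_in2 diag_in1 diag_in2 psi_in1 psi_in2

text \<open>
  Each equation of \<open>sum_eqs\<close> is used in four forms: as it stands, followed by a further morphism on
  the right, and both of these after applying \<open>\<iota>\<close>.
\<close>

lemmas sum_calc = conj_calc sum_arrs sum_eqs sum_eqs[THEN comp_reduce]
  sum_eqs[THEN comp_cmor] sum_eqs[THEN comp_cmor, THEN comp_reduce]

lemma pr1_diag:
  assumes [simp]: "X \<in> Obj A" "Y \<in> Obj A" "a \<in> arr A X Y" "d \<in> arr A (cob A X) (cob A Y)"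
  shows "comp A (sum_obj (S X)) (sum_obj (S Y)) Y (pr1 (S Y)) (diag A S X Y a d)
    = comp A (sum_obj (S X)) X Y a (pr1 (S X))"
  by (rule sum_ext[where X = X and Z = Y]) (simp_all add: sum_calc)

lemma cmor_pr1_psi:
  assumes [simp]: "X \<in> Obj A"
  shows "comp A (sum_obj (S (cob A X))) (cob A (sum_obj (S X))) (cob A X)
    (cmor A (sum_obj (S X)) X (pr1 (S X))) (psi A S X) = pr1 (S (cob A X))"
  by (rule sum_ext[where X = "cob A X" and Z = "cob A X"]) (simp_all add: sum_calc)

lemma Lambda_Lambda:
  assumes [simp]: "X \<in> Obj A"
  shows "comp A (cob A (cob A (sum_obj (S X)))) (cob A (sum_obj (S X))) (sum_obj (S X))
    (Lambda A S X) (cmor A (cob A (sum_obj (S X))) (sum_obj (S X)) (Lambda A S X)) = conj_nat A (sum_obj (S X))"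
  by (rule conj_conj_sum_ext[where X = X and Z = "sum_obj (S X)"]) (simp_all add: sum_calc)

text \<open>
  With \<open>\<Lambda>\<close> and \<open>\<Delta>\<close> given by their columns, the equations \<open>\<Delta> \<iota>(\<Delta>) = -\<lambda>\<close> and
  \<open>\<Delta> \<iota>(\<Lambda>) = -\<Lambda> \<iota>(\<Delta>)\<close> are checked on the two inclusions.
\<close>

lemma Psi_Obj:
  assumes [simp]: "X \<in> Obj A"
  shows "ob (Psi A S) X \<in> Obj (double (double A))"
proof -
  have 1: "comp A (cob A (cob A (sum_obj (S X)))) (cob A (sum_obj (S X))) (sum_obj (S X)) (Delta A S X)
      (cmor A (cob A (sum_obj (S X))) (sum_obj (S X)) (Delta A S X))
      = \<ominus>\<^bsub>Hom A (cob A (cob A (sum_obj (S X)))) (sum_obj (S X))\<^esub> conj_nat A (sum_obj (S X))"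
    by (rule conj_conj_sum_ext[where X = X and Z = "sum_obj (S X)"]) (simp_all add: sum_calc)
  have 2: "comp A (cob A (cob A (sum_obj (S X)))) (cob A (sum_obj (S X))) (sum_obj (S X)) (Delta A S X)
      (cmor A (cob A (sum_obj (S X))) (sum_obj (S X)) (Lambda A S X))
      = \<ominus>\<^bsub>Hom A (cob A (cob A (sum_obj (S X)))) (sum_obj (S X))\<^esub>
      comp A (cob A (cob A (sum_obj (S X)))) (cob A (sum_obj (S X))) (sum_obj (S X)) (Lambda A S X)
      (cmor A (cob A (sum_obj (S X))) (sum_obj (S X)) (Delta A S X))"
    by (rule conj_conj_sum_ext[where X = X and Z = "sum_obj (S X)"]) (simp_all add: sum_calc)
  show ?thesis
    unfolding Psi_def funct.simps
    by (rule double_double_ObjI) (simp_all add: Lambda_Lambda 1 2 sum_arrs conj_calc)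
qed

lemma Psi_arr:
  assumes [simp]: "X \<in> Obj A" "Y \<in> Obj A" "f \<in> arr A X Y"
  shows "mor (Psi A S) X Y f \<in> arr (double (double A)) (ob (Psi A S) X) (ob (Psi A S) Y)"
  unfolding Psi_def funct.simps double_double_arr
  by (intro conjI; (rule conj_sum_ext[where X = X and Z = "sum_obj (S Y)"])?) (simp_all add: sum_calc)

lemma linear_functor_sum: "linear_functor k A A (G_functor \<circ>\<^sub>F F_functor A S)"
  unfolding linear_functor_def comp_functor_def G_functor_def F_functor_def funct.simps fst_conv
proof (intro conjI ballI)
  fix X assume [simp]: "X \<in> Obj A"
  show "sum_obj (S X) \<in> Obj A" by (simp add: sum_arrs)
  show "diag A S X X (Id A X) (cmor A X X (Id A X)) = Id A (sum_obj (S X))"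
    by (rule sum_ext[where X = X and Z = "sum_obj (S X)"]) (simp_all add: sum_calc)
  fix Y assume [simp]: "Y \<in> Obj A"
  show "diag A S X Y (a \<odot>\<^bsub>Hom A X Y\<^esub> f) (cmor A X Y (a \<odot>\<^bsub>Hom A X Y\<^esub> f))
      = a \<odot>\<^bsub>Hom A (sum_obj (S X)) (sum_obj (S Y))\<^esub> diag A S X Y f (cmor A X Y f)"
    if [simp]: "a \<in> carrier k" "f \<in> arr A X Y" for a f
    by (rule sum_ext[where X = X and Z = "sum_obj (S Y)"]) (simp_all add: sum_calc)
  fix f assume [simp]: "f \<in> arr A X Y"
  show "diag A S X Y f (cmor A X Y f) \<in> arr A (sum_obj (S X)) (sum_obj (S Y))"
    by (simp add: sum_calc)
  show "diag A S X Y (f \<oplus>\<^bsub>Hom A X Y\<^esub> g) (cmor A X Y (f \<oplus>\<^bsub>Hom A X Y\<^esub> g))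
      = diag A S X Y f (cmor A X Y f) \<oplus>\<^bsub>Hom A (sum_obj (S X)) (sum_obj (S Y))\<^esub> diag A S X Y g (cmor A X Y g)"
    if [simp]: "g \<in> arr A X Y" for g
    by (rule sum_ext[where X = X and Z = "sum_obj (S Y)"]) (simp_all add: sum_calc)
  fix Z g assume [simp]: "Z \<in> Obj A" "g \<in> arr A Y Z"
  show "diag A S X Z (comp A X Y Z g f) (cmor A X Z (comp A X Y Z g f))
      = comp A (sum_obj (S X)) (sum_obj (S Y)) (sum_obj (S Z))
        (diag A S Y Z g (cmor A Y Z g)) (diag A S X Y f (cmor A X Y f))"
    by (rule sum_ext[where X = X and Z = "sum_obj (S Z)"]) (simp_all add: sum_calc)
qed

lemma linear_functor_F: "linear_functor k A (double A) (F_functor A S)"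
proof (rule linear_functor_doubleI[OF linear_functor_sum])
  show "ob (F_functor A S) X \<in> Obj (double A)" if "X \<in> Obj A" for X
    using double_double_ObjD(1)[OF Psi_Obj[OF that, unfolded Psi_def funct.simps]]
    by (simp add: F_functor_def)
  show "mor (F_functor A S) X Y f \<in> arr (double A) (ob (F_functor A S) X) (ob (F_functor A S) Y)"
    if "X \<in> Obj A" "Y \<in> Obj A" "f \<in> arr A X Y" for X Y f
    using Psi_arr[OF that] by (simp add: Psi_def F_functor_def double_double_arr double_arr)
qed

lemma G_Psi: "G_functor \<circ>\<^sub>F Psi A S = F_functor A S"
  by (simp add: comp_functor_def G_functor_def Psi_def F_functor_def)

lemma linear_functor_Psi: "linear_functor k A (double (double A)) (Psi A S)"
  by (rule linear_functor_doubleI) (simp_all add: G_Psi linear_functor_F Psi_Obj Psi_arr)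

interpretation dd: conj_category k "double (double A)"
  by (rule conj_category_double_double)

lemma psi_double_double:
  assumes [simp]: "X \<in> Obj A"
  shows "psi A S X \<in> arr (double (double A)) (ob (Psi A S) (cob A X))
    (cob (double (double A)) (ob (Psi A S) X))"
proof -
  note P = Psi_Obj[OF \<open>X \<in> Obj A\<close>, unfolded Psi_def funct.simps]
  show ?thesis
    unfolding Psi_def funct.simps double_double_cob[OF P] double_double_arr
    by (intro conjI; (rule conj_sum_ext[where X = "cob A X" and Z = "cob A (sum_obj (S X))"])?)
      (simp_all add: sum_calc)
qed

text \<open>
  The inverse is the diagonal matrix \<open>(1, -1)\<close> in the other direction.
\<close>

lemma iso_arr_psi:
  assumes [simp]: "X \<in> Obj A"
  shows "iso_arr A (sum_obj (S (cob A X))) (cob A (sum_obj (S X))) (psi A S X)"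
proof -
  define \<chi> where "\<chi> = copair A (cob A X) (cob A (cob A X)) (conj_biprod A X (cob A X) (S X))
    (sum_obj (S (cob A X))) (in1 (S (cob A X)))
    (\<ominus>\<^bsub>Hom A (cob A (cob A X)) (sum_obj (S (cob A X)))\<^esub> in2 (S (cob A X)))"
  have \<chi>: "\<chi> \<in> arr A (cob A (sum_obj (S X))) (sum_obj (S (cob A X)))"
    "comp A (cob A X) (cob A (sum_obj (S X))) (sum_obj (S (cob A X))) \<chi>
      (cmor A X (sum_obj (S X)) (in1 (S X))) = in1 (S (cob A X))"
    "comp A (cob A (cob A X)) (cob A (sum_obj (S X))) (sum_obj (S (cob A X))) \<chi>
      (cmor A (cob A X) (sum_obj (S X)) (in2 (S X)))
      = \<ominus>\<^bsub>Hom A (cob A (cob A X)) (sum_obj (S (cob A X)))\<^esub> in2 (S (cob A X))"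
    using copair[OF _ _ _ conj_biproduct_S, of X "sum_obj (S (cob A X))" "in1 (S (cob A X))"
        "\<ominus>\<^bsub>Hom A (cob A (cob A X)) (sum_obj (S (cob A X)))\<^esub> in2 (S (cob A X))"]
    by (simp_all add: \<chi>_def conj_biprod_def sum_arrs conj_calc)
  have "comp A (sum_obj (S (cob A X))) (cob A (sum_obj (S X))) (sum_obj (S (cob A X))) \<chi> (psi A S X)
      = Id A (sum_obj (S (cob A X)))"
    by (rule sum_ext[where X = "cob A X" and Z = "sum_obj (S (cob A X))"])
      (simp_all add: sum_calc \<chi>)
  moreover have "comp A (cob A (sum_obj (S X))) (sum_obj (S (cob A X))) (cob A (sum_obj (S X))) (psi A S X) \<chi>
      = Id A (cob A (sum_obj (S X)))"
    by (rule conj_sum_ext[where X = X and Z = "cob A (sum_obj (S X))"])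
      (simp_all add: sum_calc \<chi>)
  ultimately show ?thesis
    unfolding iso_arr_def inverse_arrs_def using \<chi>(1) psi_arr by auto
qed

lemma iso_arr_psi_double_double:
  assumes [simp]: "X \<in> Obj A"
  shows "iso_arr (double (double A)) (ob (Psi A S) (cob A X))
    (cob (double (double A)) (ob (Psi A S) X)) (psi A S X)"
proof -
  have 1: "ob (Psi A S) (cob A X) \<in> Obj (double (double A))"
    "cob (double (double A)) (ob (Psi A S) X) \<in> Obj (double (double A))"
    by (intro dd.cob_Obj Psi_Obj cob_Obj assms)+
  note P = Psi_Obj[OF \<open>X \<in> Obj A\<close>, unfolded Psi_def funct.simps]
  show ?thesis
    using 1 psi_double_double[OF assms] iso_arr_psi[OF assms]
    unfolding Psi_def funct.simps double_double_cob[OF P]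
    by (intro iso_arr_double_double)
qed

text \<open>
  The condition on \<open>\<lambda>\<close> becomes, after composing with \<open>\<psi>\<close> at \<open>\<iota>(X)\<close>, the equality
  \<open>\<lambda> \<iota>(\<psi>) \<psi> = \<Psi>(\<lambda>)\<close> of morphisms out of \<open>\<iota>\<iota>(X) \<oplus> \<iota>\<iota>\<iota>(X)\<close>; on the second summand the two signs
  of \<open>\<psi>\<close> cancel.
\<close>

theorem conj_morphism_Psi: "conj_morphism k A (double (double A)) (Psi A S, psi A S)"
  unfolding conj_morphism_def prod.case natural_iso_def
proof (intro conjI ballI)
  show "category_with_conjugation k A" "category_with_conjugation k (double (double A))"
    by (rule category_with_conjugation dd.category_with_conjugation)+
  show "linear_functor k A (double (double A)) (Psi A S)" by (rule linear_functor_Psi)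
  fix X assume [simp]: "X \<in> Obj A"
  note P = Psi_Obj[OF \<open>X \<in> Obj A\<close>, unfolded Psi_def funct.simps]
  show "iso_arr (double (double A)) (ob (Psi A S \<circ>\<^sub>F conj_functor A) X)
      (ob (conj_functor (double (double A)) \<circ>\<^sub>F Psi A S) X) (psi A S X)"
    using iso_arr_psi_double_double by (simp add: comp_functor_def)
  show "comp (double (double A)) (cob (double (double A)) (ob (Psi A S) (cob A X)))
        (cob (double (double A)) (cob (double (double A)) (ob (Psi A S) X))) (ob (Psi A S) X)
        (conj_nat (double (double A)) (ob (Psi A S) X))
        (cmor (double (double A)) (ob (Psi A S) (cob A X))
          (cob (double (double A)) (ob (Psi A S) X)) (psi A S X))
      = comp (double (double A)) (cob (double (double A)) (ob (Psi A S) (cob A X)))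
        (ob (Psi A S) (cob A (cob A X))) (ob (Psi A S) X)
        (mor (Psi A S) (cob A (cob A X)) X (conj_nat A X))
        (inv_arr (double (double A)) (ob (Psi A S) (cob A (cob A X)))
          (cob (double (double A)) (ob (Psi A S) (cob A X))) (psi A S (cob A X)))"
      (is "?l = _")
  proof (rule dd.comp_inv_arrI)
    show "?l \<in> arr (double (double A)) (cob (double (double A)) (ob (Psi A S) (cob A X))) (ob (Psi A S) X)"
      by (intro dd.comp_arr dd.conj_nat_arr dd.cmor_arr psi_double_double dd.cob_Obj Psi_Obj cob_Obj) simp_all
    note P' = Psi_Obj[OF cob_Obj[OF \<open>X \<in> Obj A\<close>], unfolded Psi_def funct.simps]
    have "comp A (sum_obj (S (cob A (cob A X)))) (cob A (sum_obj (S (cob A X)))) (sum_obj (S X))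
        (comp A (cob A (sum_obj (S (cob A X)))) (cob A (cob A (sum_obj (S X)))) (sum_obj (S X))
          (conj_nat A (sum_obj (S X)))
          (cmor A (sum_obj (S (cob A X))) (cob A (sum_obj (S X))) (psi A S X)))
        (psi A S (cob A X))
      = diag A S (cob A (cob A X)) X (conj_nat A X) (conj_nat A (cob A X))"
      by (rule sum_ext[where X = "cob A (cob A X)" and Z = "sum_obj (S X)"]) (simp_all add: sum_calc)
    then show "comp (double (double A)) (ob (Psi A S) (cob A (cob A X)))
        (cob (double (double A)) (ob (Psi A S) (cob A X))) (ob (Psi A S) X) ?l (psi A S (cob A X))
      = mor (Psi A S) (cob A (cob A X)) X (conj_nat A X)"
      unfolding Psi_def funct.simps double_double_cob[OF P] double_double_cob[OF P']
        double_double_conj_nat[OF P]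
      by (simp add: double_simps_fst double_simps cmor_conj_nat)
  qed (auto intro!: iso_arr_psi_double_double Psi_Obj Psi_arr cob_Obj dd.cob_Obj conj_nat_arr)
  fix Y f assume [simp]: "Y \<in> Obj A" "f \<in> arr A X Y"
  note Q = Psi_Obj[OF \<open>Y \<in> Obj A\<close>, unfolded Psi_def funct.simps]
  have "comp A (sum_obj (S (cob A X))) (sum_obj (S (cob A Y))) (cob A (sum_obj (S Y))) (psi A S Y)
        (diag A S (cob A X) (cob A Y) (cmor A X Y f) (cmor A (cob A X) (cob A Y) (cmor A X Y f)))
      = comp A (sum_obj (S (cob A X))) (cob A (sum_obj (S X))) (cob A (sum_obj (S Y)))
        (cmor A (sum_obj (S X)) (sum_obj (S Y)) (diag A S X Y f (cmor A X Y f))) (psi A S X)"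
    by (rule sum_ext[where X = "cob A X" and Z = "cob A (sum_obj (S Y))"]) (simp_all add: sum_calc)
  then show "comp (double (double A)) (ob (Psi A S \<circ>\<^sub>F conj_functor A) X)
        (ob (Psi A S \<circ>\<^sub>F conj_functor A) Y) (ob (conj_functor (double (double A)) \<circ>\<^sub>F Psi A S) Y)
        (psi A S Y) (mor (Psi A S \<circ>\<^sub>F conj_functor A) X Y f)
      = comp (double (double A)) (ob (Psi A S \<circ>\<^sub>F conj_functor A) X)
        (ob (conj_functor (double (double A)) \<circ>\<^sub>F Psi A S) X)
        (ob (conj_functor (double (double A)) \<circ>\<^sub>F Psi A S) Y)
        (mor (conj_functor (double (double A)) \<circ>\<^sub>F Psi A S) X Y f) (psi A S X)"
    unfolding Psi_def funct.simps comp_functor_def double_double_cob[OF P] double_double_cob[OF Q]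
    by (simp add: double_simps_fst double_simps)
qed

end

section \<open>The involution of an object of the double of the double\<close>

text \<open>
  The endomorphism \<open>h = g f\<inverse>\<close> of \<open>X\<close>, denoted by \<open>h\<close> in the explanations that follow.
\<close>

definition involution :: "('o, 'm, 'k) conjcat \<Rightarrow> 'o \<Rightarrow> 'm \<Rightarrow> 'm \<Rightarrow> 'm" where
  "involution A X f g = comp A X (cob A X) X g (inv_arr A (cob A X) X f)"

context conj_category
begin

context
  fixes X f g
  assumes P: "((X, f), g) \<in> Obj (double (double A))"
  notes [simp] = double_double_ObjD[OF P] conj_calc
begin

lemma inverse_f: "inverse_arrs A (cob A X) X f (inv_arr A (cob A X) X f)"
  by (rule inverse_arrs_inv_arr) simp_all

lemma inv_f_arr: "inv_arr A (cob A X) X f \<in> arr A X (cob A X)"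
  and inv_f_f: "comp A (cob A X) X (cob A X) (inv_arr A (cob A X) X f) f = Id A (cob A X)"
  and f_inv_f: "comp A X (cob A X) X f (inv_arr A (cob A X) X f) = Id A X"
  using inverse_f by (simp_all add: inverse_arrs_def)

lemma involution_arr: "involution A X f g \<in> arr A X X"
  by (simp add: involution_def inv_f_arr)

context
  notes [simp] = inv_f_arr inv_f_f f_inv_f involution_arr
begin

lemma involution_f: "comp A (cob A X) X X (involution A X f g) f = g"
  by (simp add: involution_def)

lemma iso_cmor_f: "iso_arr A (cob A (cob A X)) (cob A X) (cmor A (cob A X) X f)"
  using inverse_arrs_cmor[OF _ _ inverse_f] by (auto simp: iso_arr_def)

text \<open>
  After composing with the isomorphism \<open>\<iota>(f)\<close> this reads
  \<open>h g \<iota>(f) = -h f \<iota>(g) = -g \<iota>(g) = \<lambda> = f \<iota>(f)\<close>.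
\<close>

lemma involution_g: "comp A (cob A X) X X (involution A X f g) g = f"
proof (rule iso_cancel_right[OF _ _ _ iso_cmor_f])
  have "comp A (cob A (cob A X)) X X (involution A X f g)
      (comp A (cob A (cob A X)) (cob A X) X f (cmor A (cob A X) X g))
    = comp A (cob A (cob A X)) (cob A X) X g (cmor A (cob A X) X g)"
    by (subst comp_reduce[OF involution_f]) simp_all
  then show "comp A (cob A (cob A X)) (cob A X) X (comp A (cob A X) X X (involution A X f g) g) (cmor A (cob A X) X f)
    = comp A (cob A (cob A X)) (cob A X) X f (cmor A (cob A X) X f)"
    by simp
qed simp_all

lemma involution_involution: "comp A X X X (involution A X f g) (involution A X f g) = Id A X"
  using comp_reduce[OF involution_g, of X "inv_arr A (cob A X) X f"]
  by (simp add: involution_def)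

text \<open>
  After composing with \<open>\<iota>(f)\<close> this is \<open>f \<iota>(h f) = f \<iota>(g) = -g \<iota>(f)\<close>.  As \<open>g = h f\<close>, it says
  that \<open>f\<close> carries each eigenspace of \<open>\<iota>(h)\<close> to the eigenspace of \<open>h\<close> with the opposite sign.
\<close>

lemma f_cmor_involution:
  "comp A (cob A X) (cob A X) X f (cmor A X X (involution A X f g)) = \<ominus>\<^bsub>Hom A (cob A X) X\<^esub> g"
proof (rule iso_cancel_right[OF _ _ _ iso_cmor_f])
  have "comp A (cob A (cob A X)) (cob A X) (cob A X) (cmor A X X (involution A X f g)) (cmor A (cob A X) X f)
      = cmor A (cob A X) X g"
    by (simp add: involution_f flip: cmor_comp)
  then show "comp A (cob A (cob A X)) (cob A X) X
      (comp A (cob A X) (cob A X) X f (cmor A X X (involution A X f g))) (cmor A (cob A X) X f)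
    = comp A (cob A (cob A X)) (cob A X) X (\<ominus>\<^bsub>Hom A (cob A X) X\<^esub> g) (cmor A (cob A X) X f)"
    by simp
qed simp_all

lemma inv_f_involution:
  "comp A X X (cob A X) (inv_arr A (cob A X) X f) (involution A X f g)
    = \<ominus>\<^bsub>Hom A X (cob A X)\<^esub>
      comp A X (cob A X) (cob A X) (cmor A X X (involution A X f g)) (inv_arr A (cob A X) X f)"
proof -
  have "comp A (cob A X) X (cob A X) (inv_arr A (cob A X) X f) g
      = \<ominus>\<^bsub>Hom A (cob A X) (cob A X)\<^esub> comp A (cob A X) X (cob A X) (inv_arr A (cob A X) X f)
         (comp A (cob A X) (cob A X) X f (cmor A X X (involution A X f g)))"
    by (simp add: f_cmor_involution)
  also have "\<dots> = \<ominus>\<^bsub>Hom A (cob A X) (cob A X)\<^esub> cmor A X X (involution A X f g)"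
    by (simp add: comp_reduce[OF inv_f_f])
  finally show ?thesis
    by (simp add: involution_def comp_reduce[where f = g and h = "\<ominus>\<^bsub>Hom A (cob A X) (cob A X)\<^esub> cmor A X X (involution A X f g)"])
qed

text \<open>
  The signs in \<open>\<iota>''(X, f, g)\<close> cancel in the quotient of its two structure morphisms.  This is why
  \<open>\<Theta>\<iota>''\<close> and \<open>\<iota>\<Theta>\<close> are splittings of the same idempotent.
\<close>

lemma involution_cob:
  "involution A (cob A X) (\<ominus>\<^bsub>Hom A (cob A (cob A X)) (cob A X)\<^esub> cmor A (cob A X) X f)
      (\<ominus>\<^bsub>Hom A (cob A (cob A X)) (cob A X)\<^esub> cmor A (cob A X) X g)
    = cmor A X X (involution A X f g)"
proof -
  have "inverse_arrs A (cob A (cob A X)) (cob A X)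
      (\<ominus>\<^bsub>Hom A (cob A (cob A X)) (cob A X)\<^esub> cmor A (cob A X) X f)
      (\<ominus>\<^bsub>Hom A (cob A X) (cob A (cob A X))\<^esub> cmor A X (cob A X) (inv_arr A (cob A X) X f))"
    using inverse_arrs_cmor[OF _ _ inverse_f] by (simp add: inverse_arrs_def)
  then have "inv_arr A (cob A (cob A X)) (cob A X)
      (\<ominus>\<^bsub>Hom A (cob A (cob A X)) (cob A X)\<^esub> cmor A (cob A X) X f)
    = \<ominus>\<^bsub>Hom A (cob A X) (cob A (cob A X))\<^esub> cmor A X (cob A X) (inv_arr A (cob A X) X f)"
    by (intro inv_arr_eq) simp_all
  then show ?thesis
    by (simp add: involution_def)
qed

end

end

lemma involution_natural:
  assumes P: "((X, f), g) \<in> Obj (double (double A))" and Q: "((X', f'), g') \<in> Obj (double (double A))"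
    and \<phi>: "\<phi> \<in> arr (double (double A)) ((X, f), g) ((X', f'), g')"
  shows "comp A X X X' \<phi> (involution A X f g) = comp A X X' X' (involution A X' f' g') \<phi>"
proof (rule iso_cancel_right)
  note [simp] = double_double_ObjD[OF P] double_double_ObjD[OF Q] conj_calc \<phi>[unfolded double_double_arr]
    involution_arr[OF P] involution_arr[OF Q]
  show "iso_arr A (cob A X) X f" by simp
  show "comp A (cob A X) X X' (comp A X X X' \<phi> (involution A X f g)) f
    = comp A (cob A X) X X' (comp A X X' X' (involution A X' f' g') \<phi>) f"
    by (simp add: involution_f[OF P] comp_reduce[OF involution_f[OF Q]])
qed (use assms in \<open>simp_all add: double_double_ObjD involution_arr[OF P] involution_arr[OF Q]
  double_double_arr comp_arr cob_Obj\<close>)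

end

section \<open>The idempotent of an object of the double of the double\<close>

locale conj_category_splitting = conj_category k A
  for k :: "'k ring" (structure) and A :: "('o, 'm, 'k) conjcat" +
  fixes T :: "('o \<times> 'm) \<times> 'm \<Rightarrow> 'o" and t s :: "('o \<times> 'm) \<times> 'm \<Rightarrow> 'm"
  assumes two_unit: "\<one> \<oplus> \<one> \<in> Units k"
    and splitting_choice: "splitting_choice k A T t s"
begin

abbreviation half :: 'k where "half \<equiv> inv (\<one> \<oplus> \<one>)"

lemma half_carrier: "half \<in> carrier k"
  using two_unit by simp

lemma half_double:
  assumes "X \<in> Obj A" "Y \<in> Obj A" "x \<in> arr A X Y"
  shows "half \<odot>\<^bsub>Hom A X Y\<^esub> (x \<oplus>\<^bsub>Hom A X Y\<^esub> x) = x"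
proof -
  interpret module k "Hom A X Y" by (rule hom_module) fact+
  have "x \<oplus>\<^bsub>Hom A X Y\<^esub> x = (\<one> \<oplus> \<one>) \<odot>\<^bsub>Hom A X Y\<^esub> x"
    using assms by (simp add: smult_l_distr)
  then show ?thesis
    using assms two_unit by (simp flip: smult_assoc1)
qed

lemma eq_minus_self_zero:
  assumes "X \<in> Obj A" "Y \<in> Obj A" "x \<in> arr A X Y" "x = \<ominus>\<^bsub>Hom A X Y\<^esub> x"
  shows "x = \<zero>\<^bsub>Hom A X Y\<^esub>"
proof -
  interpret module k "Hom A X Y" by (rule hom_module) fact+
  have "x \<oplus>\<^bsub>Hom A X Y\<^esub> x = \<zero>\<^bsub>Hom A X Y\<^esub>"
    using assms(3,4) by (metis r_neg)
  then show ?thesis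
    using half_double[OF assms(1-3)] half_carrier by simp
qed

lemma half_idem_eq:
  "half_idem k A ((X, f), g) = half \<odot>\<^bsub>Hom A X X\<^esub> (Id A X \<oplus>\<^bsub>Hom A X X\<^esub> \<ominus>\<^bsub>Hom A X X\<^esub> involution A X f g)"
  by (simp add: half_idem_def involution_def a_minus_def)

context
  fixes X f g
  assumes P: "((X, f), g) \<in> Obj (double (double A))"
  notes [simp] = double_double_ObjD(2-7)[OF P] conj_calc half_carrier involution_arr[OF P]
begin

lemma splits_half_idem: "splits A X (half_idem k A ((X, f), g)) (T ((X, f), g)) (t ((X, f), g)) (s ((X, f), g))"
  using splitting_choice P unfolding splitting_choice_def by fastforce

lemma T_Obj: "T ((X, f), g) \<in> Obj A"
  and t_arr: "t ((X, f), g) \<in> arr A (T ((X, f), g)) X"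
  and s_arr: "s ((X, f), g) \<in> arr A X (T ((X, f), g))"
  and s_t: "comp A (T ((X, f), g)) X (T ((X, f), g)) (s ((X, f), g)) (t ((X, f), g)) = Id A (T ((X, f), g))"
  and t_s: "comp A X (T ((X, f), g)) X (t ((X, f), g)) (s ((X, f), g)) = half_idem k A ((X, f), g)"
  using splits_half_idem by (simp_all add: splits_def)

lemma half_idem_arr: "half_idem k A ((X, f), g) \<in> arr A X X"
  by (simp add: half_idem_eq)

context
  notes [simp] = T_Obj t_arr s_arr s_t half_idem_arr
begin

text \<open>
  From \<open>h\<^sup>2 = 1\<close>: \<open>h (1 - h) = h - 1\<close>.  So the idempotent has its image in the eigenspace for
  \<open>-1\<close>, and with \<open>half_idem_fix\<close> and \<open>half_idem_kill\<close> it is the projection onto it.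
\<close>

lemma involution_half_idem:
  "comp A X X X (involution A X f g) (half_idem k A ((X, f), g)) = \<ominus>\<^bsub>Hom A X X\<^esub> half_idem k A ((X, f), g)"
  and half_idem_involution:
  "comp A X X X (half_idem k A ((X, f), g)) (involution A X f g) = \<ominus>\<^bsub>Hom A X X\<^esub> half_idem k A ((X, f), g)"
proof -
  interpret M: module k "Hom A X X" by (rule hom_module) simp_all
  show "comp A X X X (involution A X f g) (half_idem k A ((X, f), g)) = \<ominus>\<^bsub>Hom A X X\<^esub> half_idem k A ((X, f), g)"
    "comp A X X X (half_idem k A ((X, f), g)) (involution A X f g) = \<ominus>\<^bsub>Hom A X X\<^esub> half_idem k A ((X, f), g)"
    by (simp_all add: half_idem_eq involution_involution[OF P] M.a_comm flip: M.smult_r_minus)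
qed

lemma half_idem_fix:
  assumes [simp]: "W \<in> Obj A" "x \<in> arr A W X"
    and "comp A W X X (involution A X f g) x = \<ominus>\<^bsub>Hom A W X\<^esub> x"
  shows "comp A W X X (half_idem k A ((X, f), g)) x = x"
  by (simp add: half_idem_eq assms(3) half_double)

lemma half_idem_t: "comp A (T ((X, f), g)) X X (half_idem k A ((X, f), g)) (t ((X, f), g)) = t ((X, f), g)"
  by (simp flip: t_s)

lemma s_half_idem: "comp A X X (T ((X, f), g)) (s ((X, f), g)) (half_idem k A ((X, f), g)) = s ((X, f), g)"
  by (simp add: comp_reduce[OF s_t] flip: t_s)

lemma involution_t:
  "comp A (T ((X, f), g)) X X (involution A X f g) (t ((X, f), g))
    = \<ominus>\<^bsub>Hom A (T ((X, f), g)) X\<^esub> t ((X, f), g)"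
  using comp_reduce[OF involution_half_idem, of "T ((X, f), g)" "t ((X, f), g)"]
  by (simp add: half_idem_t)

lemma s_involution:
  "comp A X X (T ((X, f), g)) (s ((X, f), g)) (involution A X f g)
    = \<ominus>\<^bsub>Hom A X (T ((X, f), g))\<^esub> s ((X, f), g)"
proof -
  have "comp A X X (T ((X, f), g)) (comp A X X (T ((X, f), g)) (s ((X, f), g)) (half_idem k A ((X, f), g)))
      (involution A X f g) = \<ominus>\<^bsub>Hom A X (T ((X, f), g))\<^esub>
      comp A X X (T ((X, f), g)) (s ((X, f), g)) (half_idem k A ((X, f), g))"
    by (simp add: half_idem_involution)
  then show ?thesis by (simp only: s_half_idem)
qed

lemma half_idem_cob:
  "half_idem k A (cob (double (double A)) ((X, f), g)) = cmor A X X (half_idem k A ((X, f), g))"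
  unfolding double_double_cob[OF P] half_idem_eq involution_cob[OF P] by simp

end

end

lemma half_idem_kill:
  assumes "((X, f), g) \<in> Obj (double (double A))" "W \<in> Obj A" "x \<in> arr A W X"
    and "comp A W X X (involution A X f g) x = x"
  shows "comp A W X X (half_idem k A ((X, f), g)) x = \<zero>\<^bsub>Hom A W X\<^esub>"
proof -
  interpret module k "Hom A W X" using assms by (intro hom_module) (simp_all add: double_double_ObjD)
  show ?thesis
    using assms half_carrier
    by (simp add: half_idem_eq calc involution_arr double_double_ObjD add_minus)
qed

lemma half_idem_natural:
  assumes P: "((X, f), g) \<in> Obj (double (double A))" and Q: "((X', f'), g') \<in> Obj (double (double A))"
    and \<phi>: "\<phi> \<in> arr (double (double A)) ((X, f), g) ((X', f'), g')"
  shows "comp A X X X' \<phi> (half_idem k A ((X, f), g)) = comp A X X' X' (half_idem k A ((X', f'), g')) \<phi>"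
proof -
  note [simp] = double_double_ObjD[OF P] double_double_ObjD[OF Q] conj_calc \<phi>[unfolded double_double_arr]
    involution_arr[OF P] involution_arr[OF Q] half_carrier
  show ?thesis by (simp add: half_idem_eq involution_natural[OF assms])
qed

section \<open>The functor given by the splittings\<close>

interpretation dd: conj_category k "double (double A)"
  by (rule conj_category_double_double)

abbreviation e :: "('o \<times> 'm) \<times> 'm \<Rightarrow> 'm" where "e \<equiv> half_idem k A"

lemma split_typing:
  assumes "P \<in> Obj (double (double A))"
  shows "T P \<in> Obj A" "t P \<in> arr A (T P) (base P)" "s P \<in> arr A (base P) (T P)" "e P \<in> arr A (base P) (base P)"
  by (rule dd_cases[OF assms]; simp add: T_Obj t_arr s_arr half_idem_arr)+

lemma split_eqs:
  assumes "P \<in> Obj (double (double A))"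
  shows "comp A (T P) (base P) (T P) (s P) (t P) = Id A (T P)"
    and "comp A (base P) (T P) (base P) (t P) (s P) = e P"
    and "comp A (T P) (base P) (base P) (e P) (t P) = t P"
    and "comp A (base P) (base P) (T P) (s P) (e P) = s P"
  by (rule dd_cases[OF assms]; simp add: s_t t_s half_idem_t s_half_idem)+

lemma e_cob: "P \<in> Obj (double (double A)) \<Longrightarrow> e (cob (double (double A)) P) = cmor A (base P) (base P) (e P)"
  by (erule dd_cases) (simp add: half_idem_cob)

lemma e_natural:
  assumes "P \<in> Obj (double (double A))" "Q \<in> Obj (double (double A))" "\<phi> \<in> arr (double (double A)) P Q"
  shows "comp A (base P) (base P) (base Q) \<phi> (e P) = comp A (base P) (base Q) (base Q) (e Q) \<phi>"
proof -
  obtain X f g where "P = ((X, f), g)" using assms(1) by (rule dd_cases)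
  moreover obtain X' f' g' where "Q = ((X', f'), g')" using assms(2) by (rule dd_cases)
  ultimately show ?thesis using half_idem_natural assms by simp
qed

text \<open>
  The inclusion \<open>t\<close> is natural from \<open>\<Theta>\<close> to the forgetful functor, because morphisms commute with the
  idempotents.  As \<open>t\<close> is a monomorphism, this equation determines \<open>\<Theta>\<close> on morphisms and replaces its
  definition in what follows.
\<close>

lemma t_Theta:
  assumes [simp]: "P \<in> Obj (double (double A))" "Q \<in> Obj (double (double A))"
    and \<phi>: "\<phi> \<in> arr (double (double A)) P Q"
  shows "comp A (T P) (T Q) (base Q) (t Q) (mor (Theta A T t s) P Q \<phi>)
      = comp A (T P) (base P) (base Q) \<phi> (t P)"
proof -
  note [simp] = base_arr[OF \<phi>] base_Obj split_typing calc split_eqs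
  have "comp A (T P) (T Q) (base Q) (t Q) (mor (Theta A T t s) P Q \<phi>)
      = comp A (T P) (base P) (base Q) (comp A (base P) (base P) (base Q) \<phi> (e P)) (t P)"
    by (simp add: e_natural[OF assms] Theta_def comp_reduce[OF split_eqs(2)[of Q]])
  then show ?thesis by simp
qed

lemma Theta_s:
  assumes [simp]: "P \<in> Obj (double (double A))" "Q \<in> Obj (double (double A))"
    and \<phi>: "\<phi> \<in> arr (double (double A)) P Q"
  shows "comp A (base P) (T P) (T Q) (mor (Theta A T t s) P Q \<phi>) (s P)
      = comp A (base P) (base Q) (T Q) (s Q) \<phi>"
proof -
  note [simp] = base_arr[OF \<phi>] base_Obj split_typing calc split_eqs
  show ?thesis
    by (simp add: Theta_def e_natural[OF assms] comp_reduce[OF split_eqs(4)[of Q]])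
qed

lemma t_cancel:
  assumes [simp]: "P \<in> Obj (double (double A))" "W \<in> Obj A" "x \<in> arr A W (T P)" "y \<in> arr A W (T P)"
    and eq: "comp A W (T P) (base P) (t P) x = comp A W (T P) (base P) (t P) y"
  shows "x = y"
proof -
  note [simp] = base_Obj split_typing calc comp_reduce[OF split_eqs(1)]
  have "comp A W (base P) (T P) (s P) (comp A W (T P) (base P) (t P) x)
      = comp A W (base P) (T P) (s P) (comp A W (T P) (base P) (t P) y)"
    by (simp only: eq)
  then show ?thesis by simp
qed

lemma Theta_arr:
  assumes "P \<in> Obj (double (double A))" "Q \<in> Obj (double (double A))" "\<phi> \<in> arr (double (double A)) P Q"
  shows "mor (Theta A T t s) P Q \<phi> \<in> arr A (T P) (T Q)"
  using assms by (simp add: Theta_def base_arr base_Obj split_typing typing)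

lemma linear_functor_Theta: "linear_functor k (double (double A)) A (Theta A T t s)"
  unfolding linear_functor_def
proof (intro conjI ballI)
  have ob: "ob (Theta A T t s) = T" by (simp add: Theta_def)
  fix P assume [simp]: "P \<in> Obj (double (double A))"
  note [simp] = base_Obj split_typing calc ob
  show "ob (Theta A T t s) P \<in> Obj A" by simp
  show "mor (Theta A T t s) P P (Id (double (double A)) P) = Id A (ob (Theta A T t s) P)"
    by (simp add: Theta_def double_simps_fst split_eqs)
  fix Q assume [simp]: "Q \<in> Obj (double (double A))"
  show "mor (Theta A T t s) P Q (a \<odot>\<^bsub>Hom (double (double A)) P Q\<^esub> \<phi>)
      = a \<odot>\<^bsub>Hom A (ob (Theta A T t s) P) (ob (Theta A T t s) Q)\<^esub> mor (Theta A T t s) P Q \<phi>"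
    if "a \<in> carrier k" "\<phi> \<in> arr (double (double A)) P Q" for a \<phi>
    using that by (simp add: Theta_def double_simps_fst base_arr)
  fix \<phi> assume \<phi>: "\<phi> \<in> arr (double (double A)) P Q"
  show "mor (Theta A T t s) P Q \<phi> \<in> arr A (ob (Theta A T t s) P) (ob (Theta A T t s) Q)"
    using \<phi> by (simp add: Theta_arr)
  show "mor (Theta A T t s) P Q (\<phi> \<oplus>\<^bsub>Hom (double (double A)) P Q\<^esub> \<chi>)
      = mor (Theta A T t s) P Q \<phi> \<oplus>\<^bsub>Hom A (ob (Theta A T t s) P) (ob (Theta A T t s) Q)\<^esub>
        mor (Theta A T t s) P Q \<chi>"
    if "\<chi> \<in> arr (double (double A)) P Q" for \<chi>
    using \<phi> that by (simp add: Theta_def double_simps_fst base_arr)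
  fix R \<chi> assume [simp]: "R \<in> Obj (double (double A))" and \<chi>: "\<chi> \<in> arr (double (double A)) Q R"
  note [simp] = \<phi> \<chi> Theta_arr base_arr[OF \<phi>] base_arr[OF \<chi>]
  have c: "comp (double (double A)) P Q R \<chi> \<phi> \<in> arr (double (double A)) P R"
    by (rule dd.comp_arr) simp_all
  show "mor (Theta A T t s) P R (comp (double (double A)) P Q R \<chi> \<phi>)
      = comp A (ob (Theta A T t s) P) (ob (Theta A T t s) Q) (ob (Theta A T t s) R)
        (mor (Theta A T t s) Q R \<chi>) (mor (Theta A T t s) P Q \<phi>)"
    by (rule t_cancel[where P = R and W = "T P"])
      (use Theta_arr[OF _ _ c] t_Theta[OF _ _ c] in \<open>simp_all add: t_Theta comp_reduce[OF t_Theta] double_simps_fst\<close>)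
qed

lemma theta_eq:
  assumes "P \<in> Obj (double (double A))"
  shows "theta A T t s P = comp A (T (cob (double (double A)) P)) (cob A (base P)) (cob A (T P))
    (cmor A (base P) (T P) (s P)) (t (cob (double (double A)) P))"
  by (simp add: theta_def Let_def)

lemma cob_split_typing:
  assumes "P \<in> Obj (double (double A))"
  shows "T (cob (double (double A)) P) \<in> Obj A"
    "t (cob (double (double A)) P) \<in> arr A (T (cob (double (double A)) P)) (cob A (base P))"
    "s (cob (double (double A)) P) \<in> arr A (cob A (base P)) (T (cob (double (double A)) P))"
  using split_typing[OF dd.cob_Obj[OF assms]] by (simp_all add: base_cob[OF assms])

text \<open>
  The morphism \<open>\<theta>\<close> is the identification of the two splittings over the object \<open>\<iota>(X)\<close>.  As
  \<open>\<iota>(t)\<close> is a monomorphism, all properties of \<open>\<theta>\<close> follow from this one.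
\<close>

lemma t_theta:
  assumes [simp]: "P \<in> Obj (double (double A))"
  shows "comp A (T (cob (double (double A)) P)) (cob A (T P)) (cob A (base P))
      (cmor A (T P) (base P) (t P)) (theta A T t s P) = t (cob (double (double A)) P)"
proof -
  note [simp] = base_Obj split_typing cob_split_typing conj_calc
  have 1: "comp A (cob A (base P)) (cob A (T P)) (cob A (base P)) (cmor A (T P) (base P) (t P))
      (cmor A (base P) (T P) (s P)) = e (cob (double (double A)) P)"
    by (simp add: e_cob split_eqs flip: cmor_comp)
  show ?thesis
    using split_eqs(3)[OF dd.cob_Obj[OF assms]]
    by (simp add: theta_eq comp_reduce[OF 1] base_cob)
qed

lemma inverse_arrs_theta:
  assumes [simp]: "P \<in> Obj (double (double A))"
  shows "inverse_arrs A (T (cob (double (double A)) P)) (cob A (T P)) (theta A T t s P)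
    (comp A (cob A (T P)) (cob A (base P)) (T (cob (double (double A)) P))
      (s (cob (double (double A)) P)) (cmor A (T P) (base P) (t P)))"
proof -
  note [simp] = base_Obj split_typing cob_split_typing conj_calc
  note split = split_eqs[OF dd.cob_Obj[OF assms], unfolded base_cob[OF assms]]
  have 1: "comp A (cob A (base P)) (cob A (base P)) (cob A (T P)) (cmor A (base P) (T P) (s P))
      (e (cob (double (double A)) P)) = cmor A (base P) (T P) (s P)"
    by (simp add: e_cob split_eqs flip: cmor_comp)
  have 2: "comp A (cob A (T P)) (cob A (base P)) (cob A (T P)) (cmor A (base P) (T P) (s P))
      (cmor A (T P) (base P) (t P)) = Id A (cob A (T P))"
    by (simp add: split_eqs flip: cmor_comp)
  have e: "e (cob (double (double A)) P) \<in> arr A (cob A (base P)) (cob A (base P))"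
    by (simp add: e_cob)
  have [simp]: "theta A T t s P \<in> arr A (T (cob (double (double A)) P)) (cob A (T P))"
    by (simp add: theta_eq)
  show ?thesis
    unfolding inverse_arrs_def
    by (simp add: t_theta split) (simp add: theta_eq e comp_reduce[OF split(2)] comp_reduce[OF 1] 2)
qed

lemma theta_arr:
  "P \<in> Obj (double (double A)) \<Longrightarrow> theta A T t s P \<in> arr A (T (cob (double (double A)) P)) (cob A (T P))"
  using inverse_arrs_theta by (simp add: inverse_arrs_def)

text \<open>
  With the inverse of \<open>\<theta>\<close> from \<open>inverse_arrs_theta\<close>, both sides of the condition on \<open>\<lambda>\<close> become
  \<open>s \<lambda> \<iota>(t)\<close>, where \<open>s\<close> belongs to \<open>(X, f, g)\<close> and \<open>t\<close> to its conjugate: on the right because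
  \<open>\<Theta>(\<lambda>) s = s \<lambda>\<close>, on the left by naturality of \<open>\<lambda>\<close>.
\<close>

theorem conj_morphism_Theta: "conj_morphism k (double (double A)) A (Theta A T t s, theta A T t s)"
  unfolding conj_morphism_def prod.case natural_iso_def
proof (intro conjI ballI)
  have ob: "ob (Theta A T t s) = T" by (simp add: Theta_def)
  show "category_with_conjugation k (double (double A))" "category_with_conjugation k A"
    by (rule category_with_conjugation dd.category_with_conjugation)+
  show "linear_functor k (double (double A)) A (Theta A T t s)" by (rule linear_functor_Theta)
  fix P assume [simp]: "P \<in> Obj (double (double A))"
  note [simp] = base_Obj split_typing cob_split_typing conj_calc ob theta_arr dd.cob_Obj base_cob
  show "iso_arr A (ob (Theta A T t s \<circ>\<^sub>F conj_functor (double (double A))) P)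
      (ob (conj_functor A \<circ>\<^sub>F Theta A T t s) P) (theta A T t s P)"
    using inverse_arrs_theta[OF \<open>P \<in> Obj (double (double A))\<close>]
    by (auto simp: comp_functor_def iso_arr_def)
  have inv: "inv_arr A (T (cob (double (double A)) (cob (double (double A)) P)))
      (cob A (T (cob (double (double A)) P))) (theta A T t s (cob (double (double A)) P))
    = comp A (cob A (T (cob (double (double A)) P))) (cob A (cob A (base P)))
      (T (cob (double (double A)) (cob (double (double A)) P)))
      (s (cob (double (double A)) (cob (double (double A)) P)))
      (cmor A (T (cob (double (double A)) P)) (cob A (base P)) (t (cob (double (double A)) P)))"
    using inv_arr_eq[OF _ _ inverse_arrs_theta[of "cob (double (double A)) P"]] by simp
  have s2: "s (cob (double (double A)) (cob (double (double A)) P))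
      \<in> arr A (cob A (cob A (base P))) (T (cob (double (double A)) (cob (double (double A)) P)))"
    using cob_split_typing(3)[of "cob (double (double A)) P"] by simp
  have "mor (Theta A T t s) (cob (double (double A)) (cob (double (double A)) P)) P (conj_nat A (base P))
      \<in> arr A (T (cob (double (double A)) (cob (double (double A)) P))) (T P)"
    using Theta_arr[OF _ _ dd.conj_nat_arr] by (simp add: conj_nat_double_double)
  moreover have "comp A (cob A (cob A (base P))) (T (cob (double (double A)) (cob (double (double A)) P))) (T P)
      (mor (Theta A T t s) (cob (double (double A)) (cob (double (double A)) P)) P (conj_nat A (base P)))
      (s (cob (double (double A)) (cob (double (double A)) P)))
    = comp A (cob A (cob A (base P))) (base P) (T P) (s P) (conj_nat A (base P))"
    using Theta_s[OF _ _ dd.conj_nat_arr, of P] by (simp add: conj_nat_double_double)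
  ultimately show "comp A (cob A (ob (Theta A T t s) (cob (double (double A)) P))) (cob A (cob A (ob (Theta A T t s) P)))
        (ob (Theta A T t s) P) (conj_nat A (ob (Theta A T t s) P))
        (cmor A (ob (Theta A T t s) (cob (double (double A)) P)) (cob A (ob (Theta A T t s) P)) (theta A T t s P))
      = comp A (cob A (ob (Theta A T t s) (cob (double (double A)) P)))
        (ob (Theta A T t s) (cob (double (double A)) (cob (double (double A)) P))) (ob (Theta A T t s) P)
        (mor (Theta A T t s) (cob (double (double A)) (cob (double (double A)) P)) P
          (conj_nat (double (double A)) P))
        (inv_arr A (ob (Theta A T t s) (cob (double (double A)) (cob (double (double A)) P)))
          (cob A (ob (Theta A T t s) (cob (double (double A)) P))) (theta A T t s (cob (double (double A)) P)))"
    by (simp add: conj_nat_double_double inv s2 comp_reduce[where f = "s (cob (double (double A)) (cob (double (double A)) P))"])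
      (simp add: theta_eq)
  fix Q \<phi> assume [simp]: "Q \<in> Obj (double (double A))" and \<phi>: "\<phi> \<in> arr (double (double A)) P Q"
  note [simp] = base_arr[OF \<phi>] \<phi>
  have c\<phi>: "cmor (double (double A)) P Q \<phi> \<in> arr (double (double A)) (cob (double (double A)) P) (cob (double (double A)) Q)"
    by (rule dd.cmor_arr) simp_all
  have "comp A (T (cob (double (double A)) P)) (T (cob (double (double A)) Q)) (cob A (base Q))
      (t (cob (double (double A)) Q))
      (mor (Theta A T t s) (cob (double (double A)) P) (cob (double (double A)) Q) (cmor (double (double A)) P Q \<phi>))
    = comp A (T (cob (double (double A)) P)) (cob A (base P)) (cob A (base Q)) (cmor A (base P) (base Q) \<phi>)
      (t (cob (double (double A)) P))"
    using t_Theta[OF _ _ c\<phi>] by (simp add: cmor_double_double)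
  moreover have "mor (Theta A T t s) (cob (double (double A)) P) (cob (double (double A)) Q) (cmor (double (double A)) P Q \<phi>)
    \<in> arr A (T (cob (double (double A)) P)) (T (cob (double (double A)) Q))"
    using Theta_arr[OF _ _ c\<phi>] by simp
  ultimately show "comp A (ob (Theta A T t s \<circ>\<^sub>F conj_functor (double (double A))) P)
        (ob (Theta A T t s \<circ>\<^sub>F conj_functor (double (double A))) Q)
        (ob (conj_functor A \<circ>\<^sub>F Theta A T t s) Q) (theta A T t s Q)
        (mor (Theta A T t s \<circ>\<^sub>F conj_functor (double (double A))) P Q \<phi>)
      = comp A (ob (Theta A T t s \<circ>\<^sub>F conj_functor (double (double A))) P)
        (ob (conj_functor A \<circ>\<^sub>F Theta A T t s) P) (ob (conj_functor A \<circ>\<^sub>F Theta A T t s) Q)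
        (mor (conj_functor A \<circ>\<^sub>F Theta A T t s) P Q \<phi>) (theta A T t s P)"
    by (simp add: comp_functor_def theta_eq)
      (simp add: Theta_def t_theta flip: theta_eq)
qed

end

section \<open>The two natural isomorphisms\<close>

locale conj_category_choices = conj_category_sums k A S + conj_category_splitting k A T t s
  for k :: "'k ring" (structure) and A :: "('o, 'm, 'k) conjcat" and S T t s
begin

interpretation dd: conj_category k "double (double A)"
  by (rule conj_category_double_double)

text \<open>
  Both \<open>\<Lambda>\<close> and \<open>\<Delta>\<close> map \<open>\<iota>(X)\<close> identically onto the second summand, and they map \<open>\<iota>\<iota>(X)\<close> onto the
  first one with opposite signs.  Hence the involution is \<open>-1\<close> on \<open>X\<close> and \<open>1\<close> on \<open>\<iota>(X)\<close>.
\<close>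

lemma half_idem_Psi:
  assumes [simp]: "X \<in> Obj A"
  shows "e (ob (Psi A S) X)
    = comp A (sum_obj (S X)) X (sum_obj (S X)) (in1 (S X)) (pr1 (S X))"
proof -
  have Psi: "ob (Psi A S) X = ((sum_obj (S X), Lambda A S X), Delta A S X)"
    by (simp add: Psi_def)
  note P = Psi_Obj[OF assms, unfolded Psi]
  let ?h = "involution A (sum_obj (S X)) (Lambda A S X) (Delta A S X)"
  note h = involution_f[OF P]
  note [simp] = conj_calc sum_arrs involution_arr[OF P] half_idem_arr[OF P]
  have "comp A (cob A X) (sum_obj (S X)) (sum_obj (S X)) ?h
      (comp A (cob A X) (cob A (sum_obj (S X))) (sum_obj (S X)) (Lambda A S X)
        (cmor A X (sum_obj (S X)) (in1 (S X)))) = in2 (S X)"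
    by (subst comp_reduce[OF h]) (simp_all add: Delta_in1)
  then have h2: "comp A (cob A X) (sum_obj (S X)) (sum_obj (S X)) ?h (in2 (S X)) = in2 (S X)"
    by (simp add: Lambda_in1)
  have "comp A (cob A (cob A X)) (sum_obj (S X)) (sum_obj (S X)) ?h
      (comp A (cob A (cob A X)) (cob A (sum_obj (S X))) (sum_obj (S X)) (Lambda A S X)
        (cmor A (cob A X) (sum_obj (S X)) (in2 (S X))))
      = \<ominus>\<^bsub>Hom A (cob A (cob A X)) (sum_obj (S X))\<^esub>
        comp A (cob A (cob A X)) X (sum_obj (S X)) (in1 (S X)) (conj_nat A X)"
    by (subst comp_reduce[OF h]) (simp_all add: Delta_in2)
  then have h1: "comp A X (sum_obj (S X)) (sum_obj (S X)) ?h (in1 (S X))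
      = \<ominus>\<^bsub>Hom A X (sum_obj (S X))\<^esub> in1 (S X)"
    by - (rule iso_cancel_right[where Z = "sum_obj (S X)", OF _ _ _ conj_nat_iso[of X]]; simp add: Lambda_in2)
  show ?thesis
    unfolding Psi
    by (rule sum_ext[where X = X and Z = "sum_obj (S X)"])
      (simp_all add: half_idem_fix[OF P _ _ h1] half_idem_kill[OF P _ _ h2] S_eqs)
qed

text \<open>
  By \<open>half_idem_Psi\<close> the inclusion of the first summand and the first projection form a splitting
  of the idempotent of \<open>\<Psi>(X)\<close>; comparing it with the chosen one gives the isomorphism \<open>pr\<^sub>1 t\<close>.
  Compatibility with the conjugations comes down to \<open>\<iota>(pr\<^sub>1) \<psi> = pr\<^sub>1\<close>, where the positive sign of
  \<open>\<psi>\<close> on the first summand is essential.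
\<close>

theorem conj_natural_iso_Theta_Psi:
  "conj_natural_iso A A (conj_comp A (double (double A)) A (Theta A T t s, theta A T t s) (Psi A S, psi A S))
    (conj_id A) (\<lambda>X. comp A (T (ob (Psi A S) X)) (sum_obj (S X)) X (pr1 (S X)) (t (ob (Psi A S) X)))"
  unfolding conj_natural_iso_def conj_comp_def conj_id_def prod.case natural_iso_def
proof (intro conjI ballI)
  have ob: "ob (Theta A T t s) = T" by (simp add: Theta_def)
  have base: "base (ob (Psi A S) X) = sum_obj (S X)" for X
    by (simp add: Psi_def)
  note [simp] = calc cob_Obj cmor_arr cmor_comp sum_arrs base Psi_Obj
  have st [simp]: "T (ob (Psi A S) X) \<in> Obj A"
    "t (ob (Psi A S) X) \<in> arr A (T (ob (Psi A S) X)) (sum_obj (S X))"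
    "s (ob (Psi A S) X) \<in> arr A (sum_obj (S X)) (T (ob (Psi A S) X))" if "X \<in> Obj A" for X
    using split_typing[OF Psi_Obj[OF that]] by simp_all
  fix X assume X [simp]: "X \<in> Obj A"
  let ?P = "ob (Psi A S) X" and ?i = "cob (double (double A)) (ob (Psi A S) X)"
  note split = split_eqs[OF Psi_Obj[OF X], unfolded base half_idem_Psi[OF X]]
  have "inverse_arrs A (T ?P) X (comp A (T ?P) (sum_obj (S X)) X (pr1 (S X)) (t ?P))
    (comp A X (sum_obj (S X)) (T ?P) (s ?P) (in1 (S X)))"
    using split(3) unfolding inverse_arrs_def
    by (simp add: comp_reduce[OF split(2)] split(1) S_eqs)
  then show "iso_arr A (ob (Theta A T t s \<circ>\<^sub>F Psi A S) X) (ob id_functor X)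
      (comp A (T ?P) (sum_obj (S X)) X (pr1 (S X)) (t ?P))"
    by (auto simp: comp_functor_def id_functor_def ob iso_arr_def)
  have t: "comp A (T (ob (Psi A S) (cob A X))) (T ?i) (cob A (sum_obj (S X))) (t ?i)
      (mor (Theta A T t s) (ob (Psi A S) (cob A X)) ?i (psi A S X))
    = comp A (T (ob (Psi A S) (cob A X))) (sum_obj (S (cob A X))) (cob A (sum_obj (S X))) (psi A S X)
      (t (ob (Psi A S) (cob A X)))"
    using t_Theta[OF _ _ psi_double_double[OF X]] by (simp add: base_cob dd.cob_Obj)
  have arr: "mor (Theta A T t s) (ob (Psi A S) (cob A X)) ?i (psi A S X)
      \<in> arr A (T (ob (Psi A S) (cob A X))) (T ?i)"
    using Theta_arr[OF _ _ psi_double_double[OF X]] by (simp add: dd.cob_Obj)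
  show "comp A (ob (Theta A T t s \<circ>\<^sub>F Psi A S) (cob A X)) (ob id_functor (cob A X))
        (cob A (ob id_functor X)) (Id A (cob A X))
        (comp A (T (ob (Psi A S) (cob A X))) (sum_obj (S (cob A X))) (cob A X) (pr1 (S (cob A X)))
          (t (ob (Psi A S) (cob A X))))
      = comp A (ob (Theta A T t s \<circ>\<^sub>F Psi A S) (cob A X)) (cob A (ob (Theta A T t s \<circ>\<^sub>F Psi A S) X))
        (cob A (ob id_functor X))
        (cmor A (ob (Theta A T t s \<circ>\<^sub>F Psi A S) X) (ob id_functor X)
          (comp A (T ?P) (sum_obj (S X)) X (pr1 (S X)) (t ?P)))
        (comp A (ob (Theta A T t s) (ob (Psi A S) (cob A X))) (ob (Theta A T t s) ?i)
          (cob A (ob (Theta A T t s) ?P)) (theta A T t s ?P)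
          (mor (Theta A T t s) (ob (Psi A S) (cob A X)) ?i (psi A S X)))"
    using theta_arr[OF Psi_Obj[OF X]] cob_split_typing[OF Psi_Obj[OF X]] arr
    by (simp add: comp_functor_def id_functor_def ob t
        comp_reduce[OF t_theta[OF Psi_Obj[OF X], unfolded base]] comp_reduce[OF cmor_pr1_psi])
  fix Y f assume Y [simp]: "Y \<in> Obj A" "f \<in> arr A X Y"
  have "comp A (T ?P) (T (ob (Psi A S) Y)) (sum_obj (S Y)) (t (ob (Psi A S) Y))
      (mor (Theta A T t s) ?P (ob (Psi A S) Y) (mor (Psi A S) X Y f))
    = comp A (T ?P) (sum_obj (S X)) (sum_obj (S Y)) (diag A S X Y f (cmor A X Y f)) (t ?P)"
    using t_Theta[OF _ _ Psi_arr[OF X Y]] by simp (simp add: Psi_def)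
  then show "comp A (ob (Theta A T t s \<circ>\<^sub>F Psi A S) X) (ob (Theta A T t s \<circ>\<^sub>F Psi A S) Y) (ob id_functor Y)
        (comp A (T (ob (Psi A S) Y)) (sum_obj (S Y)) Y (pr1 (S Y)) (t (ob (Psi A S) Y)))
        (mor (Theta A T t s \<circ>\<^sub>F Psi A S) X Y f)
      = comp A (ob (Theta A T t s \<circ>\<^sub>F Psi A S) X) (ob id_functor X) (ob id_functor Y) (mor id_functor X Y f)
        (comp A (T ?P) (sum_obj (S X)) X (pr1 (S X)) (t ?P))"
    using Theta_arr[OF _ _ Psi_arr[OF X Y]]
    by (simp add: comp_functor_def id_functor_def ob comp_reduce[OF pr1_diag])
qed

text \<open>
  The morphism \<open>(t, f \<iota>(t))\<close> from \<open>\<Theta>(X, f, g) \<oplus> \<iota>(\<Theta>(X, f, g))\<close> to \<open>X\<close>, the inclusions of the two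
  eigenspaces of the involution; \<open>snd (fst P)\<close> is \<open>f\<close>.
\<close>

definition counit :: "('o \<times> 'm) \<times> 'm \<Rightarrow> 'm" where
  "counit P = copair A (T P) (cob A (T P)) (S (T P)) (base P) (t P)
     (comp A (cob A (T P)) (cob A (base P)) (base P) (snd (fst P)) (cmor A (T P) (base P) (t P)))"

lemma counit:
  assumes P: "((X, f), g) \<in> Obj (double (double A))"
  defines "U \<equiv> T ((X, f), g)"
  shows "counit ((X, f), g) \<in> arr A (sum_obj (S U)) X"
    and "comp A U (sum_obj (S U)) X (counit ((X, f), g)) (in1 (S U)) = t ((X, f), g)"
    and "comp A (cob A U) (sum_obj (S U)) X (counit ((X, f), g)) (in2 (S U))
      = comp A (cob A U) (cob A X) X f (cmor A U X (t ((X, f), g)))"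
  using copair[OF _ _ _ biproduct_S, of U X "t ((X, f), g)"
      "comp A (cob A U) (cob A X) X f (cmor A U X (t ((X, f), g)))"]
    double_double_ObjD[OF P] T_Obj[OF P] t_arr[OF P]
  unfolding U_def counit_def by (simp_all add: conj_calc)

lemma Psi_Theta_obj: "ob (Psi A S \<circ>\<^sub>F Theta A T t s) P
    = ((sum_obj (S (T P)), Lambda A S (T P)), Delta A S (T P))"
  by (simp add: comp_functor_def Psi_def Theta_def)

text \<open>
  Write \<open>\<rho>\<close> for the morphism.  On the inclusions, \<open>\<rho> \<Delta> = g \<iota>(\<rho>)\<close> amounts to \<open>f \<iota>(t) = g \<iota>(t)\<close>, which holds because the image of
  \<open>f \<iota>(t)\<close> is in the eigenspace for \<open>1\<close>, and to \<open>-t \<lambda> = g \<iota>(f) \<iota>\<iota>(t)\<close>, which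
  follows from it by \<open>g \<iota>(f) = -f \<iota>(g)\<close>.
\<close>

lemma counit_double_double:
  assumes P: "P \<in> Obj (double (double A))"
  shows "counit P \<in> arr (double (double A)) (ob (Psi A S \<circ>\<^sub>F Theta A T t s) P) P"
proof -
  obtain X f g where Peq: "P = ((X, f), g)" and P: "((X, f), g) \<in> Obj (double (double A))"
    using P by (rule dd_cases)
  define U where U: "U = T ((X, f), g)"
  note D [simp] = double_double_ObjD[OF P] and [simp] = T_Obj[OF P, folded U] t_arr[OF P, folded U]
    involution_arr[OF P]
  note counit = counit[OF P, folded U]
  note it = involution_t[OF P, folded U] and fi = f_cmor_involution[OF P]
  have cit: "comp A (cob A U) (cob A X) (cob A X) (cmor A X X (involution A X f g)) (cmor A U X (t ((X, f), g)))
      = \<ominus>\<^bsub>Hom A (cob A U) (cob A X)\<^esub> cmor A U X (t ((X, f), g))"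
    by (simp add: it cmor_minus flip: cmor_comp)
  have "comp A (cob A U) (cob A X) X f
      (comp A (cob A U) (cob A X) (cob A X) (cmor A X X (involution A X f g)) (cmor A U X (t ((X, f), g))))
      = \<ominus>\<^bsub>Hom A (cob A U) X\<^esub> comp A (cob A U) (cob A X) X g (cmor A U X (t ((X, f), g)))"
    by (subst comp_reduce[OF fi]) (simp_all add: conj_calc)
  then have gt: "comp A (cob A U) (cob A X) X g (cmor A U X (t ((X, f), g)))
      = comp A (cob A U) (cob A X) X f (cmor A U X (t ((X, f), g)))"
    by (simp add: conj_calc cit minus_eq_iff del: cmor_comp)
  note [simp] = sum_calc counit counit(2,3)[THEN comp_reduce] counit(2,3)[THEN comp_cmor]
    comp_reduce[OF D(6)] comp_reduce[OF D(8)]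
  have gt': "comp A (cob A (cob A U)) (cob A (cob A X)) (cob A X) (cmor A (cob A X) X g)
      (cmor A (cob A U) (cob A X) (cmor A U X (t ((X, f), g))))
    = comp A (cob A (cob A U)) (cob A (cob A X)) (cob A X) (cmor A (cob A X) X f)
      (cmor A (cob A U) (cob A X) (cmor A U X (t ((X, f), g))))"
    by (simp add: gt flip: cmor_comp)
  show ?thesis
    unfolding Psi_Theta_obj Peq U[symmetric] double_double_arr
    by (intro conjI; (rule conj_sum_ext[where X = U and Z = X])?) (simp_all add: gt gt')
qed

text \<open>
  The inverse has the components \<open>s\<close> and \<open>\<iota>(s) f\<inverse>\<close>.  It is a right inverse since
  \<open>e + f \<iota>(e) f\<inverse> = (1 - h)/2 + (1 + h)/2 = 1\<close>.  It is a left inverse since the mixed terms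
  \<open>\<iota>(s) f\<inverse> t\<close> and \<open>s f \<iota>(t)\<close> vanish: inserting \<open>h\<close> in the middle shows that each is
  its own negative.
\<close>

lemma iso_arr_counit:
  assumes P: "((X, f), g) \<in> Obj (double (double A))"
  shows "iso_arr A (sum_obj (S (T ((X, f), g)))) X (counit ((X, f), g))"
proof -
  define U where U: "U = T ((X, f), g)"
  define t0 where t0: "t0 = t ((X, f), g)"
  define s0 where s0: "s0 = s ((X, f), g)"
  define h where h: "h = involution A X f g"
  define f' where f': "f' = inv_arr A (cob A X) X f"
  note D [simp] = double_double_ObjD[OF P] and counit [simp] = counit[OF P, folded U t0]
  note [simp] = T_Obj[OF P, folded U] t_arr[OF P, folded U t0] s_arr[OF P, folded U s0]
    involution_arr[OF P, folded h] inv_f_arr[OF P, folded f'] half_carrier half_idem_arr[OF P]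
    sum_calc counit(2,3)[THEN comp_reduce] S_eqs[THEN comp_reduce]
  note st = s_t[OF P, folded U t0 s0] and ts = t_s[OF P, folded U t0 s0]
  note it = involution_t[OF P, folded U t0 h] and si = s_involution[OF P, folded U s0 h]
  note ff' = f_inv_f[OF P, folded f'] and f'f = inv_f_f[OF P, folded f']
  note fh = f_cmor_involution[OF P, folded h]
  have hf: "comp A (cob A X) X X h f = g" by (rule involution_f[OF P, folded h])
  define \<chi> where "\<chi> = comp A X U (sum_obj (S U)) (in1 (S U)) s0 \<oplus>\<^bsub>Hom A X (sum_obj (S U))\<^esub>
    comp A X (cob A U) (sum_obj (S U)) (in2 (S U))
      (comp A X (cob A X) (cob A U) (cmor A X U s0) f')"
  have \<chi>: "\<chi> \<in> arr A X (sum_obj (S U))" by (simp add: \<chi>_def)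
  have cts: "comp A (cob A X) (cob A U) (cob A X) (cmor A U X t0) (cmor A X U s0)
      = cmor A X X (half_idem k A ((X, f), g))"
    by (simp add: ts flip: cmor_comp)
  have gf': "comp A X (cob A X) X g f' = h" by (simp add: h f' involution_def)
  have fef': "comp A X (cob A X) X f (comp A X (cob A X) (cob A X) (cmor A X X (half_idem k A ((X, f), g))) f')
      = half \<odot>\<^bsub>Hom A X X\<^esub> (Id A X \<oplus>\<^bsub>Hom A X X\<^esub> h)"
    by (simp add: half_idem_eq comp_reduce[OF fh] ff' gf' flip: h)
  interpret M: module k "Hom A X X" by (rule hom_module) simp_all
  \<comment> \<open>the projections onto the two eigenspaces add up to \<open>1\<close>\<close>
  have sum: "half_idem k A ((X, f), g) \<oplus>\<^bsub>Hom A X X\<^esub> half \<odot>\<^bsub>Hom A X X\<^esub> (Id A X \<oplus>\<^bsub>Hom A X X\<^esub> h) = Id A X"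
  proof -
    have "(Id A X \<oplus>\<^bsub>Hom A X X\<^esub> \<ominus>\<^bsub>Hom A X X\<^esub> h) \<oplus>\<^bsub>Hom A X X\<^esub> (Id A X \<oplus>\<^bsub>Hom A X X\<^esub> h)
        = Id A X \<oplus>\<^bsub>Hom A X X\<^esub> Id A X"
      by (simp add: M.a_comm[of "Id A X" h] M.a_assoc M.r_neg1)
    then show ?thesis
      using half_double[of X X "Id A X"] by (simp add: half_idem_eq flip: h M.smult_r_distr)
  qed
  have 1: "comp A X (sum_obj (S U)) X (counit ((X, f), g)) \<chi> = Id A X"
    by (simp add: \<chi>_def comp_reduce[OF cts] ts fef' sum)
  have sf't: "comp A U (cob A X) (cob A U) (cmor A X U s0) (comp A U X (cob A X) f' t0) = \<zero>\<^bsub>Hom A U (cob A U)\<^esub>"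
      (is "?x = _")
  proof (rule eq_minus_self_zero)
    have csi: "comp A (cob A X) (cob A X) (cob A U) (cmor A X U s0) (cmor A X X h)
        = \<ominus>\<^bsub>Hom A (cob A X) (cob A U)\<^esub> cmor A X U s0"
      by (simp add: si cmor_minus flip: cmor_comp)
    have "comp A U (cob A X) (cob A U) (cmor A X U s0) (comp A U X (cob A X) f' (comp A U X X h t0)) = ?x"
      by (subst comp_reduce[OF inv_f_involution[OF P, folded h f']])
        (simp_all add: comp_reduce[OF csi])
    then show "?x = \<ominus>\<^bsub>Hom A U (cob A U)\<^esub> ?x"
      by (simp add: it)
  qed simp_all
  have sft: "comp A (cob A U) X U s0 (comp A (cob A U) (cob A X) X f (cmor A U X t0)) = \<zero>\<^bsub>Hom A (cob A U) U\<^esub>"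
      (is "?x = _")
  proof (rule eq_minus_self_zero)
    have cit: "comp A (cob A U) (cob A X) (cob A X) (cmor A X X h) (cmor A U X t0)
        = \<ominus>\<^bsub>Hom A (cob A U) (cob A X)\<^esub> cmor A U X t0"
      by (simp add: it cmor_minus flip: cmor_comp)
    have fit: "comp A (cob A U) (cob A X) X f (cmor A U X t0) = comp A (cob A U) (cob A X) X g (cmor A U X t0)"
      using comp_reduce[OF fh, of "cob A U" "cmor A U X t0"] by (simp add: cit minus_eq_iff)
    have "\<ominus>\<^bsub>Hom A (cob A U) U\<^esub> ?x
        = comp A (cob A U) X U s0 (comp A (cob A U) X X h (comp A (cob A U) (cob A X) X f (cmor A U X t0)))"
      by (simp add: comp_reduce[OF si])
    also have "\<dots> = ?x"
      by (subst comp_reduce[OF hf]) (simp_all add: fit)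
    finally show "?x = \<ominus>\<^bsub>Hom A (cob A U) U\<^esub> ?x" ..
  qed simp_all
  have cst: "comp A (cob A U) (cob A X) (cob A U) (cmor A X U s0) (cmor A U X t0) = Id A (cob A U)"
    by (simp add: st flip: cmor_comp)
  have 2: "comp A (sum_obj (S U)) X (sum_obj (S U)) \<chi> (counit ((X, f), g)) = Id A (sum_obj (S U))"
    by (rule sum_ext[where X = U and Z = "sum_obj (S U)"])
      (simp_all add: \<chi> \<chi>_def sf't sft st comp_reduce[OF f'f] cst)
  show ?thesis
    using 1 2 \<chi> counit(1) unfolding iso_arr_def inverse_arrs_def U by auto
qed

lemma counit_natural:
  assumes P: "P \<in> Obj (double (double A))" and Q: "Q \<in> Obj (double (double A))"
    and \<phi>: "\<phi> \<in> arr (double (double A)) P Q"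
  shows "comp A (sum_obj (S (T P))) (sum_obj (S (T Q))) (base Q) (counit Q)
      (mor (Psi A S \<circ>\<^sub>F Theta A T t s) P Q \<phi>)
    = comp A (sum_obj (S (T P))) (base P) (base Q) \<phi> (counit P)"
proof -
  obtain X f g where Peq: "P = ((X, f), g)" and P': "((X, f), g) \<in> Obj (double (double A))"
    using P by (rule dd_cases)
  obtain Y f' g' where Qeq: "Q = ((Y, f'), g')" and Q': "((Y, f'), g') \<in> Obj (double (double A))"
    using Q by (rule dd_cases)
  define \<mu> where \<mu>: "\<mu> = mor (Theta A T t s) P Q \<phi>"
  have base: "base P = X" "base Q = Y" by (simp_all add: Peq Qeq)
  note [simp] = double_double_ObjD[OF P'] double_double_ObjD[OF Q'] \<phi>[unfolded Peq Qeq double_double_arr]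
    sum_calc split_typing[OF P, unfolded base] split_typing[OF Q, unfolded base]
    counit[OF P', folded Peq] counit[OF Q', folded Qeq]
    counit(2,3)[OF P', folded Peq, THEN comp_reduce] counit(2,3)[OF Q', folded Qeq, THEN comp_reduce]
    Theta_arr[OF P Q \<phi>, folded \<mu>]
  have t: "comp A (T P) (T Q) Y (t Q) \<mu> = comp A (T P) X Y \<phi> (t P)"
    using t_Theta[OF P Q \<phi>] by (simp add: \<mu> base)
  have ct: "comp A (cob A (T P)) (cob A (T Q)) (cob A Y) (cmor A (T Q) Y (t Q)) (cmor A (T P) (T Q) \<mu>)
      = comp A (cob A (T P)) (cob A X) (cob A Y) (cmor A X Y \<phi>) (cmor A (T P) X (t P))"
    by (simp add: t flip: cmor_comp)
  have \<phi>f: "comp A (cob A X) X Y \<phi> f = comp A (cob A X) (cob A Y) Y f' (cmor A X Y \<phi>)" by simp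
  have "comp A (sum_obj (S (T P))) (sum_obj (S (T Q))) Y (counit Q)
      (diag A S (T P) (T Q) \<mu> (cmor A (T P) (T Q) \<mu>))
    = comp A (sum_obj (S (T P))) X Y \<phi> (counit P)"
    by (rule sum_ext[where X = "T P" and Z = Y]) (simp_all add: t ct comp_reduce[OF \<phi>f])
  then show ?thesis
    by (simp add: comp_functor_def Psi_def base \<mu> Theta_def)
qed

text \<open>
  On the first inclusion both sides are \<open>t\<close> of the conjugate object, by \<open>t_theta\<close>.  On the second one
  the sign of \<open>\<psi>\<close> matches the sign of the structure morphism \<open>-\<iota>(f)\<close> of the conjugate object.
\<close>

lemma counit_conj:
  assumes P: "P \<in> Obj (double (double A))"
  defines "i \<equiv> cob (double (double A)) P"
  shows "comp A (sum_obj (S (T i))) (cob A (sum_obj (S (T P)))) (cob A (base P))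
      (cmor A (sum_obj (S (T P))) (base P) (counit P))
      (comp A (sum_obj (S (T i))) (sum_obj (S (cob A (T P)))) (cob A (sum_obj (S (T P)))) (psi A S (T P))
        (diag A S (T i) (cob A (T P)) (theta A T t s P) (cmor A (T i) (cob A (T P)) (theta A T t s P))))
    = counit i"
proof -
  obtain X f g where Peq: "P = ((X, f), g)" and P': "((X, f), g) \<in> Obj (double (double A))"
    using P by (rule dd_cases)
  have base: "base P = X" by (simp add: Peq)
  have ieq: "i = ((cob A X, \<ominus>\<^bsub>Hom A (cob A (cob A X)) (cob A X)\<^esub> cmor A (cob A X) X f),
        \<ominus>\<^bsub>Hom A (cob A (cob A X)) (cob A X)\<^esub> cmor A (cob A X) X g)"
    unfolding i_def Peq double_double_cob[OF P'] ..
  have i: "i \<in> Obj (double (double A))" unfolding i_def by (rule dd.cob_Obj[OF P])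
  note counit_i = counit[OF i[unfolded ieq], folded ieq]
  note [simp] = double_double_ObjD[OF P'] sum_calc split_typing[OF P, unfolded base]
    cob_split_typing[OF P, folded i_def, unfolded base] theta_arr[OF P, folded i_def]
    counit[OF P', folded Peq] counit_i counit_i(2,3)[THEN comp_reduce]
    counit(2,3)[OF P', folded Peq, THEN comp_cmor] counit(2,3)[OF P', folded Peq, THEN comp_cmor, THEN comp_reduce]
  note t = t_theta[OF P, folded i_def, unfolded base]
  have ct: "comp A (cob A (T i)) (cob A (cob A (T P))) (cob A (cob A X))
      (cmor A (cob A (T P)) (cob A X) (cmor A (T P) X (t P))) (cmor A (T i) (cob A (T P)) (theta A T t s P))
    = cmor A (T i) (cob A X) (t i)"
    by (simp add: t flip: cmor_comp)
  show ?thesis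
    unfolding base
    by (rule sum_ext[where X = "T i" and Z = "cob A X"]) (simp_all add: t ct)
qed

theorem conj_natural_iso_Psi_Theta:
  "conj_natural_iso (double (double A)) (double (double A))
    (conj_comp (double (double A)) A (double (double A)) (Psi A S, psi A S) (Theta A T t s, theta A T t s))
    (conj_id (double (double A))) counit"
  unfolding conj_natural_iso_def conj_comp_def conj_id_def prod.case natural_iso_def
proof (intro conjI ballI)
  fix P assume P: "P \<in> Obj (double (double A))"
  have PsiT: "ob (Psi A S \<circ>\<^sub>F Theta A T t s) P \<in> Obj (double (double A))"
    using P by (simp add: comp_functor_def Theta_def Psi_Obj split_typing)
  obtain X f g where Peq: "P = ((X, f), g)" and P': "((X, f), g) \<in> Obj (double (double A))"
    using P by (rule dd_cases)
  show "iso_arr (double (double A)) (ob (Psi A S \<circ>\<^sub>F Theta A T t s) P) (ob id_functor P) (counit P)"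
    using PsiT counit_double_double[OF P] P' iso_arr_counit[OF P']
    unfolding id_functor_def funct.simps Psi_Theta_obj unfolding Peq
    by (intro iso_arr_double_double)
  have "counit (cob (double (double A)) P) \<in> arr (double (double A))
      (ob (Psi A S \<circ>\<^sub>F Theta A T t s) (cob (double (double A)) P)) (cob (double (double A)) P)"
    by (intro counit_double_double dd.cob_Obj P)
  moreover have "ob (Psi A S \<circ>\<^sub>F Theta A T t s) (cob (double (double A)) P) \<in> Obj (double (double A))"
    using dd.cob_Obj[OF P] by (simp add: comp_functor_def Theta_def Psi_Obj split_typing)
  ultimately have "comp (double (double A)) (ob (Psi A S \<circ>\<^sub>F Theta A T t s) (cob (double (double A)) P))
        (cob (double (double A)) P) (cob (double (double A)) P)
        (Id (double (double A)) (cob (double (double A)) P)) (counit (cob (double (double A)) P))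
      = counit (cob (double (double A)) P)"
    by (intro dd.comp_Id_left dd.cob_Obj P)
  also have "\<dots> = comp (double (double A)) (ob (Psi A S \<circ>\<^sub>F Theta A T t s) (cob (double (double A)) P))
        (cob (double (double A)) (ob (Psi A S \<circ>\<^sub>F Theta A T t s) P)) (cob (double (double A)) P)
        (cmor (double (double A)) (ob (Psi A S \<circ>\<^sub>F Theta A T t s) P) P (counit P))
        (comp (double (double A)) (ob (Psi A S) (ob (Theta A T t s) (cob (double (double A)) P)))
          (ob (Psi A S) (cob A (ob (Theta A T t s) P)))
          (cob (double (double A)) (ob (Psi A S) (ob (Theta A T t s) P)))
          (psi A S (ob (Theta A T t s) P))
          (mor (Psi A S) (ob (Theta A T t s) (cob (double (double A)) P))
            (cob A (ob (Theta A T t s) P)) (theta A T t s P)))"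
    using counit_conj[OF P] base_cob[OF P] base_cob[OF PsiT]
    by (simp add: double_simps_fst cmor_double_double comp_functor_def Theta_def Psi_def)
  finally show "comp (double (double A)) (ob (Psi A S \<circ>\<^sub>F Theta A T t s) (cob (double (double A)) P))
        (ob id_functor (cob (double (double A)) P)) (cob (double (double A)) (ob id_functor P))
        (Id (double (double A)) (cob (double (double A)) P)) (counit (cob (double (double A)) P))
      = comp (double (double A)) (ob (Psi A S \<circ>\<^sub>F Theta A T t s) (cob (double (double A)) P))
        (cob (double (double A)) (ob (Psi A S \<circ>\<^sub>F Theta A T t s) P)) (cob (double (double A)) (ob id_functor P))
        (cmor (double (double A)) (ob (Psi A S \<circ>\<^sub>F Theta A T t s) P) (ob id_functor P) (counit P))
        (comp (double (double A)) (ob (Psi A S) (ob (Theta A T t s) (cob (double (double A)) P)))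
          (ob (Psi A S) (cob A (ob (Theta A T t s) P)))
          (cob (double (double A)) (ob (Psi A S) (ob (Theta A T t s) P)))
          (psi A S (ob (Theta A T t s) P))
          (mor (Psi A S) (ob (Theta A T t s) (cob (double (double A)) P))
            (cob A (ob (Theta A T t s) P)) (theta A T t s P)))"
    by (simp add: id_functor_def)
  fix Q \<phi> assume "Q \<in> Obj (double (double A))" "\<phi> \<in> arr (double (double A)) P Q"
  from counit_natural[OF P this]
  show "comp (double (double A)) (ob (Psi A S \<circ>\<^sub>F Theta A T t s) P) (ob (Psi A S \<circ>\<^sub>F Theta A T t s) Q)
        (ob id_functor Q) (counit Q) (mor (Psi A S \<circ>\<^sub>F Theta A T t s) P Q \<phi>)
      = comp (double (double A)) (ob (Psi A S \<circ>\<^sub>F Theta A T t s) P) (ob id_functor P) (ob id_functor Q)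
        (mor id_functor P Q \<phi>) (counit P)"
    by (simp add: id_functor_def double_simps_fst Psi_Theta_obj)
qed

theorem conj_equivalence_Theta_Psi:
  "conj_equivalence k (double (double A)) A (Theta A T t s, theta A T t s) (Psi A S, psi A S)"
  unfolding conj_equivalence_def
  using conj_morphism_Theta conj_morphism_Psi conj_natural_iso_Theta_Psi conj_natural_iso_Psi_Theta
  by blast

end

section \<open>The image of the doubling functor\<close>

context conj_category_splitting
begin

interpretation dbl: conj_category k "double A"
  by unfold_locales (rule category_with_conjugation_double)

text \<open>
  Let \<open>e\<close> be the idempotent of \<open>F'(X, f)\<close>.  Its involution \<open>h\<close> satisfies \<open>h in\<^sub>1 f = in\<^sub>2\<close>, so \<open>e\<close> has
  the matrix \<open>(1/2)(1, -f; -f\<inverse>, 1)\<close>.  Consequently \<open>2 s in\<^sub>1\<close> and \<open>pr\<^sub>1 t\<close> are inverse to each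
  other; the two equations are what this needs.  The biproduct lives in the double, but it is
  compared on inclusions in the original category, because \<open>h\<close> is in general not a morphism of the double.
\<close>

lemma half_idem_F:
  assumes S': "sum_choice (double A) S'" and P: "(X, f) \<in> Obj (double A)"
  defines "E \<equiv> ob (F_functor (double A) S') (X, f)"
  shows pr1_half_idem_in1: "comp A X (base E) X (pr1 (S' (X, f)))
      (comp A X (base E) (base E) (half_idem k A E) (in1 (S' (X, f)))) = half \<odot>\<^bsub>Hom A X X\<^esub> Id A X"
    and half_idem_in1_pr1: "comp A (base E) (base E) (base E) (half_idem k A E)
      (comp A (base E) X (base E) (in1 (S' (X, f)))
        (comp A (base E) (base E) X (pr1 (S' (X, f))) (half_idem k A E)))
      = half \<odot>\<^bsub>Hom A (base E) (base E)\<^esub> half_idem k A E"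
proof -
  interpret SD: conj_category_sums k "double A" S'
    by unfold_locales (rule S')
  define b where b: "b = S' (X, f)"
  obtain D d where Dd: "sum_obj b = (D, d)" by fastforce
  define L where L: "L = Lambda (double A) S' (X, f)"
  have E: "E = ((D, d), L)" by (simp add: E_def F_functor_def Dd L flip: b)
  have P': "((D, d), L) \<in> Obj (double (double A))"
    using linear_functorD(1)[OF SD.linear_functor_F P] by (simp flip: E E_def)
  define h where h: "h = involution A D d L"
  have dbl_b: "is_biproduct (double A) (X, f) (cob (double A) (X, f)) b"
    unfolding b by (rule SD.biproduct_S[OF P])
  let ?b = "\<lparr>sum_obj = D, in1 = in1 b, in2 = in2 b, pr1 = pr1 b, pr2 = pr2 b\<rparr>"
  have bA: "is_biproduct A X (cob A X) ?b"
    using biproduct_of_double[OF dbl_b[unfolded double_simps]] by (simp add: Dd)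
  have in1d: "comp A (cob A X) X D (in1 b) f = comp A (cob A X) (cob A D) D d (cmor A X D (in1 b))"
    using dbl_b by (simp add: is_biproduct_def Dd double_arr double_simps)
  \<comment> \<open>the structure morphism of \<open>F'(X, f)\<close> in the double of the double is \<open>L\<close>, the matrix \<open>\<Lambda>\<close> of the double\<close>
  have Lin1: "comp A (cob A X) (cob A D) D L (cmor A X D (in1 b)) = in2 b"
    using SD.Lambda_in1[OF P] by (simp add: Dd L double_simps flip: b)
  note bD = biproductD[OF bA, simplified]
  note [simp] = bD double_double_ObjD[OF P'] double_ObjD[OF P] conj_calc involution_arr[OF P', folded h]
    half_idem_arr[OF P'] half_carrier
  have f: "iso_arr A (cob A X) X f" by simp
  \<comment> \<open>the involution exchanges the two summands\<close>
  have hin1f: "comp A (cob A X) X D (comp A X D D h (in1 b)) f = in2 b"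
  proof -
    have "comp A (cob A X) X D (comp A X D D h (in1 b)) f
        = comp A (cob A X) D D h (comp A (cob A X) (cob A D) D d (cmor A X D (in1 b)))"
      by (simp flip: in1d)
    also have "\<dots> = comp A (cob A X) (cob A D) D L (cmor A X D (in1 b))"
      by (subst comp_reduce[OF involution_f[OF P', folded h]]) simp_all
    finally show ?thesis by (simp only: Lin1)
  qed
  have pr1hin1: "comp A X D X (pr1 b) (comp A X D D h (in1 b)) = \<zero>\<^bsub>Hom A X X\<^esub>"
    by (rule iso_cancel_right[where Z = X, OF _ _ _ f]) (use hin1f in simp_all)
  have eh: "comp A D D D (half_idem k A ((D, d), L)) h = \<ominus>\<^bsub>Hom A D D\<^esub> half_idem k A ((D, d), L)"
    unfolding h by (rule half_idem_involution[OF P'])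
  have ein2: "comp A (cob A X) D D (half_idem k A ((D, d), L)) (in2 b)
      = \<ominus>\<^bsub>Hom A (cob A X) D\<^esub> comp A (cob A X) X D (comp A X D D (half_idem k A ((D, d), L)) (in1 b)) f"
    using comp_reduce[OF eh, of "cob A X" "comp A (cob A X) X D (in1 b) f"] by (simp flip: hin1f)
  have 1: "comp A X D X (pr1 b) (comp A X D D (half_idem k A ((D, d), L)) (in1 b)) = half \<odot>\<^bsub>Hom A X X\<^esub> Id A X"
    by (simp add: half_idem_eq pr1hin1 flip: h)
  have pr1e: "comp A (cob A X) D X (pr1 b) (comp A (cob A X) D D (half_idem k A ((D, d), L))
      (comp A (cob A X) X D (in1 b) f)) = half \<odot>\<^bsub>Hom A (cob A X) X\<^esub> f"
    using comp_reduce[OF 1, of "cob A X" f] by simp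
  show "comp A X (base E) X (pr1 (S' (X, f)))
      (comp A X (base E) (base E) (half_idem k A E) (in1 (S' (X, f)))) = half \<odot>\<^bsub>Hom A X X\<^esub> Id A X"
    using 1 by (simp add: E flip: b)
  have "comp A D D D (half_idem k A ((D, d), L))
      (comp A D X D (in1 b) (comp A D D X (pr1 b) (half_idem k A ((D, d), L))))
      = half \<odot>\<^bsub>Hom A D D\<^esub> half_idem k A ((D, d), L)"
    by (rule biproduct_ext[where Z = D, OF _ _ _ bA])
      (simp_all add: 1 pr1e ein2 module.smult_r_minus[OF hom_module])
  then show "comp A (base E) (base E) (base E) (half_idem k A E)
      (comp A (base E) X (base E) (in1 (S' (X, f)))
        (comp A (base E) (base E) X (pr1 (S' (X, f))) (half_idem k A E)))
      = half \<odot>\<^bsub>Hom A (base E) (base E)\<^esub> half_idem k A E"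
    by (simp add: E flip: b)
qed

theorem isomorphic_functors_Theta_F:
  assumes S': "sum_choice (double A) S'"
  shows "isomorphic_functors k (double A) A (Theta A T t s \<circ>\<^sub>F F_functor (double A) S') G_functor"
proof -
  interpret SD: conj_category_sums k "double A" S'
    by unfold_locales (rule S')
  let ?F = "F_functor (double A) S'"
  define \<rho> where "\<rho> P = comp A (T (ob ?F P)) (base (ob ?F P)) (fst P) (pr1 (S' P)) (t (ob ?F P))" for P
  have ob: "ob (Theta A T t s) = T" by (simp add: Theta_def)
  have F: "ob ?F P \<in> Obj (double (double A))" if "P \<in> Obj (double A)" for P
    using linear_functorD(1)[OF SD.linear_functor_F that] .
  have base: "base (ob ?F P) = fst (sum_obj (S' P))" for P
    by (simp add: F_functor_def)
  have arrs: "fst P \<in> Obj A" "base (ob ?F P) \<in> Obj A" "T (ob ?F P) \<in> Obj A"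
    "t (ob ?F P) \<in> arr A (T (ob ?F P)) (base (ob ?F P))" "s (ob ?F P) \<in> arr A (base (ob ?F P)) (T (ob ?F P))"
    "pr1 (S' P) \<in> arr A (base (ob ?F P)) (fst P)" "in1 (S' P) \<in> arr A (fst P) (base (ob ?F P))"
    if P: "P \<in> Obj (double A)" for P
    using split_typing[OF F[OF P]] base_Obj[OF F[OF P]] fst_arr[OF SD.S_typing(4)[OF P]] fst_arr[OF SD.S_typing(2)[OF P]] P
    by (cases P; simp add: base double_Obj)+
  have "iso_arr A (T (ob ?F P)) (fst P) (\<rho> P)" if P: "P \<in> Obj (double A)" for P
  proof -
    \<comment> \<open>the factor \<open>2\<close> compensates for \<open>pr\<^sub>1 e in\<^sub>1 = 1/2\<close>\<close>
    define \<sigma> where "\<sigma> = (\<one> \<oplus> \<one>) \<odot>\<^bsub>Hom A (fst P) (T (ob ?F P))\<^esub>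
      comp A (fst P) (base (ob ?F P)) (T (ob ?F P)) (s (ob ?F P)) (in1 (S' P))"
    have two: "\<one> \<oplus> \<one> \<in> carrier k" by simp
    have twohalf: "(\<one> \<oplus> \<one>) \<odot>\<^bsub>Hom A Y Z\<^esub> (half \<odot>\<^bsub>Hom A Y Z\<^esub> x) = x"
      if "Y \<in> Obj A" "Z \<in> Obj A" "x \<in> arr A Y Z" for Y Z x
    proof -
      interpret module k "Hom A Y Z" by (rule hom_module) fact+
      show ?thesis using that two_unit by (simp flip: smult_assoc1)
    qed
    note [simp] = arrs[OF P] calc two half_carrier split_typing(4)[OF F[OF P]]
    note split = split_eqs[OF F[OF P]]
    obtain X f where Pf: "P = (X, f)" by fastforce
    note F1 = pr1_half_idem_in1[OF S', of X f, folded Pf, OF P] and F2 = half_idem_in1_pr1[OF S', of X f, folded Pf, OF P]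
    have X: "X = fst P" by (simp add: Pf)
    have "comp A (T (ob ?F P)) (base (ob ?F P)) (T (ob ?F P)) (s (ob ?F P))
        (comp A (T (ob ?F P)) (fst P) (base (ob ?F P)) (in1 (S' P))
          (comp A (T (ob ?F P)) (base (ob ?F P)) (fst P) (pr1 (S' P)) (t (ob ?F P))))
      = comp A (T (ob ?F P)) (base (ob ?F P)) (T (ob ?F P)) (s (ob ?F P))
        (comp A (T (ob ?F P)) (base (ob ?F P)) (base (ob ?F P))
          (comp A (base (ob ?F P)) (base (ob ?F P)) (base (ob ?F P)) (half_idem k A (ob ?F P))
            (comp A (base (ob ?F P)) (fst P) (base (ob ?F P)) (in1 (S' P))
              (comp A (base (ob ?F P)) (base (ob ?F P)) (fst P) (pr1 (S' P)) (half_idem k A (ob ?F P)))))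
          (t (ob ?F P)))"
      by (simp add: split comp_reduce[OF split(4)])
    also have "\<dots> = half \<odot>\<^bsub>Hom A (T (ob ?F P)) (T (ob ?F P))\<^esub> Id A (T (ob ?F P))"
      by (subst F2[unfolded X]) (simp add: split)
    finally have "inverse_arrs A (T (ob ?F P)) (fst P) (\<rho> P) \<sigma>"
      using F1[unfolded X] unfolding inverse_arrs_def \<rho>_def \<sigma>_def
      by (simp add: comp_reduce[OF split(2)] twohalf)
    then show ?thesis by (auto simp: iso_arr_def)
  qed
  moreover have "comp A (T (ob ?F P)) (T (ob ?F Q)) (fst Q) (\<rho> Q) (mor (Theta A T t s) (ob ?F P) (ob ?F Q) (mor ?F P Q \<phi>))
      = comp A (T (ob ?F P)) (fst P) (fst Q) \<phi> (\<rho> P)"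
    if P: "P \<in> Obj (double A)" and Q: "Q \<in> Obj (double A)" and \<phi>: "\<phi> \<in> arr (double A) P Q" for P Q \<phi>
  proof -
    note F\<phi> = linear_functorD(2)[OF SD.linear_functor_F P Q \<phi>]
    note [simp] = arrs[OF P] arrs[OF Q] calc fst_arr[OF \<phi>] base_arr[OF F\<phi>] Theta_arr[OF F[OF P] F[OF Q] F\<phi>]
    have pr: "comp A (base (ob ?F P)) (base (ob ?F Q)) (fst Q) (pr1 (S' Q)) (mor ?F P Q \<phi>)
        = comp A (base (ob ?F P)) (fst P) (fst Q) \<phi> (pr1 (S' P))"
      using SD.pr1_diag[OF P Q \<phi> dbl.cmor_arr[OF P Q \<phi>]]
      by (simp add: F_functor_def double_simps_fst)
    show ?thesis
      by (simp add: \<rho>_def t_Theta[OF F[OF P] F[OF Q] F\<phi>] comp_reduce[OF pr])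
  qed
  ultimately have "natural_iso (double A) A (Theta A T t s \<circ>\<^sub>F ?F) G_functor \<rho>"
    by (simp add: natural_iso_def comp_functor_def G_functor_def ob)
  then show ?thesis
    unfolding isomorphic_functors_def
    using linear_functor_comp[OF SD.linear_functor_F linear_functor_Theta] linear_functor_G by blast
qed

end

theorem theorem1p2:
  fixes k :: "'k ring"
    and A :: "('o, 'm, 'k) conjcat"
    and S :: "'o \<Rightarrow> ('o, 'm) biprod"
    and S' :: "'o \<times> 'm \<Rightarrow> ('o \<times> 'm, 'm) biprod"
    and T :: "('o \<times> 'm) \<times> 'm \<Rightarrow> 'o"
    and t s :: "('o \<times> 'm) \<times> 'm \<Rightarrow> 'm"
  assumes "cring k" and "\<one>\<^bsub>k\<^esub> \<oplus>\<^bsub>k\<^esub> \<one>\<^bsub>k\<^esub> \<in> Units k"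
    and "category_with_conjugation k A"
    and "sum_choice A S" and "sum_choice (double A) S'"
    and "splitting_choice k A T t s"
  shows "conj_equivalence k (double (double A)) A (Theta A T t s, theta A T t s) (Psi A S, psi A S)
    \<and> isomorphic_functors k A (double A) (G_functor \<circ>\<^sub>F Psi A S) (F_functor A S)
    \<and> isomorphic_functors k (double A) A (Theta A T t s \<circ>\<^sub>F F_functor (double A) S') G_functor"
proof -
  interpret conj_category_choices k A S T t s
    by unfold_locales (use assms in auto)
  interpret D: linear_category k "double A" by (rule linear_category_double)
  show ?thesis
    using conj_equivalence_Theta_Psi D.isomorphic_functors_refl[OF linear_functor_F]
      isomorphic_functors_Theta_F[OF assms(5)]
    by (simp add: G_Psi)
qed

end
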